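(* There is a polynomial $\vartheta$ in four variables such that the following holds. Let $A\in\mathbb{R}^{n_A\times R}$, $B\in\mathbb{R}^{n_B\times R}$, $C\in\mathbb{R}^{n_C\times R}$ be matrices which are $\rho_A$-, $\rho_B$-, $\rho_C$-bounded respectively, with $\mathrm{K\text{-}rank}_{\tau_A}(A)=k_A$, $\mathrm{K\text{-}rank}_{\tau_B}(B)=k_B$, $\mathrm{K\text{-}rank}_{\tau_C}(C)=k_C$ satisfying $k_A+k_B+k_C\ge 2R+2$, and let $T=[A\;B\;C]$. Let $\rho'_A,\rho'_B,\rho'_C$ be further parameters. Then for every $0<\varepsilon'<1$, setting \[\varepsilon=\frac{\varepsilon'}{R^6\,\vartheta(\tau_A,\rho_A,\rho'_A,n_A)\,\vartheta(\tau_B,\rho_B,\rho'_B,n_B)\,\vartheta(\tau_C,\rho_C,\rho'_C,n_C)},\] the following holds: for any matrices $A'\in\mathbb{R}^{n_A\times R}$, $B'\in\mathbb{R}^{n_B\times R}$, $C'\in\mathbb{R}^{n_C\times R}$ that are $\rho'_A$-, $\rho'_B$-, $\rho'_C$-bounded respectively and satisfy $\|[A'\;B'\;C']-[A\;B\;C]\|_F\le\varepsilon$, there exist an $R\times R$ permutation matrix $\Pi$ and diagonal $R\times R$ matrices $\Lambda_A,\Lambda_B,\Lambda_C$ such that \[\|\Lambda_A\Lambda_B\Lambda_C-I\|_F\le\varepsilon',\quad \|A'-A\Pi\Lambda_A\|_F\le\varepsilon',\quad \|B'-B\Pi\Lambda_B\|_F\le\varepsilon',\quad \|C'-C\Pi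\Lambda_C\|_F\le\varepsilon'.\]
   Context: For matrices $U^{(1)},\dots,U^{(\ell)}$ with $U^{(i)}\in\mathbb{R}^{n_i\times R}$, $[U^{(1)}\;\cdots\;U^{(\ell)}]:=\sum_{r=1}^R U^{(1)}_r\otimes\cdots\otimes U^{(\ell)}_r$, where $X_r$ denotes the $r$-th column of $X$; $\|\cdot\|_F$ is the Frobenius norm (square root of sum of squared entries). A matrix is $\rho$-bounded if each of its columns has Euclidean length at most $\rho$. For a matrix $X$ with $R$ columns and $\tau>0$, $\mathrm{K\text{-}rank}_\tau(X)$ is the largest $k$ such that every submatrix $X_{|S}$ formed by $k$ columns of $X$ has $k$-th largest singular value $\sigma_k(X_{|S})\ge 1/\tau$. Standing normalization: all parameters $\tau_\ast,\rho_\ast,\rho'_\ast$ are at least $1$. *)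

theory Defs
  imports
    Complex_Main
    "HOL-Computational_Algebra.Polynomial"
    "HOL-Combinatorics.Permutations"
    "Jordan_Normal_Form.Char_Poly"
    "Jordan_Normal_Form.DL_Submatrix"
begin

text \<open>
  Dimensions are natural numbers quantified inside the statement, so matrices are elements of
  \<^typ>\<open>real mat\<close> with explicit carriers. Rows and columns are indexed from 0.
\<close>

definition polynomial4 :: "(real \<Rightarrow> real \<Rightarrow> real \<Rightarrow> real \<Rightarrow> real) \<Rightarrow> bool" where
  "polynomial4 f \<longleftrightarrow> (\<exists>(d :: nat) (c :: nat \<Rightarrow> nat \<Rightarrow> nat \<Rightarrow> nat \<Rightarrow> real). \<forall>w x y z.
     f w x y z = (\<Sum>i\<le>d. \<Sum>j\<le>d. \<Sum>k\<le>d. \<Sum>l\<le>d. c i j k l * w ^ i * x ^ j * y ^ k * z ^ l))"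

text \<open>
  A tensor of format \<open>[n\<^sub>0, \<dots>, n\<^sub>l]\<close> is a function on index lists; only its values on
  \<open>tensor_indices [n\<^sub>0, \<dots>, n\<^sub>l]\<close> (the lists \<open>[i\<^sub>0, \<dots>, i\<^sub>l]\<close> with \<open>i\<^sub>j < n\<^sub>j\<close>) are meaningful.
\<close>

definition tensor_indices :: "nat list \<Rightarrow> nat list set" where
  "tensor_indices ns = listset (map (\<lambda>n. {..<n}) ns)"

definition outer_product :: "real vec list \<Rightarrow> nat list \<Rightarrow> real" where
  "outer_product vs ix = (\<Prod>j<length vs. (vs ! j) $ (ix ! j))"

text \<open>\<open>cp_tensor R [U\<^sub>0, \<dots>, U\<^sub>l]\<close> is the sum of the outer products of the \<open>r\<close>-th columns,
  for \<open>r < R\<close>, where every \<open>U\<^sub>j\<close> has \<open>R\<close> columns.\<close>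

definition cp_tensor :: "nat \<Rightarrow> real mat list \<Rightarrow> nat list \<Rightarrow> real" where
  "cp_tensor R Us ix = (\<Sum>r<R. outer_product (map (\<lambda>U. col U r) Us) ix)"

definition tensor_fnorm :: "nat list \<Rightarrow> (nat list \<Rightarrow> real) \<Rightarrow> real" where
  "tensor_fnorm ns T = sqrt (\<Sum>ix\<in>tensor_indices ns. (T ix)\<^sup>2)"

definition mat_fnorm :: "real mat \<Rightarrow> real" where
  "mat_fnorm X = sqrt (\<Sum>i<dim_row X. \<Sum>j<dim_col X. (X $$ (i, j))\<^sup>2)"

definition col_bounded :: "real \<Rightarrow> real mat \<Rightarrow> bool" where
  "col_bounded \<rho> X \<longleftrightarrow> (\<forall>r<dim_col X. sqrt (col X r \<bullet> col X r) \<le> \<rho>)"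

text \<open>
  The singular values of \<open>X\<close>: the square roots of the eigenvalues, with multiplicity, of the
  Gram matrix \<open>X\<^sup>T X\<close>, in decreasing order. There are exactly \<open>dim_col X\<close> of them, so a matrix
  with more columns than rows has trailing zero singular values.
\<close>

definition singular_values :: "real mat \<Rightarrow> real list" where
  "singular_values X =
     rev (sorted_list_of_multiset
       (image_mset sqrt (proots (char_poly (transpose_mat X * X)))))"

text \<open>The \<open>k\<close>-th largest singular value, counted from 1.\<close>

definition sing_val :: "nat \<Rightarrow> real mat \<Rightarrow> real" where
  "sing_val k X = singular_values X ! (k - 1)"

text \<open>
  The bound \<open>k \<le> dim_col X\<close> is needed since the condition is vacuous for larger \<open>k\<close>;
  the condition is regarded as satisfied for \<open>k = 0\<close>, so the set below is finite and nonempty.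
\<close>

definition K_rank :: "real \<Rightarrow> real mat \<Rightarrow> nat" where
  "K_rank \<tau> X = Max {k. k \<le> dim_col X \<and>
     (1 \<le> k \<longrightarrow> (\<forall>S. S \<subseteq> {..<dim_col X} \<and> card S = k \<longrightarrow>
        1 / \<tau> \<le> sing_val k (submatrix X UNIV S)))}"

definition permutation_matrix :: "nat \<Rightarrow> real mat \<Rightarrow> bool" where
  "permutation_matrix n P \<longleftrightarrow>
     (\<exists>p. p permutes {..<n} \<and> P = mat n n (\<lambda>(i, j). if i = p j then 1 else 0))"

end

theory Submission
  imports Defs "HOL-Analysis.Inner_Product" "HOL-Analysis.L2_Norm" "HOL-Analysis.Function_Topology"
    "HOL-Library.Poly_Mapping"
begin

text \<open>
  Contracting the tensor along \<open>x\<close> gives the matrix \<open>A diag(x\<^sup>T C) B\<^sup>T\<close>. If \<open>x\<^sup>T C'\<close> has few nonzero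
  entries, this matrix is close to one of small rank, and the conditioning of \<open>A\<close> and \<open>B\<close> forces
  \<open>x\<^sup>T C\<close> to have equally few large entries. Choosing \<open>x\<close> orthogonal to a set \<open>S\<close> of columns of
  \<open>C'\<close> but generic otherwise shows that at least \<open>card S\<close> columns of \<open>C\<close> are close to the span of the
  columns of \<open>C'\<close> in \<open>S\<close>, as soon as \<open>card S \<ge> k\<^sub>C - 1\<close>.

  For \<open>card S = k\<^sub>C - 1\<close> the conditioning of \<open>C\<close> makes this correspondence rigid, and Kruskal's counting
  argument extends it one dimension further down. From there no induction on the dimension
  is needed, which would multiply the errors: the columns of \<open>C\<close> belonging to \<open>S\<close> are well
  conditioned, so the expansions of a column \<open>s \<in> S\<close> of \<open>C'\<close> in the columns belonging to the sets \<open>S - {t}\<close>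
  all agree up to a small error, and only one coefficient survives. The three resulting matchings
  of columns coincide because suitable contractions of the tensor isolate a single column.

  Since \<open>2R + 2 \<le> n\<^sub>A + n\<^sub>B + n\<^sub>C\<close>, all parameters are bounded by one number \<open>L\<close>, and every loss is a
  fixed power of \<open>L\<close>.
\<close>

section \<open>Kernels, dual vectors and generic vectors\<close>

text \<open>Nothing is assumed about the conditioning of the primed matrices, so lower bounds on the
  distance of columns of C' from a span have to be extracted from the tensor itself.
  \<open>not_near_small_span\<close> provides them, and it creates two scales: errors have the form
  \<open>L ^ m * e\<close>, while \<open>kC - 1\<close> or \<open>kC\<close> columns of C' cannot
  all lie within \<open>1 / L ^ 12\<close> of a span of fewer vectors. Disjointness and injectivity
  always come from comparing an error with this threshold. The errors grow as m = 6 (columns near a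
  span), 20 (one dimension lower), 27 (single columns), 31 (tensor with all factors replaced), 34
  (product of the scalings). Since \<open>L ^ 27 * e\<close> must stay below the threshold with a
  numerical factor to spare, the polynomial has to pay for the power 27 + 12 + 1 = 40. A column is
  determined only up to a scalar, and each factor yields its own permutation, which is why the three
  matchings have to be compared at the end.\<close>

lemma nontrivial_kernel:
  fixes f :: "'j \<Rightarrow> 'i \<Rightarrow> real"
  assumes "finite J" "finite I" "card J < card I"
  shows "\<exists>v. (\<forall>j\<in>J. (\<Sum>i\<in>I. f j i * v i) = 0) \<and> (\<exists>i\<in>I. v i \<noteq> 0)"
  using assms
proof (induction J arbitrary: I f rule: finite_induct)
  case empty
  then have "I \<noteq> {}" by auto
  then show ?case by (intro exI[of _ "\<lambda>_. 1"]) auto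
next
  case (insert j J)
  show ?case
  proof (cases "\<forall>i\<in>I. f j i = 0")
    case True
    from insert obtain v where "\<forall>j\<in>J. (\<Sum>i\<in>I. f j i * v i) = 0" "\<exists>i\<in>I. v i \<noteq> 0"
      by (metis card_insert_disjoint Suc_lessD)
    with True show ?thesis by (intro exI[of _ v]) auto
  next
    case False
    \<comment> \<open>Gaussian elimination with pivot \<open>m\<close>: row \<open>j\<close> removes
      the unknown \<open>m\<close> from the other rows and is solved for \<open>w m\<close> at the
      end.\<close>
    then obtain m where m: "m \<in> I" "f j m \<noteq> 0" by blast
    have "card J < card (I - {m})" using insert m by simp
    then obtain v where v: "\<forall>j'\<in>J. (\<Sum>i\<in>I - {m}. (f j' i - f j' m * f j i / f j m) * v i) = 0"
      and nz: "\<exists>i\<in>I - {m}. v i \<noteq> 0"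
      using insert.IH[of "I - {m}" "\<lambda>j' i. f j' i - f j' m * f j i / f j m"] insert.prems by auto
    define w where "w = v(m := - (\<Sum>i\<in>I - {m}. f j i * v i) / f j m)"
    have split: "(\<Sum>i\<in>I. f j' i * w i)
        = (\<Sum>i\<in>I - {m}. f j' i * v i) - f j' m * (\<Sum>i\<in>I - {m}. f j i * v i) / f j m" for j'
      using insert.prems m by (simp add: sum.remove[of I m] w_def)
    have "(\<Sum>i\<in>I. f j' i * w i) = (\<Sum>i\<in>I - {m}. (f j' i - f j' m * f j i / f j m) * v i)" for j'
      unfolding split
      by (simp add: left_diff_distrib sum_subtractf sum_distrib_left sum_divide_distrib mult.assoc)
    moreover have "(\<Sum>i\<in>I. f j i * w i) = 0" using m by (simp add: split)
    moreover have "\<exists>i\<in>I. w i \<noteq> 0" using nz by (auto simp: w_def)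
    ultimately show ?thesis using v by (intro exI[of _ w]) (metis insertE)
  qed
qed

text \<open>Dividing by an entry of largest modulus gives bounded coefficients, one of them equal to
  1, so that conclusions are quantitative without any conditioning of \<open>f\<close>.\<close>

lemma normalized_kernel:
  fixes f :: "'j \<Rightarrow> 'i \<Rightarrow> real"
  assumes "finite J" "finite I" "card J < card I"
  obtains v m where "\<And>j. j \<in> J \<Longrightarrow> (\<Sum>i\<in>I. f j i * v i) = 0"
    "m \<in> I" "v m = 1" "\<And>i. i \<in> I \<Longrightarrow> \<bar>v i\<bar> \<le> 1"
proof -
  obtain v where v: "\<forall>j\<in>J. (\<Sum>i\<in>I. f j i * v i) = 0" "\<exists>i\<in>I. v i \<noteq> 0"
    using nontrivial_kernel[OF assms] by blast
  have "I \<noteq> {}" using v(2) by blast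
  then have "Max ((\<lambda>i. \<bar>v i\<bar>) ` I) \<in> (\<lambda>i. \<bar>v i\<bar>) ` I" using assms(2) by (intro Max_in) auto
  then obtain m where m: "m \<in> I" "Max ((\<lambda>i. \<bar>v i\<bar>) ` I) = \<bar>v m\<bar>" by (rule imageE)
  have le: "\<bar>v i\<bar> \<le> \<bar>v m\<bar>" if "i \<in> I" for i
    unfolding m(2)[symmetric] using assms(2) that by (intro Max_ge) auto
  have nz: "v m \<noteq> 0"
  proof
    assume "v m = 0"
    then have "v i = 0" if "i \<in> I" for i using le[OF that] by simp
    with v(2) show False by blast
  qed
  show ?thesis
  proof (rule that[of "\<lambda>i. v i / v m" m])
    fix j assume "j \<in> J"
    then have "(\<Sum>i\<in>I. f j i * v i) / v m = 0" using v by simp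
    then show "(\<Sum>i\<in>I. f j i * (v i / v m)) = 0" by (simp add: sum_divide_distrib)
  qed (use m le nz in \<open>simp_all add: abs_divide divide_le_eq\<close>)
qed

section \<open>Spans of finite families and orthogonal projection\<close>

lemma span_image_sumE:
  assumes "finite S" "v \<in> span (c ` S)"
  obtains g :: "'i \<Rightarrow> real" where "v = (\<Sum>s\<in>S. g s *\<^sub>R c s)"
proof -
  let ?X = "range (\<lambda>g. \<Sum>s\<in>S. g s *\<^sub>R c s)"
  have "subspace ?X"
    unfolding subspace_def
  proof (intro conjI ballI allI)
    show "0 \<in> ?X" by (auto intro!: image_eqI[of _ _ "\<lambda>_. 0"])
  next
    fix x y assume "x \<in> ?X" "y \<in> ?X"
    then obtain g h where "x = (\<Sum>s\<in>S. g s *\<^sub>R c s)" "y = (\<Sum>s\<in>S. h s *\<^sub>R c s)" by auto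
    then show "x + y \<in> ?X"
      by (auto intro!: image_eqI[of _ _ "\<lambda>s. g s + h s"] simp: scaleR_add_left sum.distrib)
  next
    fix t x assume "x \<in> ?X"
    then obtain g where "x = (\<Sum>s\<in>S. g s *\<^sub>R c s)" by auto
    then show "t *\<^sub>R x \<in> ?X"
      by (auto intro!: image_eqI[of _ _ "\<lambda>s. t * g s"] simp: scaleR_sum_right)
  qed
  moreover have "c ` S \<subseteq> ?X"
  proof
    fix x assume "x \<in> c ` S"
    then obtain s where s: "s \<in> S" "x = c s" by auto
    have "(\<Sum>i\<in>S. (if i = s then 1 else 0) *\<^sub>R c i) = (\<Sum>i\<in>S. if i = s then c i else 0)"
      by (intro sum.cong) auto
    also have "\<dots> = c s" using s assms by simp
    finally show "x \<in> ?X" using s by (auto intro!: image_eqI[of _ _ "\<lambda>i. if i = s then 1 else 0"])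
  qed
  ultimately have "span (c ` S) \<subseteq> ?X" by (rule span_minimal[rotated])
  with assms that show thesis by auto
qed

lemma sum_in_span_image:
  "T \<subseteq> S \<Longrightarrow> (\<Sum>s\<in>T. g s *\<^sub>R c s) \<in> span (c ` S)"
  by (intro span_sum span_scale span_base) auto

lemma inner_span_zero:
  assumes "w \<in> span S" "\<And>s. s \<in> S \<Longrightarrow> inner p s = 0"
  shows "inner p w = (0::real)"
  using assms(1)
proof (rule span_induct)
  show "subspace {w. inner p w = 0}" by (simp add: subspace_def inner_right_distrib)
qed (use assms(2) in auto)

text \<open>One Gram-Schmidt step per vector: the residual \<open>xp\<close> of the new vector is
  orthogonal to \<open>S\<close>, and a multiple of it is subtracted from the residual of
  \<open>v\<close>.\<close>

lemma orthogonal_decomposition: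
  fixes v :: "'a::real_inner"
  assumes "finite S"
  shows "\<exists>u p. u \<in> span S \<and> v = u + p \<and> (\<forall>w\<in>S. inner p w = 0)"
  using assms
proof (induction S arbitrary: v rule: finite_induct)
  case empty
  then show ?case by (intro exI[of _ 0] exI[of _ v]) auto
next
  case (insert x S)
  obtain xu xp where x: "xu \<in> span S" "x = xu + xp" "\<forall>w\<in>S. inner xp w = 0"
    using insert.IH by blast
  obtain vu vp where v: "vu \<in> span S" "v = vu + vp" "\<forall>w\<in>S. inner vp w = 0"
    using insert.IH by blast
  \<comment> \<open>For \<open>xp = 0\<close> the division by zero gives \<open>t = 0\<close>, as it
    should.\<close>
  define t where "t = inner vp xp / inner xp xp"
  have xs: "xu \<in> span (insert x S)" "vu \<in> span (insert x S)"
    using x(1) v(1) span_mono[of S "insert x S"] by auto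
  have "x \<in> span (insert x S)" by (intro span_base) auto
  then have "xp \<in> span (insert x S)"
    using xs x(2) span_diff[of x "insert x S" xu] by simp
  then have "vu + t *\<^sub>R xp \<in> span (insert x S)" using xs by (intro span_add span_scale)
  moreover have "\<forall>w\<in>insert x S. inner (vp - t *\<^sub>R xp) w = 0"
  proof (rule ballI)
    fix w assume w: "w \<in> insert x S"
    have S0: "\<And>w. w \<in> S \<Longrightarrow> inner (vp - t *\<^sub>R xp) w = 0" using x v by (simp add: inner_diff_left)
    have "inner (vp - t *\<^sub>R xp) x = inner (vp - t *\<^sub>R xp) xu + inner (vp - t *\<^sub>R xp) xp"
      using x by (simp add: inner_add_right)
    also have "inner (vp - t *\<^sub>R xp) xu = 0" using inner_span_zero[OF x(1)] S0 by blast
    also have "inner (vp - t *\<^sub>R xp) xp = 0"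
      by (cases "xp = 0") (auto simp: inner_diff_left t_def)
    finally show "inner (vp - t *\<^sub>R xp) w = 0" using w S0 by auto
  qed
  moreover have "v = (vu + t *\<^sub>R xp) + (vp - t *\<^sub>R xp)" using v by simp
  ultimately show ?case by blast
qed

text \<open>The form in which a bound \<open>1 / L\<close> on a least singular value is used:
  coefficient by coefficient. Sets with fewer than \<open>k\<close> elements are included so that
  the property passes to subsets.\<close>

definition well_conditioned :: "nat \<Rightarrow> real \<Rightarrow> 'i set \<Rightarrow> ('i \<Rightarrow> 'a::real_inner) \<Rightarrow> bool" where
  "well_conditioned k L I a \<longleftrightarrow> (\<forall>S f. S \<subseteq> I \<and> card S \<le> k \<longrightarrow>
     (\<forall>r\<in>S. \<bar>f r\<bar> \<le> L * norm (\<Sum>i\<in>S. f i *\<^sub>R a i)))"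

lemma well_conditionedD:
  "well_conditioned k L I a \<Longrightarrow> S \<subseteq> I \<Longrightarrow> card S \<le> k \<Longrightarrow> r \<in> S \<Longrightarrow>
     \<bar>f r\<bar> \<le> L * norm (\<Sum>i\<in>S. f i *\<^sub>R a i)"
  unfolding well_conditioned_def by blast

text \<open>\<open>y\<close> is the residual \<open>p\<close> of \<open>b r\<close> modulo the other
  vectors, divided by its squared norm. Conditioning, applied to a combination with coefficient 1 at
  \<open>r\<close>, gives \<open>norm p\<close> at least \<open>1 / L\<close>.\<close>

lemma dual_vector:
  assumes wc: "well_conditioned k L I b" and S: "S \<subseteq> I" "card S \<le> k" "r \<in> S"
    and fin: "finite I" and L: "L > 0"
  obtains y where "\<And>i. i \<in> S \<Longrightarrow> inner (b i) y = (if i = r then 1 else 0)" "norm y \<le> L"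
proof -
  have fS: "finite S" using S fin finite_subset by blast
  obtain u p where up: "u \<in> span (b ` (S - {r}))" "b r = u + p" "\<forall>w\<in>b ` (S - {r}). inner p w = 0"
    using orthogonal_decomposition[of "b ` (S - {r})" "b r"] fS by blast
  obtain g where g: "u = (\<Sum>s\<in>S - {r}. g s *\<^sub>R b s)" 
    using span_image_sumE up(1) fS by (metis finite_Diff)
  define f where "f = (\<lambda>s. if s = r then 1 else - g s)"
  have "(\<Sum>i\<in>S. f i *\<^sub>R b i) = b r + (\<Sum>i\<in>S - {r}. f i *\<^sub>R b i)"
    using fS S by (simp add: sum.remove[of S r] f_def)
  also have "(\<Sum>i\<in>S - {r}. f i *\<^sub>R b i) = - u"
    unfolding g sum_negf[symmetric] by (intro sum.cong) (auto simp: f_def)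
  finally have p: "(\<Sum>i\<in>S. f i *\<^sub>R b i) = p" using up by simp
  have "\<bar>f r\<bar> \<le> L * norm p" using well_conditionedD[OF wc S, of f] p by simp
  then have np: "1 \<le> L * norm p" by (simp add: f_def)
  then have p0: "norm p > 0" using L by (smt (verit, best) mult_nonneg_nonpos norm_ge_zero)
  define y where "y = p /\<^sub>R (norm p)\<^sup>2"
  have "inner (b r) p = inner u p + inner p p" using up(2) by (simp add: inner_add_left)
  also have "inner u p = 0" using inner_span_zero[OF up(1), of p] up(3) by (metis inner_commute)
  finally have "inner (b r) p = (norm p)\<^sup>2" by (simp add: power2_norm_eq_inner)
  moreover have "inner (b i) p = 0" if "i \<in> S" "i \<noteq> r" for i
    using up(3) that by (simp add: inner_commute)
  ultimately have "inner (b i) y = (if i = r then 1 else 0)" if "i \<in> S" for i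
    using that p0 by (auto simp: y_def)
  moreover have "norm y = 1 / norm p" using p0 by (simp add: y_def power2_eq_square divide_simps)
  then have "norm y \<le> L" using np p0 by (simp add: divide_le_eq)
  ultimately show thesis by (rule that)
qed

text \<open>The coefficients of \<open>x\<close> are taken from a grid: with the others fixed, each \<open>p r\<close> rules out at most one
  value of its own coefficient, so a union bound leaves a good choice.\<close>

lemma generic_vector:
  fixes p :: "'i \<Rightarrow> 'a::real_inner"
  assumes fin: "finite I"
  obtains x where "x \<in> span (p ` I)" "norm x \<le> real (card I) * (real (card I) + 1)"
    "\<And>r. r \<in> I \<Longrightarrow> norm (p r) \<le> 2 * \<bar>inner (p r) x\<bar>"
proof -
  \<comment> \<open>With \<open>M = card I + 1\<close> grid values, \<open>card I\<close> bad sets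
    of at most \<open>M ^ (card I - 1)\<close> points each cannot cover the grid.\<close>
  define M where "M = card I + 1"
  define u where "u r = p r /\<^sub>R norm (p r)" for r
  define X where "X s = (\<Sum>r\<in>I. real (s r) *\<^sub>R u r)" for s :: "'i \<Rightarrow> nat"
  define G where "G = (I \<rightarrow>\<^sub>E {1..M})"
  define bad where "bad r = {s \<in> G. p r \<noteq> 0 \<and> \<bar>inner (u r) (X s)\<bar> < 1/2}" for r
  have finG: "finite G" unfolding G_def using fin by (intro finite_PiE) auto
  have cardG: "card G = M ^ card I" unfolding G_def using fin by (simp add: card_PiE)
  have card_bad: "card (bad r) \<le> M ^ (card I - 1)" if r: "r \<in> I" for r
  proof -
    have "inj_on (\<lambda>s. restrict s (I - {r})) (bad r)"
    proof (rule inj_onI)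
      fix s t assume st: "s \<in> bad r" "t \<in> bad r" "restrict s (I - {r}) = restrict t (I - {r})"
      have eq: "s i = t i" if "i \<in> I - {r}" for i
        using fun_cong[OF st(3), of i] that by simp
      have un: "inner (u r) (u r) = 1"
        using st by (auto simp: bad_def u_def power2_norm_eq_inner[symmetric] power2_eq_square)
      \<comment> \<open>Two bad points that agree off \<open>r\<close> have inner products with
        \<open>u r\<close> that differ by the integer \<open>s r - t r\<close> and by less than
        1.\<close>
      have "X s - X t = (real (s r) - real (t r)) *\<^sub>R u r"
        using r fin eq by (simp add: X_def sum.remove[of I r] algebra_simps)
      then have "inner (u r) (X s) - inner (u r) (X t) = real (s r) - real (t r)"
        using un by (simp add: inner_diff_right[symmetric])
      moreover have "\<bar>inner (u r) (X s)\<bar> < 1/2" "\<bar>inner (u r) (X t)\<bar> < 1/2"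
        using st by (auto simp: bad_def)
      ultimately have "\<bar>real (s r) - real (t r)\<bar> < 1" by linarith
      then have "s r = t r" by linarith
      then have "s i = t i" if "i \<in> I" for i using eq that by (cases "i = r") auto
      then show "s = t" using st unfolding bad_def G_def
        by (intro extensionalityI[of s I t]) (auto simp: PiE_def)
    qed
    moreover have "(\<lambda>s. restrict s (I - {r})) ` bad r \<subseteq> ((I - {r}) \<rightarrow>\<^sub>E {1..M})"
      unfolding bad_def G_def by (intro image_subsetI restrict_PiE_iff[THEN iffD2]) (auto simp: PiE_iff)
    ultimately have "card (bad r) \<le> card ((I - {r}) \<rightarrow>\<^sub>E {1..M})"
      using fin by (intro card_inj_on_le) (auto intro!: finite_PiE)
    also have "\<dots> = M ^ (card I - 1)" using fin r by (simp add: card_PiE)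
    finally show ?thesis .
  qed
  have "card (\<Union>r\<in>I. bad r) < card G"
  proof (cases "I = {}")
    case True
    then show ?thesis by (simp add: cardG M_def)
  next
    case False
    have "card (\<Union>r\<in>I. bad r) \<le> (\<Sum>r\<in>I. card (bad r))" using fin by (rule card_UN_le)
    also have "\<dots> \<le> (\<Sum>r\<in>I. M ^ (card I - 1))" using card_bad by (intro sum_mono)
    also have "\<dots> = card I * M ^ (card I - 1)" by simp
    also have "\<dots> < M * M ^ (card I - 1)" by (simp add: M_def)
    also have "\<dots> = M ^ card I" using False fin by (simp add: power_eq_if)
    finally show ?thesis using cardG by simp
  qed
  moreover have "finite (\<Union>r\<in>I. bad r)" using fin finG by (auto simp: bad_def)
  ultimately have "\<not> G \<subseteq> (\<Union>r\<in>I. bad r)" using card_mono leD by metis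
  then obtain s where s: "s \<in> G" "s \<notin> (\<Union>r\<in>I. bad r)" by (meson subsetI)
  have "X s \<in> span (p ` I)"
    unfolding X_def u_def by (intro span_sum span_scale span_base) auto
  moreover have "norm (X s) \<le> real (card I) * (real (card I) + 1)"
  proof -
    have "norm (X s) \<le> (\<Sum>r\<in>I. norm (real (s r) *\<^sub>R u r))" unfolding X_def by (rule norm_sum)
    also have "\<dots> \<le> (\<Sum>r\<in>I. real M * 1)"
    proof (intro sum_mono)
      fix r assume "r \<in> I"
      then have "s r \<le> M" using s by (auto simp: G_def PiE_iff)
      moreover have "norm (u r) \<le> 1" by (cases "p r = 0") (simp_all add: u_def)
      ultimately show "norm (real (s r) *\<^sub>R u r) \<le> real M * 1"
        unfolding norm_scaleR by (intro mult_mono) auto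
    qed
    finally show ?thesis by (simp add: M_def add.commute)
  qed
  moreover have "norm (p r) \<le> 2 * \<bar>inner (p r) (X s)\<bar>" if r: "r \<in> I" for r
  proof (cases "p r = 0")
    case False
    have "inner (p r) (X s) = norm (p r) * inner (u r) (X s)" using False by (simp add: u_def)
    moreover have "\<bar>inner (u r) (X s)\<bar> \<ge> 1/2" using s r False by (auto simp: bad_def)
    then have "norm (p r) * (1/2) \<le> norm (p r) * \<bar>inner (u r) (X s)\<bar>"
      by (rule mult_left_mono) simp
    ultimately show ?thesis by (simp add: abs_mult)
  qed simp
  ultimately show thesis by (rule that)
qed

section \<open>Counting columns near a span\<close>

definition near :: "real \<Rightarrow> 'a::real_inner set \<Rightarrow> 'a \<Rightarrow> bool" where
  "near d X v \<longleftrightarrow> (\<exists>u\<in>span X. norm (v - u) \<le> d)"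

lemma near_mono: "near d X v \<Longrightarrow> d \<le> d' \<Longrightarrow> X \<subseteq> Y \<Longrightarrow> near d' Y v"
  unfolding near_def using span_mono[of X Y] by force

lemma near_trans_span: "near d X v \<Longrightarrow> X \<subseteq> span Y \<Longrightarrow> near d Y v"
  unfolding near_def using span_minimal[of X "span Y"] by auto

lemma subset_card_exists:
  assumes "finite A" "n \<le> card A"
  obtains B where "B \<subseteq> A" "card B = n" "finite B"
  using obtain_subset_with_card_n[OF assms(2)] assms(1) finite_subset by metis

text \<open>Closeness of the two tensors is expressed through the trilinear forms they define, so that the
  three factors may live in arbitrary inner product spaces.\<close>

locale cp_approx =
  fixes I :: "'i set" and kA kB kC :: nat and L e :: real
    and a a' :: "'i \<Rightarrow> 'a::real_inner" and b b' :: "'i \<Rightarrow> 'b::real_inner"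
    and c c' :: "'i \<Rightarrow> 'c::real_inner"
  assumes fin: "finite I" and L: "100 \<le> L" and card_le_L: "real (card I) \<le> L"
    and wcA: "well_conditioned kA L I a" and wcB: "well_conditioned kB L I b"
    and wcC: "well_conditioned kC L I c"
    and kA: "kA \<le> card I" and kB: "kB \<le> card I" and kC: "kC \<le> card I"
    and k_sum: "2 * card I + 2 \<le> kA + kB + kC"
    and e: "0 < e"
    and close: "\<And>x y z. \<bar>(\<Sum>r\<in>I. inner (a r) x * inner (b r) y * inner (c r) z)
        - (\<Sum>r\<in>I. inner (a' r) x * inner (b' r) y * inner (c' r) z)\<bar> \<le> e * norm x * norm y * norm z"
begin

text \<open>The trilinear bound is tested with \<open>x\<close> equal to the difference itself; one
  factor of its norm cancels.\<close>

lemma contraction_close: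
  "norm ((\<Sum>r\<in>I. (inner (b r) y * inner (c r) z) *\<^sub>R a r)
       - (\<Sum>r\<in>I. (inner (b' r) y * inner (c' r) z) *\<^sub>R a' r)) \<le> e * norm y * norm z"
  (is "norm ?w \<le> _")
proof (cases "?w = 0")
  case False
  have "inner ?w x = (\<Sum>r\<in>I. inner (a r) x * inner (b r) y * inner (c r) z)
        - (\<Sum>r\<in>I. inner (a' r) x * inner (b' r) y * inner (c' r) z)" for x
    by (simp add: inner_diff_left inner_sum_left mult.commute mult.left_commute)
  then have "\<bar>inner ?w ?w\<bar> \<le> e * norm ?w * norm y * norm z" using close by simp
  then have "norm ?w * norm ?w \<le> norm ?w * (e * norm y * norm z)"
    by (simp add: dot_square_norm power2_eq_square mult.commute mult.left_commute)
  then show ?thesis by (rule mult_left_le_imp_le) (use False in simp)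
qed (use e in simp)

text \<open>The matching of columns is worked out for the third factor only; the cyclic symmetry
  carries it to the other two.\<close>

lemma rotate: "cp_approx I kB kC kA L e b b' c c' a a'"
  using fin L card_le_L wcA wcB wcC kA kB kC k_sum e close
  by unfold_locales (auto simp: ac_simps)

text \<open>The number of large entries of \<open>x\<^sup>T C\<close> plays the role of a robust rank of the contraction of the
  tensor along \<open>x\<close>, which \<open>card D'\<close> bounds from above.\<close>

lemma count_large_le:
  assumes D': "D' = {r\<in>I. inner (c' r) x \<noteq> 0}" and card: "card D' + 1 + card I \<le> kA + kB"
    and eta: "e * norm x * L ^ 3 < \<eta>"
  shows "card {r\<in>I. \<eta> \<le> \<bar>inner (c r) x\<bar>} \<le> card D'"
proof (rule ccontr)
  assume "\<not> ?thesis"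
  then have "card D' + 1 \<le> card {r\<in>I. \<eta> \<le> \<bar>inner (c r) x\<bar>}" by simp
  then obtain P where P: "P \<subseteq> {r\<in>I. \<eta> \<le> \<bar>inner (c r) x\<bar>}" "card P = card D' + 1" "finite P"
    using fin by (elim subset_card_exists[rotated]) auto
  have PI: "P \<subseteq> I" using P by blast
  \<comment> \<open>\<open>Q\<close> collects columns on which \<open>y\<close> will vanish, so that
    exactly \<open>kA\<close> columns are left for the conditioning of A. The hypothesis on
    \<open>card D'\<close> says that \<open>card P + card Q\<close> is at most \<open>kB\<close>, as
    dual vectors for \<open>P \<union> Q\<close> require.\<close>
  have "card I - kA \<le> card (I - P)"
    using card kB P PI fin by (simp add: card_Diff_subset)
  then obtain Q where Q: "Q \<subseteq> I - P" "card Q = card I - kA" "finite Q"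
    by (rule subset_card_exists[OF finite_Diff[OF fin]])
  have PQ: "P \<union> Q \<subseteq> I" "card (P \<union> Q) \<le> kB"
    using P PI Q card kA card_Un_le[of P Q] by auto
  have Lp: "L > 0" using L by simp
  have "\<exists>y. (\<forall>i\<in>P \<union> Q. inner (b i) y = (if i = p then 1 else 0)) \<and> norm y \<le> L" if "p \<in> P" for p
    using dual_vector[OF wcB PQ _ fin Lp, of p] that by (metis UnI1)
  then obtain Y where Y: "\<And>p i. p \<in> P \<Longrightarrow> i \<in> P \<union> Q \<Longrightarrow> inner (b i) (Y p) = (if i = p then 1 else 0)"
    "\<And>p. p \<in> P \<Longrightarrow> norm (Y p) \<le> L" by metis
  have finD': "finite D'" using fin D' by simp
  \<comment> \<open>There are \<open>card D' + 1\<close> coefficients and \<open>card D'\<close>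
    equations: \<open>y\<close> annihilates every \<open>b' j\<close> with
    \<open>inner (c' j) x\<close> nonzero, so the contraction of the primed tensor vanishes.\<close>
  obtain v m where v: "\<And>j. j \<in> D' \<Longrightarrow> (\<Sum>p\<in>P. inner (b' j) (Y p) * v p) = 0"
    "m \<in> P" "v m = 1" "\<And>p. p \<in> P \<Longrightarrow> \<bar>v p\<bar> \<le> 1"
    using normalized_kernel[OF finD' \<open>finite P\<close>, of "\<lambda>j p. inner (b' j) (Y p)"] P(2) by auto
  define y where "y = (\<Sum>p\<in>P. v p *\<^sub>R Y p)"
  have "norm y \<le> (\<Sum>p\<in>P. norm (v p *\<^sub>R Y p))" unfolding y_def by (rule norm_sum)
  also have "\<dots> \<le> (\<Sum>p\<in>P. 1 * L)"
    using v(4) Y(2) by (intro sum_mono) (auto simp only: norm_scaleR intro!: mult_mono norm_ge_zero)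
  also have "\<dots> = real (card P) * L" by simp
  also have "\<dots> \<le> L * L"
    using card_mono[OF fin PI] card_le_L Lp by (intro mult_right_mono) auto
  finally have ny: "norm y \<le> L * L" .
  have yb: "inner (b i) y = (if i \<in> P then v i else 0)" if "i \<in> P \<union> Q" for i
  proof -
    have "inner (b i) y = (\<Sum>p\<in>P. v p * inner (b i) (Y p))"
      unfolding y_def by (simp add: inner_sum_right)
    also have "\<dots> = (\<Sum>p\<in>P. if i = p then v p else 0)" using Y(1) that by (intro sum.cong) auto
    finally show ?thesis using P(3) by simp
  qed
  have zero: "(\<Sum>r\<in>I. (inner (b' r) y * inner (c' r) x) *\<^sub>R a' r) = 0"
  proof (rule sum.neutral, rule ballI)
    fix r assume r: "r \<in> I"
    have "inner (b' r) y = 0" if "r \<in> D'"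
      using v(1)[OF that] by (simp add: y_def inner_sum_right mult.commute)
    then show "(inner (b' r) y * inner (c' r) x) *\<^sub>R a' r = 0" using r D' by auto
  qed
  define w where "w = (\<Sum>r\<in>I. (inner (b r) y * inner (c r) x) *\<^sub>R a r)"
  have "norm w \<le> e * norm y * norm x" using contraction_close[of y x] zero by (simp add: w_def)
  also have "\<dots> \<le> e * (L * L) * norm x" using ny e by (intro mult_right_mono mult_left_mono) auto
  finally have nw: "norm w \<le> e * norm x * L ^ 2" by (simp add: ac_simps power2_eq_square)
  have "w = (\<Sum>r\<in>I - Q. (inner (b r) y * inner (c r) x) *\<^sub>R a r)"
    unfolding w_def using yb Q by (intro sum.mono_neutral_right) (auto simp: fin)
  moreover have "card (I - Q) \<le> kA" using Q fin kA by (simp add: card_Diff_subset subset_iff)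
  moreover have "m \<in> I - Q" using v(2) PI Q by auto
  ultimately have "\<bar>inner (b m) y * inner (c m) x\<bar> \<le> L * norm w"
    using well_conditionedD[OF wcA, of "I - Q" m "\<lambda>r. inner (b r) y * inner (c r) x"] by auto
  then have "\<bar>inner (c m) x\<bar> \<le> L * norm w" using yb v by auto
  moreover have "\<eta> \<le> \<bar>inner (c m) x\<bar>" using P(1) v(2) by auto
  \<comment> \<open>Of the factor \<open>L ^ 3\<close>, two powers come from \<open>norm y\<close>
    and one from the conditioning of A.\<close>
  moreover have "L * norm w \<le> L * (e * norm x * L ^ 2)" using nw Lp by (intro mult_left_mono) auto
  ultimately show False using eta by (simp add: power3_eq_cube power2_eq_square ac_simps)
qed

lemma card_near_ge:
  assumes S: "S \<subseteq> I" "kC \<le> card S + 1"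
  shows "card S \<le> card {r\<in>I. near (L ^ 6 * e) (c' ` S) (c r)}"
proof -
  have fS: "finite S" using S fin finite_subset by blast
  have "\<exists>u p. u \<in> span (c' ` S) \<and> c r = u + p \<and> (\<forall>w\<in>c' ` S. inner p w = 0)" for r
    using orthogonal_decomposition[of "c' ` S" "c r"] fS by auto
  then obtain u p where up: "\<And>r. u r \<in> span (c' ` S)" "\<And>r. c r = u r + p r"
     "\<And>r w. w \<in> c' ` S \<Longrightarrow> inner (p r) w = 0" by metis
  \<comment> \<open>Taken from the span of the residuals, \<open>x\<close> is orthogonal to the
    columns in \<open>S\<close>, and its inner product with \<open>c r\<close> sees only
    \<open>p r\<close>; being generic, it detects every \<open>p r\<close>.\<close>
  obtain x where x: "x \<in> span (p ` I)" "norm x \<le> real (card I) * (real (card I) + 1)"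
    "\<And>r. r \<in> I \<Longrightarrow> norm (p r) \<le> 2 * \<bar>inner (p r) x\<bar>"
    using generic_vector[OF fin, of p] by blast
  have x0: "inner x (c' s) = 0" if "s \<in> S" for s
  proof -
    have "inner (c' s) x = 0"
      using up(3) that by (intro inner_span_zero[OF x(1)]) (auto simp: inner_commute[of "c' s"])
    then show ?thesis by (simp add: inner_commute)
  qed
  have x1: "inner (c r) x = inner (p r) x" for r
  proof -
    have "inner x (u r) = 0" using x0 by (intro inner_span_zero[OF up(1)]) auto
    then show ?thesis by (subst up(2)) (simp add: inner_add_left inner_commute[of "u r"])
  qed
  have Lp: "L > 0" using L by simp
  have "norm x \<le> L * (L + 1)"
    using card_le_L by (intro order_trans[OF x(2)] mult_mono) auto
  also have "\<dots> \<le> 2 * L ^ 2" using L by (simp add: power2_eq_square algebra_simps)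
  finally have nx: "norm x \<le> 2 * L ^ 2" .
  define D' where "D' = {r\<in>I. inner (c' r) x \<noteq> 0}"
  have "D' \<subseteq> I - S" using x0 by (auto simp: D'_def inner_commute)
  then have cD': "card D' \<le> card I - card S"
    using card_mono[of "I - S" D'] fin fS S by (simp add: card_Diff_subset)
  \<comment> \<open>The half compensates the factor 2 in the genericity of \<open>x\<close>. The
    losses \<open>2 * L ^ 2\<close> in \<open>norm x\<close> and \<open>L ^ 3\<close> in
    \<open>count_large_le\<close> make \<open>2 * L ^ 5\<close>, less than
    \<open>L ^ 6 / 2\<close>.\<close>
  define \<eta> where "\<eta> = L ^ 6 * e / 2"
  have "e * norm x * L ^ 3 \<le> e * (2 * L ^ 2) * L ^ 3"
    using nx e Lp by (intro mult_right_mono mult_left_mono) auto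
  also have "\<dots> = 4 * \<eta> / L" using Lp by (simp add: \<eta>_def eval_nat_numeral)
  also have "\<dots> < \<eta>" using L e by (simp add: \<eta>_def divide_less_eq)
  \<comment> \<open>Here \<open>kC \<le> card S + 1\<close> meets \<open>k_sum\<close>:
    \<open>card D' + 1 + card I\<close> is at most \<open>2 * card I + 2 - kC\<close>, hence at most
    \<open>kA + kB\<close>.\<close>
  finally have "card {r\<in>I. \<eta> \<le> \<bar>inner (c r) x\<bar>} \<le> card D'"
    using cD' S k_sum kC card_mono[OF fin S(1)] by (intro count_large_le[OF D'_def]) auto
  then have le: "card {r\<in>I. \<eta> \<le> \<bar>inner (c r) x\<bar>} \<le> card I - card S" using cD' by simp
  have "I - {r\<in>I. \<eta> \<le> \<bar>inner (c r) x\<bar>} \<subseteq> {r\<in>I. near (L ^ 6 * e) (c' ` S) (c r)}"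
  proof
    fix r assume "r \<in> I - {r\<in>I. \<eta> \<le> \<bar>inner (c r) x\<bar>}"
    then have r: "r \<in> I" "\<bar>inner (p r) x\<bar> < \<eta>" using x1 by auto
    then have "norm (c r - u r) \<le> L ^ 6 * e"
      using x(3)[OF r(1)] up(2)[of r] by (simp add: \<eta>_def)
    then show "r \<in> {r\<in>I. near (L ^ 6 * e) (c' ` S) (c r)}"
      using r up(1) by (auto simp: near_def)
  qed
  then have "card (I - {r\<in>I. \<eta> \<le> \<bar>inner (c r) x\<bar>}) \<le> card {r\<in>I. near (L ^ 6 * e) (c' ` S) (c r)}"
    using fin by (intro card_mono) auto
  moreover have "card (I - {r\<in>I. \<eta> \<le> \<bar>inner (c r) x\<bar>})
      = card I - card {r\<in>I. \<eta> \<le> \<bar>inner (c r) x\<bar>}"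
    using fin by (intro card_Diff_subset) auto
  ultimately show ?thesis using le card_mono[OF fin S(1)] by linarith
qed

end

section \<open>Perturbation of well-conditioned families\<close>

context
  fixes I :: "'i set" and k :: nat and L :: real and c :: "'i \<Rightarrow> 'c::real_inner"
  assumes fin: "finite I" and L: "100 \<le> L" and IL: "real (card I) \<le> L"
    and wc: "well_conditioned k L I c"
begin

text \<open>For the largest coefficient \<open>H\<close>, replacing \<open>c\<close> by
  \<open>v\<close> changes the combination by at most \<open>L * H * d\<close>; multiplied by
  \<open>L\<close> this is at most \<open>H / 2\<close> and can be absorbed.\<close>

lemma perturbed_independent:
  assumes N: "N \<subseteq> I" "card N \<le> k" and v: "\<And>r. r \<in> N \<Longrightarrow> norm (c r - v r) \<le> d"
    and d: "2 * L\<^sup>2 * d \<le> 1" and r: "r \<in> N"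
  shows "\<bar>h r\<bar> \<le> 2 * L * norm (\<Sum>i\<in>N. h i *\<^sub>R v i)"
proof -
  have fN: "finite N" using N fin finite_subset by blast
  have d0: "0 \<le> d" using v[OF r] norm_ge_zero order_trans by blast
  define H where "H = Max ((\<lambda>i. \<bar>h i\<bar>) ` N)"
  have "H \<in> (\<lambda>i. \<bar>h i\<bar>) ` N" unfolding H_def using fN r by (intro Max_in) auto
  then obtain m where m: "m \<in> N" "H = \<bar>h m\<bar>" by (rule imageE)
  have H: "\<bar>h i\<bar> \<le> H" if "i \<in> N" for i unfolding H_def using fN that by (intro Max_ge) auto
  have H0: "0 \<le> H" using m by simp
  have "norm (\<Sum>i\<in>N. h i *\<^sub>R (c i - v i)) \<le> (\<Sum>i\<in>N. norm (h i *\<^sub>R (c i - v i)))" by (rule norm_sum)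
  also have "\<dots> \<le> (\<Sum>i\<in>N. H * d)"
    using H v H0 by (intro sum_mono) (auto simp only: norm_scaleR intro!: mult_mono norm_ge_zero)
  also have "\<dots> = real (card N) * (H * d)" by simp
  also have "\<dots> \<le> L * (H * d)"
    using card_mono[OF fin N(1)] IL H0 d0 by (intro mult_right_mono) auto
  finally have 1: "norm (\<Sum>i\<in>N. h i *\<^sub>R (c i - v i)) \<le> L * (H * d)" .
  have "(\<Sum>i\<in>N. h i *\<^sub>R c i) = (\<Sum>i\<in>N. h i *\<^sub>R v i) + (\<Sum>i\<in>N. h i *\<^sub>R (c i - v i))"
    by (simp add: scaleR_diff_right sum_subtractf)
  then have 2: "norm (\<Sum>i\<in>N. h i *\<^sub>R c i) \<le> norm (\<Sum>i\<in>N. h i *\<^sub>R v i) + L * (H * d)"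
    using 1 norm_triangle_ineq[of "\<Sum>i\<in>N. h i *\<^sub>R v i" "\<Sum>i\<in>N. h i *\<^sub>R (c i - v i)"] by simp
  have "H \<le> L * norm (\<Sum>i\<in>N. h i *\<^sub>R c i)"
    unfolding m(2) by (rule well_conditionedD[OF wc N m(1)])
  also have "\<dots> \<le> L * (norm (\<Sum>i\<in>N. h i *\<^sub>R v i) + L * (H * d))"
    using 2 L by (intro mult_left_mono) auto
  also have "\<dots> = L * norm (\<Sum>i\<in>N. h i *\<^sub>R v i) + L\<^sup>2 * d * H"
    by (simp add: algebra_simps power2_eq_square)
  also have "L\<^sup>2 * d * H \<le> 1/2 * H" using d H0 by (intro mult_right_mono) auto
  finally have "H \<le> 2 * L * norm (\<Sum>i\<in>N. h i *\<^sub>R v i)" by simp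
  with H[OF r] show ?thesis by simp
qed

text \<open>If \<open>F\<close> were smaller, the approximations \<open>v r\<close> would satisfy a
  linear relation with a coefficient 1, against \<open>perturbed_independent\<close>.\<close>

lemma card_le_of_near:
  assumes N: "N \<subseteq> I" "card N \<le> k" and F: "finite F"
    and near: "\<And>r. r \<in> N \<Longrightarrow> near d F (c r)" and d: "2 * L\<^sup>2 * d \<le> 1"
  shows "card N \<le> card F"
proof (rule ccontr)
  assume "\<not> ?thesis"
  then have lt: "card F < card N" by simp
  have fN: "finite N" using N fin finite_subset by blast
  obtain v where v: "\<And>r. r \<in> N \<Longrightarrow> v r \<in> span F" "\<And>r. r \<in> N \<Longrightarrow> norm (c r - v r) \<le> d"
    using near unfolding near_def by metis
  have "\<exists>g. v r = (\<Sum>s\<in>F. g s *\<^sub>R s)" if "r \<in> N" for r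
    using span_image_sumE[OF F, of "v r" "\<lambda>s. s"] v(1)[OF that] by auto
  then obtain g where g: "\<And>r. r \<in> N \<Longrightarrow> v r = (\<Sum>s\<in>F. g r s *\<^sub>R s)" by metis
  obtain h m where h: "\<And>s. s \<in> F \<Longrightarrow> (\<Sum>r\<in>N. g r s * h r) = 0" "m \<in> N" "h m = 1"
    using normalized_kernel[OF F fN lt, of "\<lambda>s r. g r s"] by metis
  have "(\<Sum>r\<in>N. h r *\<^sub>R v r) = (\<Sum>r\<in>N. \<Sum>s\<in>F. (g r s * h r) *\<^sub>R s)"
    by (intro sum.cong) (auto simp: g scaleR_sum_right mult.commute)
  also have "\<dots> = (\<Sum>s\<in>F. \<Sum>r\<in>N. (g r s * h r) *\<^sub>R s)" by (rule sum.swap)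
  also have "\<dots> = 0" using h(1) by (auto simp: scaleR_sum_left[symmetric] intro!: sum.neutral)
  finally have "\<bar>h m\<bar> \<le> 0"
    using perturbed_independent[OF N v(2) d h(2), of h] by simp
  then show False using h(3) by simp
qed

text \<open>The approximations \<open>v r\<close> are independent and at least as many as the
  vectors of \<open>S\<close>, so they span: \<open>w\<close> is a combination of them with
  coefficients at most \<open>2 * L * norm w\<close>, and going back to \<open>c r\<close> costs
  \<open>d\<close> per unit of coefficient.\<close>

lemma near_of_card_le:
  assumes N: "N \<subseteq> I" "card N \<le> k" and S: "finite S" "card S \<le> card N"
    and near: "\<And>r. r \<in> N \<Longrightarrow> near d (s ` S) (c r)" and d: "2 * L\<^sup>2 * d \<le> 1"
    and w: "w \<in> span (s ` S)" and d0: "0 \<le> d"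
  shows "near (2 * L\<^sup>2 * d * norm w) (c ` N) w"
proof -
  have fN: "finite N" using N fin finite_subset by blast
  obtain v where v: "\<And>r. r \<in> N \<Longrightarrow> v r \<in> span (s ` S)" "\<And>r. r \<in> N \<Longrightarrow> norm (c r - v r) \<le> d"
    using near unfolding near_def by metis
  have "\<exists>g. v r = (\<Sum>i\<in>S. g i *\<^sub>R s i)" if "r \<in> N" for r
    using span_image_sumE[OF S(1) v(1)[OF that]] by metis
  then obtain g where g: "\<And>r. r \<in> N \<Longrightarrow> v r = (\<Sum>i\<in>S. g r i *\<^sub>R s i)" by metis
  obtain gw where gw: "w = (\<Sum>i\<in>S. gw i *\<^sub>R s i)" using span_image_sumE[OF S(1) w] by metis
  \<comment> \<open>\<open>None\<close> labels \<open>w\<close> and \<open>Some r\<close> labels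
    \<open>v r\<close>. A relation among these \<open>card N + 1\<close> vectors must involve
    \<open>w\<close>, since the \<open>v r\<close> are independent.\<close>
  define G where "G i q = (case q of None \<Rightarrow> gw i | Some r \<Rightarrow> g r i)" for i q
  define M where "M = insert None (Some ` N)"
  have "finite M" "card S < card M"
    using fN S by (auto simp: M_def card_insert_if card_image)
  then obtain h m where h: "\<And>i. i \<in> S \<Longrightarrow> (\<Sum>q\<in>M. G i q * h q) = 0" "m \<in> M" "h m = 1"
    using normalized_kernel[OF S(1), of M G] by metis
  have sumM: "(\<Sum>q\<in>M. f q) = f None + (\<Sum>r\<in>N. f (Some r))" for f :: "'i option \<Rightarrow> real"
    unfolding M_def using fN by (simp add: sum.reindex)
  have "h None *\<^sub>R w + (\<Sum>r\<in>N. h (Some r) *\<^sub>R v r)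
      = (\<Sum>i\<in>S. (gw i * h None) *\<^sub>R s i) + (\<Sum>r\<in>N. \<Sum>i\<in>S. (g r i * h (Some r)) *\<^sub>R s i)"
    unfolding gw by (simp add: g scaleR_sum_right mult.commute)
  also have "(\<Sum>r\<in>N. \<Sum>i\<in>S. (g r i * h (Some r)) *\<^sub>R s i)
      = (\<Sum>i\<in>S. \<Sum>r\<in>N. (g r i * h (Some r)) *\<^sub>R s i)" by (rule sum.swap)
  also have "(\<Sum>i\<in>S. (gw i * h None) *\<^sub>R s i) + \<dots> = (\<Sum>i\<in>S. (\<Sum>q\<in>M. G i q * h q) *\<^sub>R s i)"
    unfolding sumM by (simp add: G_def scaleR_sum_left scaleR_add_left sum.distrib)
  also have "\<dots> = 0" using h(1) by simp
  finally have rel: "h None *\<^sub>R w + (\<Sum>r\<in>N. h (Some r) *\<^sub>R v r) = 0" .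
  have hN: "h None \<noteq> 0"
  proof
    assume 0: "h None = 0"
    then have "h (Some r) = 0" if "r \<in> N" for r
      using perturbed_independent[OF N v(2) d that, of "\<lambda>r. h (Some r)"] rel by simp
    with 0 h(2,3) show False by (auto simp: M_def)
  qed
  define f where "f r = - h (Some r) / h None" for r
  have wf: "w = (\<Sum>r\<in>N. f r *\<^sub>R v r)"
  proof -
    have "h None *\<^sub>R w = - (\<Sum>r\<in>N. h (Some r) *\<^sub>R v r)" using rel by (simp add: eq_neg_iff_add_eq_0)
    then have "w = (1 / h None) *\<^sub>R (- (\<Sum>r\<in>N. h (Some r) *\<^sub>R v r))"
      using hN by (metis (no_types, lifting) nonzero_divide_eq_eq scaleR_one scaleR_scaleR)
    then show ?thesis by (simp add: f_def scaleR_sum_right sum_negf[symmetric])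
  qed
  have fb: "\<bar>f r\<bar> \<le> 2 * L * norm w" if "r \<in> N" for r
    using perturbed_independent[OF N v(2) d that, of f] wf by simp
  have "w - (\<Sum>r\<in>N. f r *\<^sub>R c r) = (\<Sum>r\<in>N. f r *\<^sub>R (v r - c r))"
    by (subst wf) (simp add: scaleR_diff_right sum_subtractf)
  then have "norm (w - (\<Sum>r\<in>N. f r *\<^sub>R c r)) \<le> (\<Sum>r\<in>N. norm (f r *\<^sub>R (v r - c r)))"
    by (metis norm_sum)
  also have "\<dots> \<le> (\<Sum>r\<in>N. (2 * L * norm w) * d)"
    using fb v(2) L by (intro sum_mono) (auto simp only: norm_scaleR norm_minus_commute[of "v _"] intro!: mult_mono mult_nonneg_nonneg norm_ge_zero)
  also have "\<dots> = real (card N) * (2 * L * norm w * d)" by simp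
  also have "\<dots> \<le> L * (2 * L * norm w * d)"
    using card_mono[OF fin N(1)] IL d0 L by (intro mult_right_mono) auto
  finally have "norm (w - (\<Sum>r\<in>N. f r *\<^sub>R c r)) \<le> 2 * L\<^sup>2 * d * norm w"
    by (simp add: power2_eq_square ac_simps)
  then show ?thesis unfolding near_def by (intro bexI[OF _ sum_in_span_image[OF subset_refl]])
qed

end

section \<open>Rigidity of the columns\<close>

text \<open>Kept apart from \<open>cp_approx\<close> because the auxiliary instances, in which
  primed columns are replaced, need not satisfy the norm bounds or \<open>e_small\<close>.\<close>

locale cp_approx_bounded = cp_approx +
  assumes norm_a: "\<And>r. r \<in> I \<Longrightarrow> norm (a r) \<le> L" and norm_a': "\<And>r. r \<in> I \<Longrightarrow> norm (a' r) \<le> L"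
    and norm_b: "\<And>r. r \<in> I \<Longrightarrow> norm (b r) \<le> L" and norm_b': "\<And>r. r \<in> I \<Longrightarrow> norm (b' r) \<le> L"
    and norm_c: "\<And>r. r \<in> I \<Longrightarrow> norm (c r) \<le> L" and norm_c': "\<And>r. r \<in> I \<Longrightarrow> norm (c' r) \<le> L"
    and e_small: "L ^ 40 * e \<le> 1"
begin

lemma rotate_bounded: "cp_approx_bounded I kB kC kA L e b b' c c' a a'"
  by (intro cp_approx_bounded.intro rotate cp_approx_bounded_axioms.intro
        norm_a norm_a' norm_b norm_b' norm_c norm_c' e_small)

text \<open>As \<open>L\<close> is at least 100, one extra power of \<open>L\<close> pays for any
  numerical constant up to 100, so only exponents have to be tracked.\<close>

lemma pow_e_le_1: "m < 40 \<Longrightarrow> 100 * (L ^ m * e) \<le> 1"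
proof -
  assume m: "m < 40"
  have "100 * L ^ m \<le> L * L ^ m" using L by (intro mult_right_mono) auto
  also have "\<dots> = L ^ Suc m" by simp
  also have "\<dots> \<le> L ^ 40" using m L by (intro power_increasing) auto
  finally have "100 * L ^ m * e \<le> L ^ 40 * e" using e by (intro mult_right_mono) auto
  then show ?thesis using e_small by simp
qed

lemma L_pos: "0 < L" using L by simp

lemma pow_e_le: "m < n \<Longrightarrow> 100 * (L ^ m * e) \<le> L ^ n * e"
proof -
  assume m: "m < n"
  have "100 * L ^ m \<le> L * L ^ m" using L by (intro mult_right_mono) auto
  also have "\<dots> = L ^ Suc m" by simp
  also have "\<dots> \<le> L ^ n" using m L by (intro power_increasing) auto
  finally have "100 * L ^ m * e \<le> L ^ n * e" using e by (intro mult_right_mono) auto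
  then show ?thesis by simp
qed

text \<open>The factor \<open>L ^ 3\<close> bounds the number of terms times the norms of a column
  of A' and one of B'.\<close>

lemma perturb:
  assumes "\<And>r. r \<in> I \<Longrightarrow> norm (c' r - c'' r) \<le> d"
  shows "cp_approx I kA kB kC L (e + L ^ 3 * d) a a' b b' c c''"
proof -
  have d0: "0 \<le> d"
  proof -
    have "I \<noteq> {}" using k_sum kA kB kC by auto
    then show ?thesis using assms norm_ge_zero order_trans by blast
  qed
  have "\<bar>(\<Sum>r\<in>I. inner (a r) x * inner (b r) y * inner (c r) z)
        - (\<Sum>r\<in>I. inner (a' r) x * inner (b' r) y * inner (c'' r) z)\<bar>
        \<le> (e + L ^ 3 * d) * norm x * norm y * norm z" for x y z
  proof -
    have "\<bar>\<Sum>r\<in>I. inner (a' r) x * inner (b' r) y * inner (c' r - c'' r) z\<bar>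
        \<le> (\<Sum>r\<in>I. \<bar>inner (a' r) x * inner (b' r) y * inner (c' r - c'' r) z\<bar>)" by (rule sum_abs)
    also have "\<dots> \<le> (\<Sum>r\<in>I. (L * norm x) * (L * norm y) * (d * norm z))"
    proof (rule sum_mono)
      fix r assume r: "r \<in> I"
      have "\<bar>inner (a' r) x\<bar> \<le> L * norm x"
        by (rule order_trans[OF Cauchy_Schwarz_ineq2]) (use norm_a'[OF r] in \<open>simp add: mult_right_mono\<close>)
      moreover have "\<bar>inner (b' r) y\<bar> \<le> L * norm y"
        by (rule order_trans[OF Cauchy_Schwarz_ineq2]) (use norm_b'[OF r] in \<open>simp add: mult_right_mono\<close>)
      moreover have "\<bar>inner (c' r - c'' r) z\<bar> \<le> d * norm z"
        by (rule order_trans[OF Cauchy_Schwarz_ineq2]) (use assms[OF r] in \<open>simp add: mult_right_mono\<close>)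
      ultimately show "\<bar>inner (a' r) x * inner (b' r) y * inner (c' r - c'' r) z\<bar>
          \<le> (L * norm x) * (L * norm y) * (d * norm z)"
        unfolding abs_mult using L_pos d0 by (intro mult_mono mult_nonneg_nonneg) auto
    qed
    also have "\<dots> = real (card I) * ((L * norm x) * (L * norm y) * (d * norm z))" by simp
    also have "\<dots> \<le> L * ((L * norm x) * (L * norm y) * (d * norm z))"
      using card_le_L L_pos d0 by (intro mult_right_mono) auto
    also have "\<dots> = L ^ 3 * d * norm x * norm y * norm z" by (simp add: power3_eq_cube)
    finally have "\<bar>(\<Sum>r\<in>I. inner (a' r) x * inner (b' r) y * inner (c' r) z)
        - (\<Sum>r\<in>I. inner (a' r) x * inner (b' r) y * inner (c'' r) z)\<bar> \<le> L ^ 3 * d * norm x * norm y * norm z"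
      by (simp add: inner_diff_left right_diff_distrib sum_subtractf)
    with close[of x y z] show ?thesis by (simp add: distrib_right)
  qed
  moreover have "0 < e + L ^ 3 * d" using e d0 L_pos by (intro add_pos_nonneg) auto
  ultimately show ?thesis
    by (intro cp_approx.intro fin L card_le_L wcA wcB wcC kA kB kC k_sum)
qed

text \<open>Moving the columns in \<open>S\<close> into the span of \<open>F\<close> changes the tensor little, so the count of
  \<open>card_near_ge\<close> also applies to the moved columns.\<close>

lemma not_near_small_span:
  assumes S: "S \<subseteq> I" "kC \<le> card S + 1" "card S \<le> kC" and F: "finite F" "card F < card S"
    and near: "\<And>s. s \<in> S \<Longrightarrow> near (1 / L ^ 12) F (c' s)"
  shows False
proof -
  obtain v where v: "\<And>s. s \<in> S \<Longrightarrow> v s \<in> span F" "\<And>s. s \<in> S \<Longrightarrow> norm (c' s - v s) \<le> 1 / L ^ 12"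
    using near unfolding near_def by metis
  define c'' where "c'' s = (if s \<in> S then v s else c' s)" for s
  have "norm (c' s - c'' s) \<le> 1 / L ^ 12" for s using v(2) L_pos by (auto simp: c''_def)
  then interpret p: cp_approx I kA kB kC L "e + L ^ 3 * (1 / L ^ 12)" a a' b b' c c''
    by (intro perturb)
  let ?e = "e + L ^ 3 * (1 / L ^ 12)"
  obtain N where N: "N \<subseteq> {r\<in>I. near (L ^ 6 * ?e) (c'' ` S) (c r)}" "card N = card S" "finite N"
    using p.card_near_ge[OF S(1,2)] fin by (elim subset_card_exists[rotated]) auto
  have sub: "c'' ` S \<subseteq> span F" using v(1) by (auto simp: c''_def)
  have "card N \<le> card F"
  proof (rule card_le_of_near[OF fin L card_le_L wcC])
    show "N \<subseteq> I" "card N \<le> kC" "finite F" using N S F by auto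
    show "near (L ^ 6 * ?e) F (c r)" if "r \<in> N" for r
      using N(1) that near_trans_span[OF _ sub] by blast
    have "L\<^sup>2 * (L ^ 6 * ?e) = L ^ 8 * e + 1 / L"
      using L_pos by (simp add: field_simps eval_nat_numeral)
    \<comment> \<open>This fixes the exponent 12: \<open>perturb\<close> loses 3 powers,
      \<open>card_near_ge\<close> 6 and the conditioning of C 2, which leaves
      \<open>1 / L\<close>.\<close>
    moreover have "1 / L \<le> 1 / 100" using L by (intro divide_left_mono) auto
    ultimately have "L\<^sup>2 * (L ^ 6 * ?e) \<le> 1 / 2" using pow_e_le_1[of 8] by linarith
    then show "2 * L\<^sup>2 * (L ^ 6 * ?e) \<le> 1" by linarith
  qed
  with N F show False by simp
qed

text \<open>The columns of C that belong to \<open>S\<close>; in the exact case and for fewer than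
  \<open>kC\<close> columns, the image of \<open>S\<close> under the permutation sought. The width
  \<open>d\<close> is a parameter because the counting needs these sets not to change over a range
  of widths.\<close>

definition nb :: "real \<Rightarrow> 'a set \<Rightarrow> 'a set" where
  "nb d S = {r\<in>I. near d (c' ` S) (c r)}"

lemma nb_subset: "nb d S \<subseteq> I" and finite_nb: "finite (nb d S)"
  using fin by (auto simp: nb_def)

lemma nb_mono: "d \<le> d' \<Longrightarrow> S \<subseteq> S' \<Longrightarrow> nb d S \<subseteq> nb d' S'"
  unfolding nb_def by (auto intro: near_mono[OF _ _ image_mono])

text \<open>Counterpart of \<open>card_near_ge\<close>: \<open>card S + 1\<close> well-conditioned
  columns do not fit near a span of \<open>card S\<close> vectors.\<close>

lemma card_nb_le:
  assumes S: "S \<subseteq> I" "card S + 1 \<le> kC" and d: "2 * L\<^sup>2 * d \<le> 1"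
  shows "card (nb d S) \<le> card S"
proof (rule ccontr)
  assume "\<not> ?thesis"
  then have "card S + 1 \<le> card (nb d S)" by simp
  then obtain N where N: "N \<subseteq> nb d S" "card N = card S + 1" "finite N"
    using finite_nb by (elim subset_card_exists[rotated]) auto
  have fS: "finite S" using S fin finite_subset by blast
  have "card N \<le> card (c' ` S)"
    by (rule card_le_of_near[OF fin L card_le_L wcC _ _ _ _ d]) (use N S fS in \<open>auto simp: nb_def\<close>)
  also have "\<dots> \<le> card S" using fS by (rule card_image_le)
  finally show False using N by simp
qed

lemma two_L_sq_le_1: "m < 38 \<Longrightarrow> 2 * L\<^sup>2 * (L ^ m * e) \<le> 1"
proof -
  assume "m < 38"
  then have "100 * (L ^ (m + 2) * e) \<le> 1" by (intro pow_e_le_1) simp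
  moreover have "0 \<le> L ^ (m + 2) * e" using e L_pos by simp
  moreover have "2 * L\<^sup>2 * (L ^ m * e) = 2 * (L ^ (m + 2) * e)" by (simp add: power2_eq_square)
  ultimately show ?thesis by linarith
qed

text \<open>\<open>card S = kC - 1\<close> is the one size at which both counts apply,
  \<open>card_near_ge\<close> from below and \<open>card_nb_le\<close> from above. The sets for
  different widths are nested and of equal size, hence equal.\<close>

lemma nb_hyperplane:
  assumes S: "S \<subseteq> I" "card S + 1 = kC" and m: "6 \<le> m" "m < 38"
  shows "nb (L ^ m * e) S = nb (L ^ 6 * e) S" "card (nb (L ^ 6 * e) S) = card S"
proof -
  have "L ^ 6 * e \<le> L ^ m * e" using m L e by (intro mult_right_mono power_increasing) auto
  then have sub: "nb (L ^ 6 * e) S \<subseteq> nb (L ^ m * e) S" by (rule nb_mono) simp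
  have le: "card S \<le> card (nb (L ^ 6 * e) S)" unfolding nb_def using card_near_ge S by simp
  have "card (nb (L ^ m * e) S) \<le> card S" using S two_L_sq_le_1[OF m(2)] by (intro card_nb_le) auto
  with le card_seteq[OF finite_nb sub] show "nb (L ^ m * e) S = nb (L ^ 6 * e) S" by simp
  have "card (nb (L ^ 6 * e) S) \<le> card S" using S two_L_sq_le_1[of 6] by (intro card_nb_le) auto
  with le show "card (nb (L ^ 6 * e) S) = card S" by simp
qed

lemma span_near:
  assumes S: "S \<subseteq> I" "card S + 1 \<le> kC" "card (nb (L ^ m * e) S) = card S" and m: "m < 38"
    and w: "w \<in> span (c' ` S)"
  shows "near (2 * L\<^sup>2 * (L ^ m * e) * norm w) (c ` nb (L ^ m * e) S) w"
proof (rule near_of_card_le[OF fin L card_le_L wcC nb_subset _ _ _ _ two_L_sq_le_1[OF m] w])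
  show "finite S" using S fin finite_subset by blast
qed (use S e L_pos in \<open>auto simp: nb_def\<close>)

lemma col_near:
  assumes S: "S \<subseteq> I" "card S + 1 \<le> kC" "card (nb (L ^ m * e) S) = card S" and m: "m < 38"
    and s: "s \<in> S"
  shows "near (2 * (L ^ (m + 3) * e)) (c ` nb (L ^ m * e) S) (c' s)"
proof -
  have "2 * L\<^sup>2 * (L ^ m * e) * norm (c' s) \<le> 2 * L\<^sup>2 * (L ^ m * e) * L"
    using norm_c'[of s] s S e L_pos by (intro mult_left_mono) auto
  also have "\<dots> = 2 * (L ^ (m + 3) * e)" by (simp add: power_add eval_nat_numeral)
  finally show ?thesis
    by (rule near_mono[OF span_near[OF S m span_base[OF imageI[OF s]]] _ subset_refl])
qed

lemma le_inverse_12: "m < 28 \<Longrightarrow> 100 * (L ^ m * e) \<le> 1 / L ^ 12"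
  using pow_e_le_1[of "m + 12"] L_pos by (simp add: power_add field_simps)

text \<open>Eliminating \<open>c r\<close> between its approximations over \<open>insert i U\<close>
  and \<open>insert j U\<close> leaves a multiple \<open>\<beta> *\<^sub>R c' j\<close> close to the
  span over \<open>insert i U\<close>. Since \<open>c' j\<close> itself is far from what
  approximates that span, \<open>\<beta>\<close> is small and \<open>U\<close> alone
  suffices.\<close>

lemma nb_inter:
  assumes U: "U \<subseteq> I" "card U + 2 = kC" and ij: "i \<in> I - U" "j \<in> I - U" "i \<noteq> j"
  shows "nb (L ^ 6 * e) (insert i U) \<inter> nb (L ^ 6 * e) (insert j U) \<subseteq> nb (L ^ 20 * e) U"
proof
  fix r assume r: "r \<in> nb (L ^ 6 * e) (insert i U) \<inter> nb (L ^ 6 * e) (insert j U)"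
  let ?N = "nb (L ^ 6 * e) (insert i U)"
  have fU: "finite U" using U fin finite_subset by blast
  have Si: "insert i U \<subseteq> I" "card (insert i U) + 1 = kC" using U ij fU by auto
  have cN: "card ?N = card (insert i U)" using nb_hyperplane(2)[OF Si, of 6] by simp
  \<comment> \<open>Otherwise all \<open>kC\<close> columns of C' over
    \<open>insert j (insert i U)\<close> would be near the span of the \<open>kC - 1\<close> columns
    of C in \<open>?N\<close>.\<close>
  have nj: "\<not> near (1 / L ^ 12) (c ` ?N) (c' j)"
  proof
    assume nj: "near (1 / L ^ 12) (c ` ?N) (c' j)"
    show False
    proof (rule not_near_small_span[of "insert j (insert i U)" "c ` ?N"])
      show "card (c ` ?N) < card (insert j (insert i U))"
        using card_image_le[OF finite_nb, of c "L ^ 6 * e" "insert i U"] cN Si ij fU by auto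
      fix s assume s: "s \<in> insert j (insert i U)"
      show "near (1 / L ^ 12) (c ` ?N) (c' s)"
      proof (cases "s = j")
        case False
        then have "s \<in> insert i U" using s by blast
        from col_near[OF Si(1) _ cN _ this] have "near (2 * (L ^ 9 * e)) (c ` ?N) (c' s)"
          using Si by simp
        moreover have "2 * (L ^ 9 * e) \<le> 1 / L ^ 12" 
        proof -
          have "0 \<le> L ^ 9 * e" using e L_pos by simp
          then show ?thesis using le_inverse_12[of 9] by simp
        qed
        ultimately show ?thesis by (rule near_mono) simp
      qed (use nj in simp)
    qed (use Si ij fU U finite_nb in auto)
  qed
  obtain wj where wj: "wj \<in> span (c' ` insert j U)" "norm (c r - wj) \<le> L ^ 6 * e"
    using r unfolding nb_def near_def by fast
  obtain wi where wi: "wi \<in> span (c' ` insert i U)" "norm (c r - wi) \<le> L ^ 6 * e"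
    using r unfolding nb_def near_def by fast
  obtain \<beta> where \<beta>: "wj - \<beta> *\<^sub>R c' j \<in> span (c' ` U)"
    using wj(1) by (auto simp: span_breakdown_eq)
  define w where "w = wj - \<beta> *\<^sub>R c' j"
  define v where "v = wi - w"
  have "w \<in> span (c' ` insert i U)" using \<beta> span_mono[of "c' ` U" "c' ` insert i U"] by (auto simp: w_def)
  then have v: "v \<in> span (c' ` insert i U)" unfolding v_def using wi(1) by (intro span_diff)
  define d where "d = L ^ 6 * e"
  have d0: "0 < d" using e L_pos by (simp add: d_def)
  have bv: "norm (\<beta> *\<^sub>R c' j - v) \<le> 2 * d"
  proof -
    have "\<beta> *\<^sub>R c' j - v = (c r - wi) - (c r - wj)" by (simp add: v_def w_def)
    then show ?thesis using norm_triangle_ineq4[of "c r - wi" "c r - wj"] wi(2) wj(2) by (simp add: d_def)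
  qed
  have bL: "norm (\<beta> *\<^sub>R c' j) \<le> \<bar>\<beta>\<bar> * L" using norm_c'[of j] ij by (simp add: mult_left_mono)
  have nv: "norm v \<le> \<bar>\<beta>\<bar> * L + 2 * d"
    using norm_triangle_sub[of v "\<beta> *\<^sub>R c' j"] bv bL by (simp add: norm_minus_commute)
  have "near (2 * L\<^sup>2 * d * norm v) (c ` ?N) v"
    unfolding d_def using span_near[OF Si(1) _ cN _ v] Si by simp
  then obtain u where u: "u \<in> span (c ` ?N)" "norm (v - u) \<le> 2 * L\<^sup>2 * d * norm v"
    unfolding near_def by blast
  have "norm (\<beta> *\<^sub>R c' j - u) \<le> norm (\<beta> *\<^sub>R c' j - v) + norm (v - u)"
    using norm_triangle_ineq[of "\<beta> *\<^sub>R c' j - v" "v - u"] by simp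
  also have "\<dots> \<le> 2 * d + 2 * L\<^sup>2 * d * (\<bar>\<beta>\<bar> * L + 2 * d)"
    using bv u(2) mult_left_mono[OF nv, of "2 * L\<^sup>2 * d"] d0 by simp
  also have "\<dots> = 2 * d + 2 * L\<^sup>2 * d * (2 * d) + 2 * (L ^ 9 * e) * \<bar>\<beta>\<bar>"
    by (simp add: d_def algebra_simps eval_nat_numeral)
  also have "2 * L\<^sup>2 * d * (2 * d) \<le> 1 * (2 * d)"
    using two_L_sq_le_1[of 6] d0 unfolding d_def by (intro mult_right_mono) auto
  also have "2 * (L ^ 9 * e) * \<bar>\<beta>\<bar> \<le> (1 / L ^ 12 / 2) * \<bar>\<beta>\<bar>"
  proof (rule mult_right_mono)
    have "0 \<le> L ^ 9 * e" using e L_pos by simp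
    then show "2 * (L ^ 9 * e) \<le> 1 / L ^ 12 / 2" using le_inverse_12[of 9] by simp
  qed simp
  \<comment> \<open>The part of the error proportional to \<open>\<beta>\<close> uses up only half
    of the threshold; for large \<open>\<beta>\<close> the other part fits into the second half, and
    dividing by \<open>\<beta>\<close> contradicts \<open>nj\<close>.\<close>
  finally have bu: "norm (\<beta> *\<^sub>R c' j - u) \<le> 4 * d + \<bar>\<beta>\<bar> / L ^ 12 / 2" by simp
  have "\<bar>\<beta>\<bar> \<le> 8 * L ^ 12 * d"
  proof (rule ccontr)
    assume "\<not> ?thesis"
    then have gt: "8 * L ^ 12 * d < \<bar>\<beta>\<bar>" by simp
    then have nz: "\<beta> \<noteq> 0" 
    proof -
      have "0 < 8 * L ^ 12 * d" using d0 L_pos by simp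
      with gt show ?thesis by auto
    qed
    have "8 * d \<le> \<bar>\<beta>\<bar> / L ^ 12" using gt L_pos by (simp add: field_simps)
    then have "norm (\<beta> *\<^sub>R c' j - u) \<le> \<bar>\<beta>\<bar> / L ^ 12" using bu by simp
    moreover have "c' j - u /\<^sub>R \<beta> = (\<beta> *\<^sub>R c' j - u) /\<^sub>R \<beta>" using nz by (simp add: scaleR_diff_right)
    ultimately have "norm (c' j - u /\<^sub>R \<beta>) \<le> 1 / L ^ 12"
      using nz L_pos by (simp add: divide_simps mult.commute)
    then have "near (1 / L ^ 12) (c ` ?N) (c' j)"
      unfolding near_def using u(1) span_scale by blast
    with nj show False by blast
  qed
  then have "norm (\<beta> *\<^sub>R c' j) \<le> 8 * L ^ 12 * d * L"
    using L_pos by (intro order_trans[OF bL] mult_right_mono) auto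
  \<comment> \<open>The exponent 19 is 6 for \<open>d\<close>, 12 for the threshold and 1 for the
    norm of \<open>c' j\<close>; one more power absorbs the constants.\<close>
  also have "\<dots> = 8 * (L ^ 19 * e)" by (simp add: d_def eval_nat_numeral)
  finally have "norm (\<beta> *\<^sub>R c' j) \<le> 8 * (L ^ 19 * e)" .
  moreover have "norm (c r - w) \<le> norm (c r - wj) + norm (\<beta> *\<^sub>R c' j)"
    using norm_triangle_ineq[of "c r - wj" "\<beta> *\<^sub>R c' j"] by (simp only: w_def diff_diff_eq2 diff_add_eq)
  ultimately have "norm (c r - w) \<le> L ^ 6 * e + 8 * (L ^ 19 * e)"
    using wj(2) by linarith
  moreover have "0 \<le> L ^ 6 * e" "0 \<le> L ^ 20 * e" using e L_pos by auto
  ultimately have "norm (c r - w) \<le> L ^ 20 * e"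
    using pow_e_le[of 6 20] pow_e_le[of 19 20] by simp
  then show "r \<in> nb (L ^ 20 * e) U"
    unfolding nb_def near_def using r \<beta> nb_subset by (auto simp: w_def)
qed

lemma kC_ge_2: "2 \<le> kC"
  using k_sum kA kB by linarith

text \<open>Kruskal's counting argument: the sets \<open>nb (insert i U)\<close> all contain \<open>nb U\<close>, are pairwise
  disjoint outside of it, and have to fit into \<open>I\<close>.\<close>

lemma card_nb_codim_2:
  assumes U: "U \<subseteq> I" "card U + 2 = kC"
  shows "card (nb (L ^ 20 * e) U) = card U"
proof -
  have fU: "finite U" using U fin finite_subset by blast
  let ?V = "nb (L ^ 20 * e) U"
  define N where "N i = nb (L ^ 6 * e) (insert i U)" for i
  have N: "card (N i) = card U + 1" "?V \<subseteq> N i" if i: "i \<in> I - U" for i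
  proof -
    have S: "insert i U \<subseteq> I" "card (insert i U) + 1 = kC" using U i fU by auto
    show "card (N i) = card U + 1"
      using nb_hyperplane(2)[OF S, of 6] i fU by (simp add: N_def)
    \<comment> \<open>The wider set over \<open>U\<close> fits into the narrower one over
      \<open>insert i U\<close> because the latter does not depend on the width.\<close>
    have "?V \<subseteq> nb (L ^ 20 * e) (insert i U)" by (rule nb_mono) auto
    also have "\<dots> = N i" unfolding N_def using nb_hyperplane(1)[OF S, of 20] by simp
    finally show "?V \<subseteq> N i" .
  qed
  have le: "card ?V \<le> card U" using U two_L_sq_le_1[of 20] by (intro card_nb_le) auto
  have "card (\<Union>i\<in>I - U. N i - ?V) = (\<Sum>i\<in>I - U. card (N i - ?V))"
  proof (rule card_UN_disjoint)
    show "\<forall>i\<in>I - U. \<forall>j\<in>I - U. i \<noteq> j \<longrightarrow> (N i - ?V) \<inter> (N j - ?V) = {}"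
      using nb_inter[OF U] unfolding N_def by blast
  qed (use fin finite_nb in \<open>auto simp: N_def\<close>)
  also have "\<dots> = (\<Sum>i\<in>I - U. card U + 1 - card ?V)"
    using N finite_nb by (intro sum.cong refl) (simp add: card_Diff_subset)
  also have "\<dots> = (card I - card U) * (card U + 1 - card ?V)"
    using U fU by (simp add: card_Diff_subset)
  finally have 1: "card (\<Union>i\<in>I - U. N i - ?V) = (card I - card U) * (card U + 1 - card ?V)" .
  have "card (\<Union>i\<in>I - U. N i - ?V) \<le> card (I - ?V)"
    using fin nb_subset by (intro card_mono) (auto simp: N_def)
  also have "\<dots> = card I - card ?V"
    using nb_subset finite_nb by (simp add: card_Diff_subset)
  finally have 2: "(card I - card U) * (card U + 1 - card ?V) \<le> card I - card ?V" using 1 by simp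
  \<comment> \<open>\<open>q\<close> disjoint sets of \<open>t + 1\<close> indices fit into
    \<open>q + t\<close> indices, so \<open>q * t\<close> is at most \<open>t\<close>, and
    \<open>q \<ge> 2\<close> forces \<open>t = 0\<close>. By \<open>le\<close>, the subtraction in
    \<open>t\<close> is not truncated.\<close>
  define q t where "q = card I - card U" and "t = card U - card ?V"
  have q: "2 \<le> q" using U kC by (simp add: q_def)
  have "card U + 1 - card ?V = t + 1" "card I - card ?V = q + t"
    using le q by (auto simp: q_def t_def)
  with 2 have "q * t + q \<le> q + t" by (simp add: q_def)
  moreover have "2 * t \<le> q * t" using q by (rule mult_right_mono) simp
  ultimately have "t = 0" by linarith
  with le show ?thesis by (simp add: t_def)
qed

lemma column_near_multiple:
  assumes s: "s \<in> I"
  shows "\<exists>r\<in>I. \<exists>g. norm (c' s - g *\<^sub>R c r) \<le> L ^ 27 * e"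
proof -
  have "\<exists>S. {s} \<subseteq> S \<and> S \<subseteq> I \<and> card S = kC - 1"
    by (rule exists_subset_between) (use s fin kC kC_ge_2 in auto)
  then obtain S where S: "{s} \<subseteq> S" "S \<subseteq> I" "card S = kC - 1" by blast
  have fS: "finite S" using S fin finite_subset by blast
  have cS: "card S + 1 = kC" using S kC_ge_2 by simp
  define N where "N = nb (L ^ 20 * e) S"
  have cN: "card N = card S"
    unfolding N_def using nb_hyperplane[OF S(2) cS, of 20] by simp
  have fN: "finite N" and NI: "N \<subseteq> I" unfolding N_def by (rule finite_nb nb_subset)+
  define V where "V t = nb (L ^ 20 * e) (S - {t})" for t
  have V: "V t \<subseteq> N" "card (V t) = card S - 1" if "t \<in> S" for t
  proof -
    show "V t \<subseteq> N" unfolding V_def N_def by (rule nb_mono) auto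
    show "card (V t) = card S - 1"
    proof -
      have c: "card (S - {t}) = card S - 1" using that fS by simp
      moreover have "card S - 1 + 2 = kC" using cS kC_ge_2 by linarith
      ultimately show ?thesis
        unfolding V_def using card_nb_codim_2[of "S - {t}"] S by auto
    qed
  qed
  have Vnear: "near (2 * (L ^ 23 * e)) (c ` V t) (c' i)" if t: "t \<in> S" "i \<in> S" "i \<noteq> t" for t i
  proof -
    have "card (S - {t}) = card S - 1" "S - {t} \<subseteq> I" using t fS S(2) by auto
    then show ?thesis
      using col_near[of "S - {t}" 20 i] V(2)[OF t(1)] cS t by (simp add: V_def)
  qed
  have "\<exists>u. N - V t = {u}" if "t \<in> S" for t
  proof -
    have "card (N - V t) = 1"
      using V[OF that] cN cS kC_ge_2 finite_subset[OF V(1)[OF that] fN] by (simp add: card_Diff_subset)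
    then show ?thesis by (simp add: card_1_singleton_iff)
  qed
  \<comment> \<open>\<open>f t\<close> is the index that \<open>N\<close> loses when
    \<open>t\<close> is dropped from \<open>S\<close>: in the exact case, the column matched with
    \<open>t\<close>.\<close>
  then obtain f where f: "\<And>t. t \<in> S \<Longrightarrow> N - V t = {f t}" by metis
  \<comment> \<open>If \<open>t\<close> and \<open>u\<close> lost the same index, then
    \<open>V t = V u\<close>, and every column of C' in \<open>S\<close> would be near the span of
    these \<open>kC - 2\<close> columns of C: \<open>c' t\<close> by way of \<open>u\<close>, all
    others by way of \<open>t\<close>.\<close>
  have inj: "inj_on f (S - {s})"
  proof (rule inj_onI, rule ccontr)
    fix t u assume tu: "t \<in> S - {s}" "u \<in> S - {s}" "f t = f u" "t \<noteq> u"
    have "V i = N - {f i}" if "i \<in> S" for i using f[OF that] V(1)[OF that] by auto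
    then have "V t = V u" using tu by simp
    have fV: "finite (V t)" unfolding V_def by (rule finite_nb)
    show False
    proof (rule not_near_small_span[OF S(2), of "c ` V t"])
      show "card (c ` V t) < card S"
        using card_image_le[OF fV, of c] V(2)[of t] tu cS kC_ge_2 by simp
      fix i assume i: "i \<in> S"
      have "near (2 * (L ^ 23 * e)) (c ` V t) (c' i)"
        using Vnear[of t i] Vnear[of u i] \<open>V t = V u\<close> tu i by (cases "i = t") auto
      moreover have "0 \<le> L ^ 23 * e" using e L_pos by simp
      then have "2 * (L ^ 23 * e) \<le> 1 / L ^ 12" using le_inverse_12[of 23] by simp
      ultimately show "near (1 / L ^ 12) (c ` V t) (c' i)" by (rule near_mono) simp
    qed (use cS fV in auto)
  qed
  have "f ` (S - {s}) \<subseteq> N" using f by auto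
  moreover have "card (f ` (S - {s})) = card S - 1"
    using inj S fS by (simp add: card_image card_Diff_subset)
  ultimately have "card (N - f ` (S - {s})) = 1"
    using fN cN cS kC_ge_2 fS by (subst card_Diff_subset) auto
  then obtain r where r: "N - f ` (S - {s}) = {r}" by (auto simp: card_1_singleton_iff)
  have rN: "r \<in> N" using r by blast
  let ?d = "L ^ 23 * e"
  have d0: "0 \<le> ?d" using e L_pos by simp
  have "near (2 * ?d) (c ` N) (c' s)"
    using col_near[of S 20 s] S cS cN unfolding N_def by simp
  then obtain u where u: "u \<in> span (c ` N)" "norm (c' s - u) \<le> 2 * ?d" unfolding near_def by blast
  obtain g where g: "u = (\<Sum>i\<in>N. g i *\<^sub>R c i)" by (rule span_image_sumE[OF fN u(1)])
  \<comment> \<open>\<open>V t\<close> omits \<open>f t\<close>, so at this index the expansions of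
    \<open>c' s\<close> over \<open>N\<close> and over \<open>V t\<close> differ by all of
    \<open>g i\<close>, and conditioning bounds the difference of the coefficients.\<close>
  have gs: "\<bar>g i\<bar> \<le> L * (4 * ?d)" if i: "i \<in> N - {r}" for i
  proof -
    obtain t where t: "t \<in> S - {s}" "i = f t" using i r by blast
    obtain v where v: "v \<in> span (c ` V t)" "norm (c' s - v) \<le> 2 * ?d"
      using Vnear[of t s] t S unfolding near_def by blast
    have fV: "finite (V t)" unfolding V_def by (rule finite_nb)
    obtain h where h: "v = (\<Sum>j\<in>V t. h j *\<^sub>R c j)" by (rule span_image_sumE[OF fV v(1)])
    define k where "k j = g j - (if j \<in> V t then h j else 0)" for j
    have "v = (\<Sum>j\<in>N. (if j \<in> V t then h j else 0) *\<^sub>R c j)"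
      unfolding h using V(1)[of t] t fN by (intro sum.mono_neutral_cong_left) auto
    then have "(\<Sum>j\<in>N. k j *\<^sub>R c j) = u - v"
      unfolding g k_def by (simp add: scaleR_diff_left sum_subtractf)
    moreover have "\<bar>k i\<bar> \<le> L * norm (\<Sum>j\<in>N. k j *\<^sub>R c j)"
      using i cN cS by (intro well_conditionedD[OF wcC NI]) auto
    moreover have "k i = g i" using f[of t] t by (auto simp: k_def)
    moreover have "norm (u - v) \<le> 4 * ?d"
      using norm_triangle_ineq4[of "c' s - v" "c' s - u"] u(2) v(2) by simp
    moreover have "L * norm (u - v) \<le> L * (4 * ?d)"
      using calculation(4) L_pos by (intro mult_left_mono) auto
    ultimately show ?thesis by simp
  qed
  have "u = g r *\<^sub>R c r + (\<Sum>i\<in>N - {r}. g i *\<^sub>R c i)"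
    unfolding g using fN rN by (simp add: sum.remove[of N r])
  then have "c' s - g r *\<^sub>R c r = (c' s - u) + (\<Sum>i\<in>N - {r}. g i *\<^sub>R c i)" by simp
  then have "norm (c' s - g r *\<^sub>R c r) \<le> norm (c' s - u) + norm (\<Sum>i\<in>N - {r}. g i *\<^sub>R c i)"
    by (metis norm_triangle_ineq)
  also have "\<dots> \<le> 2 * ?d + L * (L * (4 * ?d) * L)"
  proof (rule add_mono[OF u(2)])
    have "norm (\<Sum>i\<in>N - {r}. g i *\<^sub>R c i) \<le> (\<Sum>i\<in>N - {r}. norm (g i *\<^sub>R c i))" by (rule norm_sum)
    also have "\<dots> \<le> (\<Sum>i\<in>N - {r}. L * (4 * ?d) * L)"
    proof (rule sum_mono)
      fix i assume "i \<in> N - {r}"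
      then show "norm (g i *\<^sub>R c i) \<le> L * (4 * ?d) * L"
        unfolding norm_scaleR using gs norm_c[of i] NI d0 L_pos by (intro mult_mono) auto
    qed
    also have "\<dots> = real (card (N - {r})) * (L * (4 * ?d) * L)" by simp
    also have "\<dots> \<le> L * (L * (4 * ?d) * L)"
    proof (rule mult_right_mono)
      have "card (N - {r}) \<le> card I" using NI fin by (intro card_mono) auto
      then show "real (card (N - {r})) \<le> L" using card_le_L by simp
    qed (use d0 L_pos in simp)
    finally show "norm (\<Sum>i\<in>N - {r}. g i *\<^sub>R c i) \<le> L * (L * (4 * ?d) * L)" .
  qed
  \<comment> \<open>Here 23 is the width 20 plus 3 from \<open>col_near\<close>; three more powers
    come from the conditioning, the norms of the columns and the number of terms.\<close>
  also have "\<dots> = 2 * (L ^ 23 * e) + 4 * (L ^ 26 * e)" by (simp add: eval_nat_numeral)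
  also have "\<dots> \<le> L ^ 27 * e"
  proof -
    have "0 \<le> L ^ 26 * e" using e L_pos by simp
    then show ?thesis using pow_e_le[of 23 26] pow_e_le[of 26 27] d0 by linarith
  qed
  finally show ?thesis using rN NI by blast
qed

text \<open>If \<open>s\<close> and \<open>t\<close> shared a partner, this one vector and
  \<open>kC - 2\<close> columns of C' would nearly span the \<open>kC\<close> columns of a set
  containing both, against \<open>not_near_small_span\<close>.\<close>

lemma near_permutation:
  "\<exists>\<pi> g. bij_betw \<pi> I I \<and> (\<forall>s\<in>I. norm (c' s - g s *\<^sub>R c (\<pi> s)) \<le> L ^ 27 * e)"
proof -
  obtain \<pi> g where p: "\<And>s. s \<in> I \<Longrightarrow> \<pi> s \<in> I" "\<And>s. s \<in> I \<Longrightarrow> norm (c' s - g s *\<^sub>R c (\<pi> s)) \<le> L ^ 27 * e"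
    using column_near_multiple by metis
  have "inj_on \<pi> I"
  proof (rule inj_onI, rule ccontr)
    fix s t assume st: "s \<in> I" "t \<in> I" "\<pi> s = \<pi> t" "s \<noteq> t"
    have "\<exists>S. {s, t} \<subseteq> S \<and> S \<subseteq> I \<and> card S = kC"
      by (rule exists_subset_between) (use st fin kC kC_ge_2 in auto)
    then obtain S where S: "{s, t} \<subseteq> S" "S \<subseteq> I" "card S = kC" by blast
    have fS: "finite S" using S fin finite_subset by blast
    let ?F = "insert (c (\<pi> s)) (c' ` (S - {s, t}))"
    show False
    proof (rule not_near_small_span[OF S(2), of ?F])
      have "card ?F \<le> Suc (card (c' ` (S - {s, t})))" using fS by (simp add: card_insert_if)
      also have "\<dots> \<le> Suc (card (S - {s, t}))" using fS by (simp add: card_image_le)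
      also have "card (S - {s, t}) = card S - 2"
        using S st fS by (subst card_Diff_subset) auto
      finally show "card ?F < card S" using S kC_ge_2 by simp
      fix i assume i: "i \<in> S"
      show "near (1 / L ^ 12) ?F (c' i)"
      proof (cases "i \<in> {s, t}")
        case True
        then have "norm (c' i - g i *\<^sub>R c (\<pi> s)) \<le> L ^ 27 * e" using p(2)[of i] st by auto
        moreover have "0 \<le> L ^ 27 * e" using e L_pos by simp
        ultimately have "norm (c' i - g i *\<^sub>R c (\<pi> s)) \<le> 1 / L ^ 12"
          using le_inverse_12[of 27] by simp
        moreover have "g i *\<^sub>R c (\<pi> s) \<in> span ?F" by (intro span_scale span_base) simp
        ultimately show ?thesis unfolding near_def by blast
      next
        case False
        then have "c' i \<in> span ?F" using i by (intro span_base) auto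
        then show ?thesis unfolding near_def using L_pos by (intro bexI[of _ "c' i"]) auto
      qed
    qed (use S fS in auto)
  qed
  moreover have "\<pi> ` I = I"
    using p(1) \<open>inj_on \<pi> I\<close> fin by (intro endo_inj_surj) auto
  ultimately show ?thesis using p(2) unfolding bij_betw_def by blast
qed

end

section \<open>Matching the three factors\<close>

text \<open>Telescoping in the three factors; primed factors are at most twice the bound of the
  unprimed ones, whence 7 = 1 + 2 + 4.\<close>

lemma abs_mult3_diff_le:
  fixes p q r p' q' r' :: real
  assumes "\<bar>p\<bar> \<le> P" "\<bar>q\<bar> \<le> Q" "\<bar>r\<bar> \<le> R" "\<bar>p - p'\<bar> \<le> d * P" "\<bar>q - q'\<bar> \<le> d * Q" "\<bar>r - r'\<bar> \<le> d * R"
    and d: "0 \<le> d" "d \<le> 1"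
  shows "\<bar>p * q * r - p' * q' * r'\<bar> \<le> 7 * d * (P * Q * R)"
proof -
  have P: "0 \<le> P" "0 \<le> Q" "0 \<le> R" using assms(1-3) by linarith+
  have p': "\<bar>p'\<bar> \<le> 2 * P" using assms(1,4) mult_right_mono[OF d(2) P(1)] by linarith
  have q': "\<bar>q'\<bar> \<le> 2 * Q" using assms(2,5) mult_right_mono[OF d(2) P(2)] by linarith
  have "\<bar>(p - p') * q * r\<bar> \<le> (d * P) * Q * R"
    unfolding abs_mult by (intro mult_mono mult_nonneg_nonneg assms P abs_ge_zero)
  moreover have "\<bar>p' * (q - q') * r\<bar> \<le> (2 * P) * (d * Q) * R"
    unfolding abs_mult using P by (intro mult_mono mult_nonneg_nonneg assms p' abs_ge_zero) auto
  moreover have "\<bar>p' * q' * (r - r')\<bar> \<le> (2 * P) * (2 * Q) * (d * R)"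
    unfolding abs_mult using P by (intro mult_mono mult_nonneg_nonneg assms p' q' abs_ge_zero) auto
  moreover have "p * q * r - p' * q' * r' = (p - p') * q * r + p' * (q - q') * r + p' * q' * (r - r')"
    by (simp add: left_diff_distrib right_diff_distrib)
  moreover have "(d * P) * Q * R + (2 * P) * (d * Q) * R + (2 * P) * (2 * Q) * (d * R) = 7 * d * (P * Q * R)"
    by simp
  ultimately show ?thesis by linarith
qed

context cp_approx_bounded
begin

text \<open>After the replacement the second tensor consists of multiples of columns of A, B and C,
  on which dual vectors can be evaluated exactly. The exponent 31 is 26 for the relative error, 3
  for the norms, 1 for the number of terms and 1 for the constants.\<close>

lemma scaled_permutations_close:
  assumes \<pi>: "bij_betw \<pi>A I I" "bij_betw \<pi>B I I" "bij_betw \<pi>C I I"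
    and A: "\<And>s. s \<in> I \<Longrightarrow> norm (a' s - \<alpha> s *\<^sub>R a (\<pi>A s)) \<le> L ^ 27 * e"
    and B: "\<And>s. s \<in> I \<Longrightarrow> norm (b' s - \<beta> s *\<^sub>R b (\<pi>B s)) \<le> L ^ 27 * e"
    and C: "\<And>s. s \<in> I \<Longrightarrow> norm (c' s - \<gamma> s *\<^sub>R c (\<pi>C s)) \<le> L ^ 27 * e"
  shows "cp_approx I kA kB kC L (L ^ 31 * e) a (\<lambda>s. \<alpha> s *\<^sub>R a (\<pi>A s)) b (\<lambda>s. \<beta> s *\<^sub>R b (\<pi>B s))
           c (\<lambda>s. \<gamma> s *\<^sub>R c (\<pi>C s))"
proof -
  let ?a = "\<lambda>s. \<alpha> s *\<^sub>R a (\<pi>A s)" and ?b = "\<lambda>s. \<beta> s *\<^sub>R b (\<pi>B s)" and ?c = "\<lambda>s. \<gamma> s *\<^sub>R c (\<pi>C s)"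
  define d where "d = L ^ 26 * e"
  have d: "0 \<le> d" "d \<le> 1" "L ^ 27 * e = d * L"
    using pow_e_le_1[of 26] e L_pos by (simp_all add: d_def eval_nat_numeral)
  have "\<bar>(\<Sum>r\<in>I. inner (a r) x * inner (b r) y * inner (c r) z)
        - (\<Sum>r\<in>I. inner (?a r) x * inner (?b r) y * inner (?c r) z)\<bar>
        \<le> (L ^ 31 * e) * norm x * norm y * norm z" for x y z
  proof -
    have "\<bar>\<Sum>r\<in>I. inner (a' r) x * inner (b' r) y * inner (c' r) z
              - inner (?a r) x * inner (?b r) y * inner (?c r) z\<bar>
        \<le> (\<Sum>r\<in>I. \<bar>inner (a' r) x * inner (b' r) y * inner (c' r) z
              - inner (?a r) x * inner (?b r) y * inner (?c r) z\<bar>)" by (rule sum_abs)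
    also have "\<dots> \<le> (\<Sum>r\<in>I. 7 * d * ((L * norm x) * (L * norm y) * (L * norm z)))"
    proof (rule sum_mono)
      fix r assume r: "r \<in> I"
      have sA: "\<bar>inner (a' r) x - inner (?a r) x\<bar> \<le> d * (L * norm x)"
        unfolding inner_diff_left[symmetric] d(3)[symmetric] mult.assoc[symmetric]
        by (rule order_trans[OF Cauchy_Schwarz_ineq2 mult_right_mono[OF A[OF r] norm_ge_zero]])
      have sB: "\<bar>inner (b' r) y - inner (?b r) y\<bar> \<le> d * (L * norm y)"
        unfolding inner_diff_left[symmetric] d(3)[symmetric] mult.assoc[symmetric]
        by (rule order_trans[OF Cauchy_Schwarz_ineq2 mult_right_mono[OF B[OF r] norm_ge_zero]])
      have sC: "\<bar>inner (c' r) z - inner (?c r) z\<bar> \<le> d * (L * norm z)"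
        unfolding inner_diff_left[symmetric] d(3)[symmetric] mult.assoc[symmetric]
        by (rule order_trans[OF Cauchy_Schwarz_ineq2 mult_right_mono[OF C[OF r] norm_ge_zero]])
      show "\<bar>inner (a' r) x * inner (b' r) y * inner (c' r) z
              - inner (?a r) x * inner (?b r) y * inner (?c r) z\<bar>
          \<le> 7 * d * ((L * norm x) * (L * norm y) * (L * norm z))"
        by (rule abs_mult3_diff_le[OF _ _ _ sA sB sC d(1,2)];
            rule order_trans[OF Cauchy_Schwarz_ineq2 mult_right_mono[OF _ norm_ge_zero]])
          (use norm_a' norm_b' norm_c' r in auto)
    qed
    also have "\<dots> = real (card I) * (7 * d * ((L * norm x) * (L * norm y) * (L * norm z)))" by simp
    also have "\<dots> \<le> L * (7 * d * ((L * norm x) * (L * norm y) * (L * norm z)))"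
      using card_le_L L_pos d(1) by (intro mult_right_mono) auto
    also have "\<dots> = 7 * (L ^ 30 * e) * (norm x * norm y * norm z)"
      by (simp add: d_def eval_nat_numeral)
    finally have 1: "\<bar>(\<Sum>r\<in>I. inner (a' r) x * inner (b' r) y * inner (c' r) z)
        - (\<Sum>r\<in>I. inner (?a r) x * inner (?b r) y * inner (?c r) z)\<bar>
        \<le> 7 * (L ^ 30 * e) * (norm x * norm y * norm z)" by (simp only: sum_subtractf)
    have 2: "\<bar>(\<Sum>r\<in>I. inner (a r) x * inner (b r) y * inner (c r) z)
        - (\<Sum>r\<in>I. inner (a' r) x * inner (b' r) y * inner (c' r) z)\<bar>
        \<le> e * (norm x * norm y * norm z)" using close[of x y z] by (simp only: mult.assoc)
    have "0 \<le> L ^ 30 * e" using e L_pos by simp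
    then have "e + 7 * (L ^ 30 * e) \<le> L ^ 31 * e"
      using pow_e_le[of 0 30] pow_e_le[of 30 31] by simp
    then have "(e + 7 * (L ^ 30 * e)) * (norm x * norm y * norm z) \<le> L ^ 31 * e * (norm x * norm y * norm z)"
      by (intro mult_right_mono) auto
    with 1 2 show ?thesis by (simp only: distrib_right mult.assoc)
  qed
  moreover have "0 < L ^ 31 * e" using e L_pos by simp
  ultimately show ?thesis
    by (intro cp_approx.intro fin L card_le_L wcA wcB wcC kA kB kC k_sum)
qed

lemma permutations_agree:
  assumes \<pi>: "bij_betw \<pi>A I I" "bij_betw \<pi>B I I" "bij_betw \<pi>C I I"
    and A: "\<And>s. s \<in> I \<Longrightarrow> norm (a' s - \<alpha> s *\<^sub>R a (\<pi>A s)) \<le> L ^ 27 * e"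
    and B: "\<And>s. s \<in> I \<Longrightarrow> norm (b' s - \<beta> s *\<^sub>R b (\<pi>B s)) \<le> L ^ 27 * e"
    and C: "\<And>s. s \<in> I \<Longrightarrow> norm (c' s - \<gamma> s *\<^sub>R c (\<pi>C s)) \<le> L ^ 27 * e"
    and s: "s \<in> I"
  shows "\<pi>B s = \<pi>A s" "\<pi>C s = \<pi>A s" "\<bar>\<alpha> s * \<beta> s * \<gamma> s - 1\<bar> \<le> L ^ 34 * e"
proof -
  interpret p: cp_approx I kA kB kC L "L ^ 31 * e" a "\<lambda>s. \<alpha> s *\<^sub>R a (\<pi>A s)" b "\<lambda>s. \<beta> s *\<^sub>R b (\<pi>B s)"
           c "\<lambda>s. \<gamma> s *\<^sub>R c (\<pi>C s)"
    by (rule scaled_permutations_close[OF \<pi> A B C])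
  define r where "r = \<pi>A s"
  have mem: "\<pi>A t \<in> I" "\<pi>B t \<in> I" "\<pi>C t \<in> I" if "t \<in> I" for t
    using \<pi> that bij_betwE by metis+
  have r: "r \<in> I" using mem s by (simp add: r_def)
  have "2 \<le> card I" using kC_ge_2 kC by linarith
  then have "card (I - {r}) \<noteq> 0" using r fin by simp
  then have "I - {r} \<noteq> {}" by force
  then obtain o' where o': "o' \<in> I - {r}" by blast
  \<comment> \<open>\<open>x\<close> and \<open>y\<close> will be known only on
    \<open>insert r Q\<close> and \<open>insert r Q'\<close>. Putting \<open>q\<close> into
    \<open>Q\<close> and \<open>q'\<close> into \<open>Q'\<close> makes these sets contain
    \<open>\<pi>C s\<close> and \<open>\<pi>B s\<close>; \<open>o'\<close> is a filler in case of
    equality with \<open>r\<close>.\<close>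
  define q where "q = (if \<pi>C s = r then o' else \<pi>C s)"
  define q' where "q' = (if \<pi>B s = r then o' else \<pi>B s)"
  have q: "q \<in> I - {r}" "q' \<in> I - {r}" using o' mem s by (auto simp: q_def q'_def)
  have cIr: "card (I - {r}) = card I - 1" using r fin by simp
  have "\<exists>Q. {q} \<subseteq> Q \<and> Q \<subseteq> I - {r} \<and> card Q = kC - 1"
    by (rule exists_subset_between) (use q fin kC kC_ge_2 cIr in auto)
  then obtain Q where Q: "q \<in> Q" "Q \<subseteq> I - {r}" "card Q = kC - 1" by blast
  have fQ: "finite Q" using Q fin finite_subset by blast
  have "card (I - {r} - Q) = card I - kC"
    using Q cIr fin kC_ge_2 by (simp add: card_Diff_subset fQ)
  \<comment> \<open>There is room for \<open>Q'\<close>: \<open>card I - kC + 1 \<le> kB - 1\<close>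
    follows from \<open>k_sum\<close> and \<open>kA \<le> card I\<close>.\<close>
  then have "card (insert q' (I - {r} - Q)) \<le> card I - kC + 1"
    using fin by (simp add: card_insert_if)
  then have "\<exists>Q'. insert q' (I - {r} - Q) \<subseteq> Q' \<and> Q' \<subseteq> I - {r} \<and> card Q' = kB - 1"
    using q fin k_sum kA kB kC cIr by (intro exists_subset_between) auto
  then obtain Q' where Q': "q' \<in> Q'" "I - {r} - Q \<subseteq> Q'" "Q' \<subseteq> I - {r}" "card Q' = kB - 1" by blast
  have fQ': "finite Q'" using Q' fin finite_subset by blast
  have rQ: "r \<notin> Q" "r \<notin> Q'" using Q Q' by auto
  have "1 \<le> kB" using k_sum kA kB kC by linarith
  obtain x where x: "\<And>i. i \<in> insert r Q \<Longrightarrow> inner (c i) x = (if i = r then 1 else 0)" "norm x \<le> L"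
    by (rule dual_vector[OF wcC _ _ insertI1 fin L_pos, of r Q])
      (use Q r fQ rQ kC_ge_2 in auto)
  obtain y where y: "\<And>i. i \<in> insert r Q' \<Longrightarrow> inner (b i) y = (if i = r then 1 else 0)" "norm y \<le> L"
    by (rule dual_vector[OF wcB _ _ insertI1 fin L_pos, of r Q'])
      (use Q' r fQ' rQ \<open>1 \<le> kB\<close> in auto)
  define \<sigma> where "\<sigma> = the_inv_into I \<pi>A"
  have \<sigma>\<pi>: "\<sigma> (\<pi>A t) = t" if "t \<in> I" for t
    unfolding \<sigma>_def using \<pi>(1) that by (simp add: bij_betw_def the_inv_into_f_f)
  have \<sigma>: "bij_betw \<sigma> I I" unfolding \<sigma>_def using \<pi>(1) by (rule bij_betw_the_inv_into)
  define \<mu> where "\<mu> t = \<alpha> t * \<beta> t * \<gamma> t * inner (b (\<pi>B t)) y * inner (c (\<pi>C t)) x" for t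
  \<comment> \<open>\<open>Q\<close> and \<open>Q'\<close> together exhaust \<open>I - {r}\<close>,
    so every term except \<open>a r\<close> is killed by \<open>x\<close> or by
    \<open>y\<close>.\<close>
  have left: "(\<Sum>i\<in>I. (inner (b i) y * inner (c i) x) *\<^sub>R a i) = (\<Sum>i\<in>I. (if i = r then 1 else 0) *\<^sub>R a i)"
  proof (intro sum.cong refl)
    fix i assume i: "i \<in> I"
    consider "i = r" | "i \<in> Q" "i \<noteq> r" | "i \<in> Q'" "i \<noteq> r" using i Q'(2) by blast
    then show "(inner (b i) y * inner (c i) x) *\<^sub>R a i = (if i = r then 1 else 0) *\<^sub>R a i"
      by cases (use x(1)[of i] y(1)[of i] in auto)
  qed
  have right: "(\<Sum>t\<in>I. (inner (\<beta> t *\<^sub>R b (\<pi>B t)) y * inner (\<gamma> t *\<^sub>R c (\<pi>C t)) x) *\<^sub>R (\<alpha> t *\<^sub>R a (\<pi>A t)))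
      = (\<Sum>i\<in>I. \<mu> (\<sigma> i) *\<^sub>R a i)"
  proof -
    have "(\<Sum>i\<in>I. \<mu> (\<sigma> i) *\<^sub>R a i) = (\<Sum>t\<in>I. \<mu> (\<sigma> (\<pi>A t)) *\<^sub>R a (\<pi>A t))"
      using sum.reindex_bij_betw[OF \<pi>(1), of "\<lambda>i. \<mu> (\<sigma> i) *\<^sub>R a i"] by simp
    then show ?thesis by (simp add: \<sigma>\<pi> \<mu>_def mult.commute mult.left_commute mult.assoc)
  qed
  define f where "f i = (if i = r then 1 else 0) - \<mu> (\<sigma> i)" for i
  have fsum: "norm (\<Sum>i\<in>I. f i *\<^sub>R a i) \<le> L ^ 33 * e"
  proof -
    have "norm (\<Sum>i\<in>I. f i *\<^sub>R a i) \<le> L ^ 31 * e * norm y * norm x"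
      using p.contraction_close[of y x] unfolding left right
      by (simp only: f_def scaleR_diff_left sum_subtractf)
    also have "\<dots> \<le> L ^ 31 * e * L * L"
      using x(2) y(2) e L_pos by (intro mult_mono mult_nonneg_nonneg) auto
    also have "\<dots> = L ^ 33 * e" by (simp add: eval_nat_numeral)
    finally show ?thesis .
  qed
  \<comment> \<open>Outside of \<open>M\<close> the coefficient \<open>f\<close> vanishes, since
    \<open>x\<close> annihilates the matched column of C. \<open>M\<close> has at most
    \<open>card I - kC + 2\<close> elements, hence at most \<open>kA\<close> by \<open>k_sum\<close>
    and \<open>kB \<le> card I\<close>.\<close>
  define M where "M = insert r {i\<in>I. \<pi>C (\<sigma> i) \<notin> Q}"
  have MI: "M \<subseteq> I" using r by (auto simp: M_def)
  have "card {i\<in>I. \<pi>C (\<sigma> i) \<notin> Q} \<le> card (I - Q)"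
  proof (rule card_inj_on_le)
    have "bij_betw (\<pi>C \<circ> \<sigma>) I I" by (rule bij_betw_trans[OF \<sigma> \<pi>(3)])
    then show "inj_on (\<lambda>i. \<pi>C (\<sigma> i)) {i\<in>I. \<pi>C (\<sigma> i) \<notin> Q}"
      by (auto simp: bij_betw_def o_def intro: inj_on_subset)
    show "(\<lambda>i. \<pi>C (\<sigma> i)) ` {i\<in>I. \<pi>C (\<sigma> i) \<notin> Q} \<subseteq> I - Q"
      using bij_betwE[OF \<sigma>] mem by auto
  qed (use fin in auto)
  also have "card (I - Q) = card I - (kC - 1)"
    using Q fQ by (subst card_Diff_subset) auto
  finally have "card M \<le> card I - (kC - 1) + 1"
    using fin by (simp add: M_def card_insert_if)
  then have cM: "card M \<le> kA" using k_sum kB kC kC_ge_2 by linarith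
  have "(\<Sum>i\<in>M. f i *\<^sub>R a i) = (\<Sum>i\<in>I. f i *\<^sub>R a i)"
  proof (rule sum.mono_neutral_left[OF fin MI], rule ballI)
    fix i assume i: "i \<in> I - M"
    then have "\<pi>C (\<sigma> i) \<in> insert r Q" "\<pi>C (\<sigma> i) \<noteq> r" using rQ by (auto simp: M_def)
    then have "inner (c (\<pi>C (\<sigma> i))) x = 0" using x(1) by simp
    then show "f i *\<^sub>R a i = 0" using i by (auto simp: f_def M_def \<mu>_def)
  qed
  then have "\<bar>f r\<bar> \<le> L * norm (\<Sum>i\<in>I. f i *\<^sub>R a i)"
    using well_conditionedD[OF wcA MI cM, of r f] by (simp add: M_def)
  also have "\<dots> \<le> L * (L ^ 33 * e)" using fsum L_pos by (intro mult_left_mono) auto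
  also have "\<dots> = L ^ 34 * e" by (simp add: eval_nat_numeral)
  finally have fr: "\<bar>1 - \<mu> s\<bar> \<le> L ^ 34 * e" using s by (simp add: f_def r_def \<sigma>\<pi>)
  \<comment> \<open>As the coefficient at \<open>a r\<close> is near 1, neither \<open>x\<close> nor
    \<open>y\<close> kills the columns matched with \<open>s\<close>, and this decides both
    permutations.\<close>
  have nz: "\<mu> s \<noteq> 0" using fr pow_e_le_1[of 34] by auto
  have C': "\<pi>C s = r"
  proof (rule ccontr)
    assume n: "\<pi>C s \<noteq> r"
    then have "\<pi>C s \<in> insert r Q" using Q by (simp add: q_def)
    then have "inner (c (\<pi>C s)) x = 0" using x(1) n by simp
    then show False using nz by (simp add: \<mu>_def)
  qed
  have B': "\<pi>B s = r"
  proof (rule ccontr)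
    assume n: "\<pi>B s \<noteq> r"
    then have "\<pi>B s \<in> insert r Q'" using Q' by (simp add: q'_def)
    then have "inner (b (\<pi>B s)) y = 0" using y(1) n by simp
    then show False using nz by (simp add: \<mu>_def)
  qed
  show "\<pi>B s = \<pi>A s" "\<pi>C s = \<pi>A s" using B' C' by (simp_all add: r_def)
  have "\<mu> s = \<alpha> s * \<beta> s * \<gamma> s" using B' C' x(1)[of r] y(1)[of r] by (simp add: \<mu>_def)
  then show "\<bar>\<alpha> s * \<beta> s * \<gamma> s - 1\<bar> \<le> L ^ 34 * e" using fr by (simp add: abs_minus_commute)
qed

lemma robust_uniqueness:
  "\<exists>\<pi> \<alpha> \<beta> \<gamma>. bij_betw \<pi> I I \<and> (\<forall>s\<in>I. norm (a' s - \<alpha> s *\<^sub>R a (\<pi> s)) \<le> L ^ 27 * e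
     \<and> norm (b' s - \<beta> s *\<^sub>R b (\<pi> s)) \<le> L ^ 27 * e
     \<and> norm (c' s - \<gamma> s *\<^sub>R c (\<pi> s)) \<le> L ^ 27 * e
     \<and> \<bar>\<alpha> s * \<beta> s * \<gamma> s - 1\<bar> \<le> L ^ 34 * e)"
proof -
  interpret r1: cp_approx_bounded I kB kC kA L e b b' c c' a a' by (rule rotate_bounded)
  interpret r2: cp_approx_bounded I kC kA kB L e c c' a a' b b' by (rule r1.rotate_bounded)
  obtain \<pi>A \<alpha> where A: "bij_betw \<pi>A I I" "\<And>s. s \<in> I \<Longrightarrow> norm (a' s - \<alpha> s *\<^sub>R a (\<pi>A s)) \<le> L ^ 27 * e"
    using r1.near_permutation by blast
  obtain \<pi>B \<beta> where B: "bij_betw \<pi>B I I" "\<And>s. s \<in> I \<Longrightarrow> norm (b' s - \<beta> s *\<^sub>R b (\<pi>B s)) \<le> L ^ 27 * e"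
    using r2.near_permutation by blast
  obtain \<pi>C \<gamma> where C: "bij_betw \<pi>C I I" "\<And>s. s \<in> I \<Longrightarrow> norm (c' s - \<gamma> s *\<^sub>R c (\<pi>C s)) \<le> L ^ 27 * e"
    using near_permutation by blast
  note agree = permutations_agree[OF A(1) B(1) C(1) A(2) B(2) C(2)]
  show ?thesis
    using A(1) A(2) B(2) C(2) agree by (intro exI[of _ \<pi>A] exI[of _ \<alpha>] exI[of _ \<beta>] exI[of _ \<gamma>]) auto
qed

end

section \<open>Finite sequences as an inner product space\<close>

text \<open>The space is incomplete, but \<open>real_inner\<close> suffices because the argument
  projects only onto spans of finite sets.\<close>

instantiation poly_mapping :: (type, real_inner) real_inner
begin

lift_definition scaleR_poly_mapping :: "real \<Rightarrow> ('a \<Rightarrow>\<^sub>0 'b) \<Rightarrow> 'a \<Rightarrow>\<^sub>0 'b"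
  is "\<lambda>t f k. t *\<^sub>R f k"
  by (erule rev_finite_subset) auto

definition inner_poly_mapping :: "('a \<Rightarrow>\<^sub>0 'b) \<Rightarrow> ('a \<Rightarrow>\<^sub>0 'b) \<Rightarrow> real" where
  "inner_poly_mapping f g = (\<Sum>k\<in>Poly_Mapping.keys f. inner (Poly_Mapping.lookup f k) (Poly_Mapping.lookup g k))"

definition norm_poly_mapping :: "('a \<Rightarrow>\<^sub>0 'b) \<Rightarrow> real" where
  "norm_poly_mapping f = sqrt (inner f f)"

definition dist_poly_mapping :: "('a \<Rightarrow>\<^sub>0 'b) \<Rightarrow> ('a \<Rightarrow>\<^sub>0 'b) \<Rightarrow> real" where
  "dist_poly_mapping f g = norm (f - g)"

definition sgn_poly_mapping :: "('a \<Rightarrow>\<^sub>0 'b) \<Rightarrow> ('a \<Rightarrow>\<^sub>0 'b)" where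
  "sgn_poly_mapping f = inverse (norm f) *\<^sub>R f"

definition uniformity_poly_mapping :: "(('a \<Rightarrow>\<^sub>0 'b) \<times> ('a \<Rightarrow>\<^sub>0 'b)) filter" where
  "uniformity_poly_mapping = (INF d\<in>{0<..}. principal {(f, g). dist f g < d})"

definition open_poly_mapping :: "('a \<Rightarrow>\<^sub>0 'b) set \<Rightarrow> bool" where
  "open_poly_mapping U \<longleftrightarrow> (\<forall>f\<in>U. eventually (\<lambda>(f', g). f' = f \<longrightarrow> g \<in> U) uniformity)"

instance
proof
  have inner: "inner f g = (\<Sum>k\<in>K. inner (Poly_Mapping.lookup f k) (Poly_Mapping.lookup g k))"
    if "finite K" "Poly_Mapping.keys f \<subseteq> K" for f g :: "'a \<Rightarrow>\<^sub>0 'b" and K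
    unfolding inner_poly_mapping_def
    using that by (intro sum.mono_neutral_left) (auto simp: in_keys_iff)
  fix f g h :: "'a \<Rightarrow>\<^sub>0 'b" and s t :: real
  show "dist f g = norm (f - g)" by (rule dist_poly_mapping_def)
  show "sgn f = inverse (norm f) *\<^sub>R f" by (rule sgn_poly_mapping_def)
  show "uniformity = (INF d\<in>{0<..}. principal {(f, g :: 'a \<Rightarrow>\<^sub>0 'b). dist f g < d})"
    by (rule uniformity_poly_mapping_def)
  show "open U \<longleftrightarrow> (\<forall>f\<in>U. eventually (\<lambda>(f', g). f' = f \<longrightarrow> g \<in> U) uniformity)"
    for U :: "('a \<Rightarrow>\<^sub>0 'b) set" by (rule open_poly_mapping_def)
  show "norm f = sqrt (inner f f)" by (rule norm_poly_mapping_def)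
  show "t *\<^sub>R (f + g) = t *\<^sub>R f + t *\<^sub>R g" by transfer (simp add: scaleR_add_right)
  show "(s + t) *\<^sub>R f = s *\<^sub>R f + t *\<^sub>R f" by transfer (simp add: scaleR_add_left)
  show "s *\<^sub>R t *\<^sub>R f = (s * t) *\<^sub>R f" by transfer simp
  show "1 *\<^sub>R f = f" by transfer simp
  let ?K = "Poly_Mapping.keys f \<union> Poly_Mapping.keys g \<union> Poly_Mapping.keys h"
  have K: "finite ?K" by simp
  show "inner f g = inner g f"
    by (subst (1 2) inner[OF K]) (auto simp: inner_commute)
  have "Poly_Mapping.keys (f + g) \<subseteq> ?K" using keys_add[of f g] by blast
  then show "inner (f + g) h = inner f h + inner g h"
    by (subst (1 2 3) inner[OF K]) (auto simp: lookup_add inner_add_left sum.distrib)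
  have "Poly_Mapping.keys (t *\<^sub>R f) \<subseteq> Poly_Mapping.keys f" by transfer auto
  then show "inner (t *\<^sub>R f) g = t * inner f g"
    by (subst (1 2) inner[of "Poly_Mapping.keys f"]) (auto simp: scaleR_poly_mapping.rep_eq sum_distrib_left)
  show "0 \<le> inner f f" unfolding inner_poly_mapping_def by (intro sum_nonneg) simp
  show "inner f f = 0 \<longleftrightarrow> f = 0"
  proof
    assume "inner f f = 0"
    then have "\<forall>k\<in>Poly_Mapping.keys f. inner (Poly_Mapping.lookup f k) (Poly_Mapping.lookup f k) = 0"
      unfolding inner_poly_mapping_def by (subst (asm) sum_nonneg_eq_0_iff) auto
    then show "f = 0" by (intro poly_mapping_eqI) (auto simp: in_keys_iff)
  qed (simp add: inner_poly_mapping_def)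
qed

end

definition fin_seq :: "nat \<Rightarrow> (nat \<Rightarrow> real) \<Rightarrow> nat \<Rightarrow>\<^sub>0 real" where
  "fin_seq n f = (\<Sum>i<n. Poly_Mapping.single i (f i))"

lemma lookup_fin_seq: "Poly_Mapping.lookup (fin_seq n f) i = (if i < n then f i else 0)"
  unfolding fin_seq_def by (simp add: lookup_sum lookup_single when_def)

lemma lookup_scaleR: "Poly_Mapping.lookup (t *\<^sub>R f) i = t *\<^sub>R Poly_Mapping.lookup f i"
  by (simp add: scaleR_poly_mapping.rep_eq)

lemma inner_fin_seq: "inner (fin_seq n f) x = (\<Sum>i<n. f i * Poly_Mapping.lookup x i)"
proof -
  have "inner (fin_seq n f) x = (\<Sum>i\<in>Poly_Mapping.keys (fin_seq n f). f i * Poly_Mapping.lookup x i)"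
    unfolding inner_poly_mapping_def by (intro sum.cong) (auto simp: in_keys_iff lookup_fin_seq split: if_splits)
  also have "\<dots> = (\<Sum>i<n. f i * Poly_Mapping.lookup x i)"
    by (intro sum.mono_neutral_left) (auto simp: in_keys_iff lookup_fin_seq split: if_splits)
  finally show ?thesis .
qed

lemma norm_fin_seq: "norm (fin_seq n f) = sqrt (\<Sum>i<n. (f i)\<^sup>2)"
  unfolding norm_eq_sqrt_inner inner_fin_seq
  by (intro arg_cong[of _ _ sqrt] sum.cong) (auto simp: lookup_fin_seq power2_eq_square)

lemma fin_seq_diff: "fin_seq n f - fin_seq n g = fin_seq n (\<lambda>i. f i - g i)"
  by (intro poly_mapping_eqI) (auto simp: lookup_minus lookup_fin_seq)

lemma fin_seq_scaleR: "t *\<^sub>R fin_seq n f = fin_seq n (\<lambda>i. t * f i)"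
  by (intro poly_mapping_eqI) (auto simp: lookup_scaleR lookup_fin_seq)

lemma fin_seq_sum: "(\<Sum>r\<in>S. fin_seq n (f r)) = fin_seq n (\<lambda>i. \<Sum>r\<in>S. f r i)"
  by (intro poly_mapping_eqI) (auto simp: lookup_sum lookup_fin_seq)

lemma sum_lookup_le_norm: "(\<Sum>i<n. (Poly_Mapping.lookup x i)\<^sup>2) \<le> (norm (x :: nat \<Rightarrow>\<^sub>0 real))\<^sup>2"
proof -
  have "(norm x)\<^sup>2 = (\<Sum>i\<in>Poly_Mapping.keys x. (Poly_Mapping.lookup x i)\<^sup>2)"
    unfolding power2_norm_eq_inner inner_poly_mapping_def by (simp add: power2_eq_square)
  moreover have "(\<Sum>i\<in>Poly_Mapping.keys x. (Poly_Mapping.lookup x i)\<^sup>2) = (\<Sum>i\<in>Poly_Mapping.keys x \<union> {..<n}. (Poly_Mapping.lookup x i)\<^sup>2)"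
    by (intro sum.mono_neutral_left) (auto simp: in_keys_iff)
  moreover have "(\<Sum>i<n. (Poly_Mapping.lookup x i)\<^sup>2) \<le> (\<Sum>i\<in>Poly_Mapping.keys x \<union> {..<n}. (Poly_Mapping.lookup x i)\<^sup>2)"
    by (intro sum_mono2) auto
  ultimately show ?thesis by simp
qed

text \<open>Cauchy-Schwarz over index triples against the rank one tensor of \<open>x\<close>,
  \<open>y\<close>, \<open>z\<close>, whose norm factors.\<close>

lemma trilinear_form_le:
  fixes D :: "nat \<Rightarrow> nat \<Rightarrow> nat \<Rightarrow> real" and x y z :: "nat \<Rightarrow>\<^sub>0 real"
  shows "\<bar>\<Sum>i<m. \<Sum>j<n. \<Sum>k<p. D i j k * Poly_Mapping.lookup x i * Poly_Mapping.lookup y j * Poly_Mapping.lookup z k\<bar>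
     \<le> sqrt (\<Sum>i<m. \<Sum>j<n. \<Sum>k<p. (D i j k)\<^sup>2) * norm x * norm y * norm z"
proof -
  let ?T = "{..<m} \<times> {..<n} \<times> {..<p}"
  define g where "g t = (case t of (i, j, k) \<Rightarrow> Poly_Mapping.lookup x i * Poly_Mapping.lookup y j * Poly_Mapping.lookup z k)" for t
  have triple: "(\<Sum>i<m. \<Sum>j<n. \<Sum>k<p. h i j k) = (\<Sum>(i, j, k)\<in>?T. h i j k)" for h :: "_ \<Rightarrow> _ \<Rightarrow> _ \<Rightarrow> real"
    by (simp add: sum.cartesian_product)
  have "\<bar>\<Sum>i<m. \<Sum>j<n. \<Sum>k<p. D i j k * Poly_Mapping.lookup x i * Poly_Mapping.lookup y j * Poly_Mapping.lookup z k\<bar>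
      = \<bar>\<Sum>t\<in>?T. (case t of (i, j, k) \<Rightarrow> D i j k) * g t\<bar>"
    unfolding triple g_def by (simp add: case_prod_unfold mult.assoc)
  also have "\<dots> \<le> (\<Sum>t\<in>?T. \<bar>case t of (i, j, k) \<Rightarrow> D i j k\<bar> * \<bar>g t\<bar>)"
    by (rule order_trans[OF sum_abs]) (simp add: abs_mult)
  also have "\<dots> \<le> L2_set (\<lambda>t. case t of (i, j, k) \<Rightarrow> D i j k) ?T * L2_set g ?T"
    by (rule L2_set_mult_ineq)
  also have "L2_set (\<lambda>t. case t of (i, j, k) \<Rightarrow> D i j k) ?T = sqrt (\<Sum>i<m. \<Sum>j<n. \<Sum>k<p. (D i j k)\<^sup>2)"
    unfolding triple L2_set_def by (simp add: case_prod_unfold)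
  also have "L2_set g ?T = sqrt ((\<Sum>i<m. (Poly_Mapping.lookup x i)\<^sup>2) * ((\<Sum>j<n. (Poly_Mapping.lookup y j)\<^sup>2) * (\<Sum>k<p. (Poly_Mapping.lookup z k)\<^sup>2)))"
  proof -
    have "(\<Sum>t\<in>?T. (g t)\<^sup>2) = (\<Sum>i<m. \<Sum>j<n. \<Sum>k<p. (Poly_Mapping.lookup x i)\<^sup>2 * ((Poly_Mapping.lookup y j)\<^sup>2 * (Poly_Mapping.lookup z k)\<^sup>2))"
      unfolding triple g_def by (simp add: case_prod_unfold power_mult_distrib mult.assoc)
    also have "\<dots> = (\<Sum>i<m. (Poly_Mapping.lookup x i)\<^sup>2) * ((\<Sum>j<n. (Poly_Mapping.lookup y j)\<^sup>2) * (\<Sum>k<p. (Poly_Mapping.lookup z k)\<^sup>2))"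
      by (simp only: sum_distrib_left[symmetric] sum_distrib_right[symmetric])
    finally show ?thesis by (simp only: L2_set_def)
  qed
  also have "\<dots> \<le> sqrt ((norm x)\<^sup>2 * ((norm y)\<^sup>2 * (norm z)\<^sup>2))"
    by (intro real_sqrt_le_mono mult_mono sum_lookup_le_norm mult_nonneg_nonneg sum_nonneg zero_le_power2)
  also have "\<dots> = norm x * (norm y * norm z)" by (simp add: real_sqrt_mult)
  finally show ?thesis by (simp add: mult_left_mono sum_nonneg mult.assoc)
qed

section \<open>Singular values\<close>

lemma symmetric_eigenvalue_real:
  assumes A: "A \<in> carrier_mat n n" and sym: "\<And>i j. i < n \<Longrightarrow> j < n \<Longrightarrow> A $$ (i, j) = A $$ (j, i)"
    and ev: "eigenvalue (map_mat complex_of_real A) l"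
  shows "l \<in> \<real>"
proof -
  obtain v where v: "v \<in> carrier_vec n" "v \<noteq> 0\<^sub>v n" "map_mat complex_of_real A *\<^sub>v v = l \<cdot>\<^sub>v v"
    using ev A unfolding eigenvalue_def eigenvector_def by auto
  have Av: "(\<Sum>j<n. of_real (A $$ (i, j)) * v $ j) = l * v $ i" if "i < n" for i
    using arg_cong[OF v(3), of "\<lambda>w. w $ i"] that v(1) A
    by (simp add: scalar_prod_def atLeast0LessThan)
  define s where "s = (\<Sum>i<n. \<Sum>j<n. cnj (v $ i) * of_real (A $$ (i, j)) * v $ j)"
  define N where "N = (\<Sum>i<n. (cmod (v $ i))\<^sup>2)"
  have "s = (\<Sum>i<n. cnj (v $ i) * (l * v $ i))"
    unfolding s_def by (intro sum.cong refl) (simp add: Av[symmetric] sum_distrib_left mult.assoc)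
  also have "\<dots> = l * of_real N"
    by (simp add: N_def sum_distrib_left complex_norm_square mult_ac del: of_real_power)
  finally have s: "s = l * of_real N" .
  have "cnj s = (\<Sum>i<n. \<Sum>j<n. v $ i * of_real (A $$ (i, j)) * cnj (v $ j))"
    by (simp add: s_def)
  also have "\<dots> = (\<Sum>j<n. \<Sum>i<n. v $ i * of_real (A $$ (i, j)) * cnj (v $ j))" by (rule sum.swap)
  also have "\<dots> = s"
    unfolding s_def using sym by (intro sum.cong refl) (simp add: mult_ac)
  finally have "cnj l * of_real N = l * of_real N" by (simp add: s)
  moreover have "N \<noteq> 0"
  proof
    assume "N = 0"
    then have "\<forall>i\<in>{..<n}. (cmod (v $ i))\<^sup>2 = 0"
      unfolding N_def by (subst (asm) sum_nonneg_eq_0_iff) auto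
    then have "v = 0\<^sub>v n" using v(1) by (intro eq_vecI) auto
    with v(2) show False by simp
  qed
  ultimately show ?thesis by (simp add: Reals_cnj_iff)
qed

text \<open>\<open>proots\<close> counts only real roots. For a Gram matrix none is missed, so
  \<open>singular_values\<close> has one entry per column and \<open>sing_val k\<close> reads an
  existing entry.\<close>

lemma size_proots_char_poly_symmetric:
  fixes A :: "real mat"
  assumes A: "A \<in> carrier_mat n n" and sym: "\<And>i j. i < n \<Longrightarrow> j < n \<Longrightarrow> A $$ (i, j) = A $$ (j, i)"
  shows "size (proots (char_poly A)) = n"
proof -
  let ?C = "map_mat complex_of_real A"
  have C: "?C \<in> carrier_mat n n" using A by simp
  obtain as where as: "char_poly ?C = (\<Prod>a\<leftarrow>as. [:- a, 1:])" "length as = n"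
    using char_poly_factorized[OF C] by blast
  have re: "of_real (Re a) = a" if "a \<in> set as" for a
  proof -
    have "poly (char_poly ?C) a = 0"
      unfolding as(1) poly_prod_list using that by (auto simp: prod_list_zero_iff)
    then have "eigenvalue ?C a" using eigenvalue_root_char_poly[OF C] by simp
    then show ?thesis using symmetric_eigenvalue_real[OF A sym] by (simp add: of_real_Re)
  qed
  interpret h: map_poly_inj_idom_hom complex_of_real ..
  have "map_poly complex_of_real (char_poly A) = (\<Prod>a\<leftarrow>as. [:- a, 1:])"
    using of_real_hom.char_poly_hom[OF A, where 'a = complex] as(1) by simp
  also have "\<dots> = (\<Prod>a\<leftarrow>as. map_poly complex_of_real [:- Re a, 1:])"
    by (intro arg_cong[of _ _ prod_list] map_cong refl) (simp add: re)
  also have "\<dots> = map_poly complex_of_real (\<Prod>a\<leftarrow>as. [:- Re a, 1:])"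
    by (simp add: h.hom_prod_list o_def)
  finally have eq: "char_poly A = (\<Prod>a\<leftarrow>as. [:- Re a, 1:])" by simp
  have "proots (char_poly A) = (\<Sum>a\<leftarrow>as. {#Re a#})"
    unfolding eq using proots_prod_list[of "map (\<lambda>a. [:- Re a, 1:]) as"]
    by (auto simp: o_def image_iff eq_commute[of 0])
  moreover have "size (\<Sum>a\<leftarrow>as. {#Re a#}) = length as" by (induction as) auto
  ultimately show ?thesis using as(2) by simp
qed

lemma compact_unit_vectors:
  "compact {v :: nat \<Rightarrow> real. (\<forall>i\<ge>n. v i = 0) \<and> (\<Sum>i<n. (v i)\<^sup>2) = 1}" (is "compact ?S")
proof -
  \<comment> \<open>Sequences vanishing from \<open>n\<close> on stand for n-dimensional space; the
    unit sphere is a closed part of a product of compact sets.\<close>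
  define K where "K i = (if i < n then {-1..1} else {0 :: real})" for i :: nat
  have "compactin (product_topology (\<lambda>i. euclidean) UNIV) (PiE UNIV K)"
    unfolding compactin_PiE by (auto simp: K_def)
  then have comp: "compact (PiE UNIV K)" by (simp add: euclidean_product_topology)
  have "closed ((\<lambda>v :: nat \<Rightarrow> real. \<Sum>i<n. (v i)\<^sup>2) -` {1})"
    by (intro closed_vimage closed_singleton continuous_intros continuous_on_product_coordinates)
  then have "compact (PiE UNIV K \<inter> (\<lambda>v :: nat \<Rightarrow> real. \<Sum>i<n. (v i)\<^sup>2) -` {1})"
    by (rule compact_Int_closed[OF comp])
  also have "PiE UNIV K \<inter> (\<lambda>v :: nat \<Rightarrow> real. \<Sum>i<n. (v i)\<^sup>2) -` {1} = ?S"
  proof (rule Set.equalityI; rule Set.subsetI)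
    fix v assume v: "v \<in> ?S"
    have "\<bar>v i\<bar> \<le> 1" if "i < n" for i
    proof -
      have "(v i)\<^sup>2 \<le> (\<Sum>i<n. (v i)\<^sup>2)" using that by (intro member_le_sum) auto
      then show ?thesis using v by (simp add: abs_square_le_1)
    qed
    then show "v \<in> PiE UNIV K \<inter> (\<lambda>v :: nat \<Rightarrow> real. \<Sum>i<n. (v i)\<^sup>2) -` {1}"
      using v by (auto simp: K_def PiE_iff abs_le_iff minus_le_iff)
  next
    fix v assume v: "v \<in> PiE UNIV K \<inter> (\<lambda>v :: nat \<Rightarrow> real. \<Sum>i<n. (v i)\<^sup>2) -` {1}"
    then have "v i \<in> K i" for i by (auto simp: PiE_iff)
    then have "v i = 0" if "i \<ge> n" for i using that by (metis K_def leD singletonD)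
    with v show "v \<in> ?S" by simp
  qed
  finally show ?thesis .
qed

text \<open>By compactness the quadratic form has a minimum on the unit sphere, and by first
  variation a minimiser is an eigenvector; the minimum is therefore an eigenvalue.\<close>

lemma rayleigh_lower_bound:
  fixes A :: "real mat"
  assumes A: "A \<in> carrier_mat n n" and sym: "\<And>i j. i < n \<Longrightarrow> j < n \<Longrightarrow> A $$ (i, j) = A $$ (j, i)"
    and ev: "\<And>l. eigenvalue A l \<Longrightarrow> c \<le> l"
  shows "c * (\<Sum>i<n. (v i)\<^sup>2) \<le> (\<Sum>i<n. \<Sum>j<n. v i * A $$ (i, j) * v j)"
proof -
  define q where "q v = (\<Sum>i<n. \<Sum>j<n. v i * A $$ (i, j) * v j)" for v :: "nat \<Rightarrow> real"
  define N where "N v = (\<Sum>i<n. (v i)\<^sup>2)" for v :: "nat \<Rightarrow> real"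
  let ?S = "{v :: nat \<Rightarrow> real. (\<forall>i\<ge>n. v i = 0) \<and> (\<Sum>i<n. (v i)\<^sup>2) = 1}"
  have N0: "0 \<le> N v" for v unfolding N_def by (intro sum_nonneg) simp
  show ?thesis
  proof (cases "N v = 0")
    case True
    then have "\<forall>i\<in>{..<n}. (v i)\<^sup>2 = 0" unfolding N_def by (subst (asm) sum_nonneg_eq_0_iff) auto
    then show ?thesis by simp
  next
    case False
    have scale: "(\<lambda>i. if i < n then w i / sqrt (N w) else 0) \<in> ?S"
      "q (\<lambda>i. if i < n then w i / sqrt (N w) else 0) = q w / N w" if "N w \<noteq> 0" for w
    proof -
      have Nw: "0 < N w" using that N0[of w] by simp
      then have "(\<Sum>i<n. (w i / sqrt (N w))\<^sup>2) = 1"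
        by (simp add: power_divide sum_divide_distrib[symmetric] N_def[symmetric])
      then show "(\<lambda>i. if i < n then w i / sqrt (N w) else 0) \<in> ?S" by simp
      have "q (\<lambda>i. if i < n then w i / sqrt (N w) else 0)
          = (\<Sum>i<n. \<Sum>j<n. w i * A $$ (i, j) * w j / (sqrt (N w) * sqrt (N w)))"
        unfolding q_def by (intro sum.cong refl) simp
      then show "q (\<lambda>i. if i < n then w i / sqrt (N w) else 0) = q w / N w"
        using Nw by (simp add: q_def sum_divide_distrib)
    qed
    have S0: "?S \<noteq> {}" using scale(1)[OF False] by (rule ex_in_conv[THEN iffD1, OF exI])
    have "continuous_on ?S q"
      unfolding q_def
      by (intro continuous_intros continuous_on_subset[OF continuous_on_product_coordinates]) auto
    then have "\<exists>u\<in>?S. \<forall>w\<in>?S. q u \<le> q w"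
      by (rule continuous_attains_inf[OF compact_unit_vectors S0])
    then obtain u where u: "u \<in> ?S" "\<forall>w\<in>?S. q u \<le> q w" by (rule bexE)
    define m where "m = q u"
    have Nu: "N u = 1" using u(1) by (simp add: N_def)
    have min: "m * N w \<le> q w" for w
    proof (cases "N w = 0")
      case True
      then have "\<forall>i\<in>{..<n}. (w i)\<^sup>2 = 0" unfolding N_def by (subst (asm) sum_nonneg_eq_0_iff) auto
      then show ?thesis using True by (simp add: q_def)
    next
      case nz: False
      have "m \<le> q w / N w" using bspec[OF u(2) scale(1)[OF nz]] unfolding scale(2)[OF nz] m_def .
      then show ?thesis using nz N0[of w] by (simp add: field_simps)
    qed
    \<comment> \<open>The residual of the eigenvalue equation serves as direction of variation:
      along it, the form minus \<open>m\<close> times the squared norm is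
      \<open>2 * t * N z + t\<^sup>2 * M\<close>.\<close>
    define z where "z i = (\<Sum>j<n. A $$ (i, j) * u j) - m * u i" for i
    have z0: "N z = 0"
    proof (rule ccontr)
      assume "N z \<noteq> 0"
      then have Nz: "0 < N z" using N0[of z] by simp
      define M where "M = q z - m * N z"
      have M0: "0 \<le> M" using min[of z] by (simp add: M_def)
      \<comment> \<open>Negative and so small that the linear term dominates; the \<open>+ 1\<close>
        covers \<open>M = 0\<close>.\<close>
      define t where "t = - N z / (M + 1)"
      have "q (\<lambda>i. u i + t * z i) = q u + 2 * t * (\<Sum>i<n. \<Sum>j<n. z i * A $$ (i, j) * u j) + t\<^sup>2 * q z"
      proof -
        have "(\<Sum>i<n. \<Sum>j<n. u i * A $$ (i, j) * z j) = (\<Sum>j<n. \<Sum>i<n. u i * A $$ (i, j) * z j)"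
          by (rule sum.swap)
        also have "\<dots> = (\<Sum>i<n. \<Sum>j<n. z i * A $$ (i, j) * u j)"
          using sym by (intro sum.cong refl) (simp add: mult_ac)
        finally have sw: "(\<Sum>i<n. \<Sum>j<n. u i * A $$ (i, j) * z j) = (\<Sum>i<n. \<Sum>j<n. z i * A $$ (i, j) * u j)" .
        have "q (\<lambda>i. u i + t * z i) = (\<Sum>i<n. \<Sum>j<n. u i * A $$ (i, j) * u j
            + (t * (u i * A $$ (i, j) * z j) + t * (z i * A $$ (i, j) * u j)) + t\<^sup>2 * (z i * A $$ (i, j) * z j))"
          unfolding q_def by (intro sum.cong refl) (simp add: algebra_simps power2_eq_square)
        also have "\<dots> = q u + (t * (\<Sum>i<n. \<Sum>j<n. u i * A $$ (i, j) * z j)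
            + t * (\<Sum>i<n. \<Sum>j<n. z i * A $$ (i, j) * u j)) + t\<^sup>2 * q z"
          by (simp add: sum.distrib q_def sum_distrib_left)
        finally show ?thesis unfolding sw by simp
      qed
      moreover have "N (\<lambda>i. u i + t * z i) = N u + 2 * t * (\<Sum>i<n. z i * u i) + t\<^sup>2 * N z"
        by (simp add: N_def power2_sum sum.distrib sum_distrib_left power_mult_distrib mult_ac)
      moreover have "(\<Sum>i<n. \<Sum>j<n. z i * A $$ (i, j) * u j) - m * (\<Sum>i<n. z i * u i) = N z"
      proof -
        have "N z = (\<Sum>i<n. z i * z i)" by (simp add: N_def power2_eq_square)
        also have "\<dots> = (\<Sum>i<n. z i * ((\<Sum>j<n. A $$ (i, j) * u j) - m * u i))" by (simp only: z_def)
        also have "\<dots> = (\<Sum>i<n. \<Sum>j<n. z i * A $$ (i, j) * u j) - m * (\<Sum>i<n. z i * u i)"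
          by (simp add: right_diff_distrib sum_subtractf sum_distrib_left mult_ac)
        finally show ?thesis by simp
      qed
      ultimately have "q (\<lambda>i. u i + t * z i) - m * N (\<lambda>i. u i + t * z i)
          = (q u - m * N u) + 2 * t * N z + t\<^sup>2 * M"
        by (simp add: M_def algebra_simps)
      also have "\<dots> = 2 * t * N z + t\<^sup>2 * M" using Nu by (simp add: m_def)
      finally have ge: "0 \<le> t * (2 * N z + t * M)"
        using min[of "\<lambda>i. u i + t * z i"] by (simp add: power2_eq_square algebra_simps)
      have "t < 0" using Nz M0 by (simp add: t_def divide_neg_pos)
      moreover have "0 < 2 * N z + t * M"
      proof -
        have "N z * (M / (M + 1)) \<le> N z * 1" using M0 Nz by (intro mult_left_mono) auto
        then show ?thesis using Nz by (simp add: t_def)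
      qed
      ultimately have "t * (2 * N z + t * M) < 0" by (rule mult_neg_pos)
      with ge show False by simp
    qed
    have zi: "(\<Sum>j<n. A $$ (i, j) * u j) = m * u i" if "i < n" for i
    proof -
      have "\<forall>i\<in>{..<n}. (z i)\<^sup>2 = 0" using z0 unfolding N_def by (subst (asm) sum_nonneg_eq_0_iff) auto
      then show ?thesis using that by (simp add: z_def)
    qed
    have "eigenvector A (vec n u) m"
      unfolding eigenvector_def
    proof (intro conjI)
      show "vec n u \<noteq> 0\<^sub>v (dim_row A)"
      proof
        assume "vec n u = 0\<^sub>v (dim_row A)"
        then have "u i = 0" if "i < n" for i
          using that A by (metis carrier_matD(1) index_vec index_zero_vec(1))
        then show False using Nu by (simp add: N_def)
      qed
      show "A *\<^sub>v vec n u = m \<cdot>\<^sub>v vec n u"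
        using A zi by (intro eq_vecI) (auto simp: scalar_prod_def atLeast0LessThan)
    qed (use A in auto)
    then have "c \<le> m" using ev unfolding eigenvalue_def by blast
    then have "c * N v \<le> m * N v" using N0[of v] by (rule mult_right_mono)
    also have "\<dots> \<le> q v" by (rule min)
    finally show ?thesis by (simp add: N_def q_def)
  qed
qed

lemma sing_val_lower_bound:
  assumes X: "X \<in> carrier_mat m k" and k: "1 \<le> k" and t: "0 < t" and sv: "t \<le> sing_val k X"
  shows "t\<^sup>2 * (\<Sum>j<k. (v j)\<^sup>2) \<le> (\<Sum>i<m. (\<Sum>j<k. X $$ (i, j) * v j)\<^sup>2)"
proof -
  let ?G = "transpose_mat X * X"
  have G: "?G \<in> carrier_mat k k" using X by simp
  have Gij: "?G $$ (i, j) = (\<Sum>l<m. X $$ (l, i) * X $$ (l, j))" if "i < k" "j < k" for i j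
    using that X by (simp add: scalar_prod_def atLeast0LessThan)
  have sym: "?G $$ (i, j) = ?G $$ (j, i)" if "i < k" "j < k" for i j
    unfolding Gij[OF that] Gij[OF that(2,1)] by (simp add: mult.commute)
  define xs where "xs = sorted_list_of_multiset (image_mset sqrt (proots (char_poly ?G)))"
  have mxs: "mset xs = image_mset sqrt (proots (char_poly ?G))" by (simp add: xs_def)
  then have "size (mset xs) = k"
    using size_proots_char_poly_symmetric[OF G sym] by simp
  then have len: "length xs = k" by simp
  \<comment> \<open>\<open>X\<close> has exactly \<open>k\<close> columns, so its
    \<open>k\<close>-th largest singular value is the smallest one, the head of the increasing
    list.\<close>
  have "sing_val k X = xs ! 0"
    unfolding sing_val_def singular_values_def xs_def[symmetric] using k len by (simp add: rev_nth)
  have low: "t\<^sup>2 \<le> l" if "eigenvalue ?G l" for l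
  proof -
    have "char_poly ?G \<noteq> 0" using degree_monic_char_poly[OF G] by auto
    then have "l \<in># proots (char_poly ?G)"
      using that eigenvalue_root_char_poly[OF G] by simp
    then have "sqrt l \<in># mset xs" unfolding mxs by simp
    then obtain i where i: "i < length xs" "xs ! i = sqrt l" by (auto simp: in_set_conv_nth)
    have "sorted xs" by (simp add: xs_def)
    then have "xs ! 0 \<le> sqrt l" using i by (metis le0 sorted_nth_mono)
    then have "t \<le> sqrt l" using sv \<open>sing_val k X = xs ! 0\<close> by simp
    then have "t\<^sup>2 \<le> (sqrt l)\<^sup>2" using t by (intro power_mono) auto
    \<comment> \<open>\<open>sqrt\<close> is negative on negative numbers, so this gives
      \<open>l > 0\<close> and \<open>(sqrt l)\<^sup>2 = l\<close>.\<close>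
    moreover have "0 < sqrt l" using \<open>t \<le> sqrt l\<close> t by linarith
    ultimately show ?thesis by simp
  qed
  have "t\<^sup>2 * (\<Sum>j<k. (v j)\<^sup>2) \<le> (\<Sum>i<k. \<Sum>j<k. v i * ?G $$ (i, j) * v j)"
    by (rule rayleigh_lower_bound[OF G sym low])
  also have "\<dots> = (\<Sum>i<k. \<Sum>j<k. \<Sum>l<m. (X $$ (l, i) * v i) * (X $$ (l, j) * v j))"
    by (intro sum.cong refl) (simp add: Gij sum_distrib_left sum_distrib_right mult_ac del: index_mult_mat)
  also have "\<dots> = (\<Sum>i<k. \<Sum>l<m. \<Sum>j<k. (X $$ (l, i) * v i) * (X $$ (l, j) * v j))"
    by (intro sum.cong refl sum.swap)
  also have "\<dots> = (\<Sum>l<m. \<Sum>i<k. \<Sum>j<k. (X $$ (l, i) * v i) * (X $$ (l, j) * v j))"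
    by (rule sum.swap)
  also have "\<dots> = (\<Sum>i<m. (\<Sum>j<k. X $$ (i, j) * v j)\<^sup>2)"
    by (simp add: power2_eq_square sum_product)
  finally show ?thesis .
qed

text \<open>\<open>submatrix\<close> numbers the selected columns by \<open>pick\<close>; this turns
  sums over positions into sums over \<open>S\<close>.\<close>

lemma bij_betw_pick:
  assumes "finite S"
  shows "bij_betw (pick S) {..<card S} S"
proof -
  have sub: "S \<subseteq> pick S ` {..<card S}"
  proof
    fix i assume i: "i \<in> S"
    have "card {a \<in> S. a < i} < card S" using i assms by (intro psubset_card_mono) auto
    then show "i \<in> pick S ` {..<card S}" 
      using pick_card_in_set[OF i] by (intro image_eqI[of _ _ "card {a \<in> S. a < i}"]) auto
  qed
  have "card (pick S ` {..<card S}) \<le> card S" using card_image_le[of "{..<card S}" "pick S"] by simp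
  then have eq: "S = pick S ` {..<card S}" using sub by (intro card_seteq) auto
  then have "inj_on (pick S) {..<card S}" by (intro eq_card_imp_inj_on) auto
  with eq show ?thesis by (simp add: bij_betw_def)
qed

lemma K_rank_cases:
  assumes "K_rank t X = k"
  shows "k \<le> dim_col X" "1 \<le> k \<Longrightarrow> S \<subseteq> {..<dim_col X} \<Longrightarrow> card S = k \<Longrightarrow>
     1 / t \<le> sing_val k (submatrix X UNIV S)"
proof -
  let ?P = "{k. k \<le> dim_col X \<and> (1 \<le> k \<longrightarrow> (\<forall>S. S \<subseteq> {..<dim_col X} \<and> card S = k \<longrightarrow>
        1 / t \<le> sing_val k (submatrix X UNIV S)))}"
  have "0 \<in> ?P" by simp
  then have "?P \<noteq> {}" by (rule ex_in_conv[THEN iffD1, OF exI])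
  moreover have "finite ?P" by simp
  ultimately have "Max ?P \<in> ?P" by (rule Max_in[rotated])
  then have "k \<in> ?P" using assms by (simp add: K_rank_def)
  then show "k \<le> dim_col X" "1 \<le> k \<Longrightarrow> S \<subseteq> {..<dim_col X} \<Longrightarrow> card S = k \<Longrightarrow>
     1 / t \<le> sing_val k (submatrix X UNIV S)" by blast+
qed

text \<open>\<open>K_rank\<close> speaks about exactly \<open>k\<close> columns, so a smaller set is
  enlarged and \<open>f\<close> is extended by zero.\<close>

lemma K_rank_lower_bound:
  assumes X: "X \<in> carrier_mat n R" and K: "K_rank t X = k" and t: "0 < t"
    and S: "S \<subseteq> {..<R}" "card S \<le> k"
  shows "(\<Sum>r\<in>S. (f r)\<^sup>2) \<le> t\<^sup>2 * (\<Sum>i<n. (\<Sum>r\<in>S. X $$ (i, r) * f r)\<^sup>2)"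
proof (cases "k = 0")
  case True
  then have "S = {}" using S finite_subset[OF S(1)] by auto
  then show ?thesis by simp
next
  case False
  have kR: "k \<le> R" using K_rank_cases(1)[OF K] X by simp
  obtain S' where S': "S \<subseteq> S'" "S' \<subseteq> {..<R}" "card S' = k"
    using exists_subset_between[OF S(2) _ S(1)] kR by auto
  have fS': "finite S'" using S' finite_subset by blast
  let ?Y = "submatrix X UNIV S'"
  have colS: "{j. j < R \<and> j \<in> S'} = S'" using S' by auto
  have Y: "?Y \<in> carrier_mat n k"
    using X S' by (intro carrier_matI) (simp_all add: dim_submatrix colS)
  have Yij: "?Y $$ (i, j) = X $$ (i, pick S' j)" if "i < n" "j < k" for i j
    using that X S' by (subst submatrix_index) (simp_all add: colS pick_UNIV)
  have bij: "bij_betw (pick S') {..<k} S'" using bij_betw_pick[OF fS'] S' by simp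
  define g where "g r = (if r \<in> S then f r else 0)" for r
  have "(1 / t)\<^sup>2 * (\<Sum>j<k. (g (pick S' j))\<^sup>2) \<le> (\<Sum>i<n. (\<Sum>j<k. ?Y $$ (i, j) * g (pick S' j))\<^sup>2)"
    using False t S' X K_rank_cases(2)[OF K] by (intro sing_val_lower_bound[OF Y]) auto
  also have "(\<Sum>i<n. (\<Sum>j<k. ?Y $$ (i, j) * g (pick S' j))\<^sup>2)
      = (\<Sum>i<n. (\<Sum>j<k. X $$ (i, pick S' j) * g (pick S' j))\<^sup>2)" by (simp add: Yij)
  also have "\<dots> = (\<Sum>i<n. (\<Sum>r\<in>S'. X $$ (i, r) * g r)\<^sup>2)"
    by (intro sum.cong refl arg_cong[of _ _ "\<lambda>x. x\<^sup>2"] sum.reindex_bij_betw[OF bij, of "\<lambda>r. X $$ (_, r) * g r"])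
  also have "\<dots> = (\<Sum>i<n. (\<Sum>r\<in>S. X $$ (i, r) * f r)\<^sup>2)"
    using S' fS' by (intro sum.cong refl arg_cong[of _ _ "\<lambda>x. x\<^sup>2"] sum.mono_neutral_cong_right) (auto simp: g_def)
  also have "(\<Sum>j<k. (g (pick S' j))\<^sup>2) = (\<Sum>r\<in>S'. (g r)\<^sup>2)"
    by (rule sum.reindex_bij_betw[OF bij, of "\<lambda>r. (g r)\<^sup>2"])
  also have "\<dots> = (\<Sum>r\<in>S. (f r)\<^sup>2)"
    using S' fS' by (intro sum.mono_neutral_cong_right) (auto simp: g_def)
  finally show ?thesis using t by (simp add: power_divide divide_le_eq mult.commute)
qed

section \<open>Matrices and tensors\<close>

text \<open>Columns of all lengths are embedded isometrically into one inner product space, since the abstract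
  result is about a type and the number of rows is not known to the type system.\<close>

definition col_seq :: "real mat \<Rightarrow> nat \<Rightarrow> nat \<Rightarrow>\<^sub>0 real" where
  "col_seq X r = fin_seq (dim_row X) (\<lambda>i. X $$ (i, r))"

lemma norm_combination_col_seq:
  "norm (\<Sum>r\<in>S. f r *\<^sub>R col_seq X r) = sqrt (\<Sum>i<dim_row X. (\<Sum>r\<in>S. X $$ (i, r) * f r)\<^sup>2)"
  by (simp add: col_seq_def fin_seq_scaleR fin_seq_sum norm_fin_seq mult.commute)

lemma well_conditioned_col_seq:
  assumes X: "X \<in> carrier_mat n R" and K: "K_rank t X = k" and t: "0 < t" "t \<le> L"
  shows "well_conditioned k L {..<R} (col_seq X)"
  unfolding well_conditioned_def
proof (intro allI impI ballI)
  fix S f r assume S: "S \<subseteq> {..<R} \<and> card S \<le> k" and r: "r \<in> S"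
  have fS: "finite S" using S finite_subset by blast
  let ?N = "norm (\<Sum>i\<in>S. f i *\<^sub>R col_seq X i)"
  have N: "?N\<^sup>2 = (\<Sum>i<n. (\<Sum>r\<in>S. X $$ (i, r) * f r)\<^sup>2)"
    unfolding norm_combination_col_seq using X by (simp add: sum_nonneg)
  have "\<bar>f r\<bar>\<^sup>2 \<le> (\<Sum>r\<in>S. (f r)\<^sup>2)" 
    using member_le_sum[of r S "\<lambda>r. (f r)\<^sup>2"] r fS by simp
  also have "\<dots> \<le> t\<^sup>2 * ?N\<^sup>2" unfolding N using K_rank_lower_bound[OF X K t(1)] S by blast
  also have "\<dots> = (t * ?N)\<^sup>2" by (simp add: power_mult_distrib)
  finally have "\<bar>f r\<bar> \<le> t * ?N" by (rule power2_le_imp_le) (use t in simp)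
  also have "\<dots> \<le> L * ?N" using t by (intro mult_right_mono) auto
  finally show "\<bar>f r\<bar> \<le> L * ?N" .
qed

text \<open>More than \<open>n\<close> columns would admit a kernel vector. This ties
  \<open>R\<close> to the numbers of rows, the only dimensions that the polynomial sees.\<close>

lemma K_rank_le_dim_row:
  assumes X: "X \<in> carrier_mat n R" and K: "K_rank t X = k" and t: "0 < t"
  shows "k \<le> n"
proof (rule ccontr)
  assume "\<not> k \<le> n"
  then obtain v where v: "\<forall>i\<in>{..<n}. (\<Sum>r\<in>{..<k}. X $$ (i, r) * v r) = 0" "\<exists>r\<in>{..<k}. v r \<noteq> 0"
    using nontrivial_kernel[of "{..<n}" "{..<k}" "\<lambda>i r. X $$ (i, r)"] by auto
  have "{..<k} \<subseteq> {..<R}" using K_rank_cases(1)[OF K] X by auto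
  then have "(\<Sum>r<k. (v r)\<^sup>2) \<le> t\<^sup>2 * (\<Sum>i<n. (\<Sum>r<k. X $$ (i, r) * v r)\<^sup>2)"
    by (intro K_rank_lower_bound[OF X K t]) auto
  also have "\<dots> = 0" using v(1) by simp
  finally have "(\<Sum>r<k. (v r)\<^sup>2) = 0" by (simp add: antisym sum_nonneg)
  then have "\<forall>r\<in>{..<k}. (v r)\<^sup>2 = 0" by (subst (asm) sum_nonneg_eq_0_iff) auto
  with v(2) show False by simp
qed

lemma norm_col_seq_le:
  assumes "X \<in> carrier_mat n R" "col_bounded \<rho> X" "r < R"
  shows "norm (col_seq X r) \<le> \<rho>"
  using assms
  by (auto simp: col_seq_def norm_fin_seq col_bounded_def scalar_prod_def atLeast0LessThan power2_eq_square)

lemma tensor_indices_3: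
  "tensor_indices [m, n, p] = (\<lambda>(i, j, k). [i, j, k]) ` ({..<m} \<times> {..<n} \<times> {..<p})"
  by (force simp: tensor_indices_def set_Cons_def)

lemma tensor_fnorm_3:
  "tensor_fnorm [m, n, p] T = sqrt (\<Sum>i<m. \<Sum>j<n. \<Sum>k<p. (T [i, j, k])\<^sup>2)"
proof -
  have "inj_on (\<lambda>(i, j, k). [i, j, k]) ({..<m} \<times> {..<n} \<times> {..<p})" by (auto simp: inj_on_def)
  then show ?thesis
    unfolding tensor_fnorm_def tensor_indices_3
    by (subst sum.reindex) (auto simp: sum.cartesian_product case_prod_unfold)
qed

lemma cp_tensor_3:
  assumes "A \<in> carrier_mat m R" "B \<in> carrier_mat n R" "C \<in> carrier_mat p R" "i < m" "j < n" "k < p"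
  shows "cp_tensor R [A, B, C] [i, j, k] = (\<Sum>r<R. A $$ (i, r) * B $$ (j, r) * C $$ (k, r))"
  unfolding cp_tensor_def outer_product_def using assms
  by (intro sum.cong refl) (simp add: numeral_3_eq_3 lessThan_Suc mult_ac)

lemma trilinear_col_seq:
  assumes ABC: "A \<in> carrier_mat m R" "B \<in> carrier_mat n R" "C \<in> carrier_mat p R"
  shows "(\<Sum>r<R. inner (col_seq A r) x * inner (col_seq B r) y * inner (col_seq C r) z)
    = (\<Sum>i<m. \<Sum>j<n. \<Sum>k<p. cp_tensor R [A, B, C] [i, j, k] *
        Poly_Mapping.lookup x i * Poly_Mapping.lookup y j * Poly_Mapping.lookup z k)"
proof -
  let ?f = "\<lambda>i j k r. A $$ (i, r) * B $$ (j, r) * C $$ (k, r) *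
        Poly_Mapping.lookup x i * Poly_Mapping.lookup y j * Poly_Mapping.lookup z k"
  have "(\<Sum>r<R. inner (col_seq A r) x * inner (col_seq B r) y * inner (col_seq C r) z)
      = (\<Sum>r<R. \<Sum>i<m. \<Sum>j<n. \<Sum>k<p. ?f i j k r)"
  proof (intro sum.cong refl)
    fix r
    have "inner (col_seq A r) x * inner (col_seq B r) y * inner (col_seq C r) z
        = (\<Sum>i<m. A $$ (i, r) * Poly_Mapping.lookup x i) * ((\<Sum>j<n. B $$ (j, r) * Poly_Mapping.lookup y j)
          * (\<Sum>k<p. C $$ (k, r) * Poly_Mapping.lookup z k))"
      using ABC by (simp add: col_seq_def inner_fin_seq)
    also have "\<dots> = (\<Sum>i<m. \<Sum>j<n. \<Sum>k<p. (A $$ (i, r) * Poly_Mapping.lookup x i) *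
        ((B $$ (j, r) * Poly_Mapping.lookup y j) * (C $$ (k, r) * Poly_Mapping.lookup z k)))"
      by (simp only: sum_distrib_left[symmetric] sum_distrib_right[symmetric])
    finally show "inner (col_seq A r) x * inner (col_seq B r) y * inner (col_seq C r) z
        = (\<Sum>i<m. \<Sum>j<n. \<Sum>k<p. ?f i j k r)" by (simp add: mult_ac)
  qed
  also have "\<dots> = (\<Sum>i<m. \<Sum>r<R. \<Sum>j<n. \<Sum>k<p. ?f i j k r)" by (rule sum.swap)
  also have "\<dots> = (\<Sum>i<m. \<Sum>j<n. \<Sum>r<R. \<Sum>k<p. ?f i j k r)" by (intro sum.cong refl sum.swap)
  also have "\<dots> = (\<Sum>i<m. \<Sum>j<n. \<Sum>k<p. \<Sum>r<R. ?f i j k r)" by (intro sum.cong refl sum.swap)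
  also have "\<dots> = (\<Sum>i<m. \<Sum>j<n. \<Sum>k<p. cp_tensor R [A, B, C] [i, j, k] *
        Poly_Mapping.lookup x i * Poly_Mapping.lookup y j * Poly_Mapping.lookup z k)"
    by (intro sum.cong refl) (simp add: cp_tensor_3[OF ABC] sum_distrib_right)
  finally show ?thesis .
qed

lemma trilinear_close:
  assumes ABC: "A \<in> carrier_mat m R" "B \<in> carrier_mat n R" "C \<in> carrier_mat p R"
    and ABC': "A' \<in> carrier_mat m R" "B' \<in> carrier_mat n R" "C' \<in> carrier_mat p R"
    and close: "tensor_fnorm [m, n, p] (\<lambda>ix. cp_tensor R [A', B', C'] ix - cp_tensor R [A, B, C] ix) \<le> e"
  shows "\<bar>(\<Sum>r<R. inner (col_seq A r) x * inner (col_seq B r) y * inner (col_seq C r) z)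
     - (\<Sum>r<R. inner (col_seq A' r) x * inner (col_seq B' r) y * inner (col_seq C' r) z)\<bar>
     \<le> e * norm x * norm y * norm z"
proof -
  let ?D = "\<lambda>i j k. cp_tensor R [A', B', C'] [i, j, k] - cp_tensor R [A, B, C] [i, j, k]"
  have "(\<Sum>r<R. inner (col_seq A' r) x * inner (col_seq B' r) y * inner (col_seq C' r) z)
     - (\<Sum>r<R. inner (col_seq A r) x * inner (col_seq B r) y * inner (col_seq C r) z)
     = (\<Sum>i<m. \<Sum>j<n. \<Sum>k<p. ?D i j k *
        Poly_Mapping.lookup x i * Poly_Mapping.lookup y j * Poly_Mapping.lookup z k)"
    unfolding trilinear_col_seq[OF ABC] trilinear_col_seq[OF ABC']
    by (simp only: sum_subtractf[symmetric] left_diff_distrib)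
  also have "\<bar>\<dots>\<bar> \<le> tensor_fnorm [m, n, p] (\<lambda>ix. cp_tensor R [A', B', C'] ix - cp_tensor R [A, B, C] ix)
      * norm x * norm y * norm z"
    unfolding tensor_fnorm_3 by (rule trilinear_form_le)
  also have "\<dots> \<le> e * norm x * norm y * norm z"
    using close by (intro mult_right_mono) auto
  finally show ?thesis by (simp only: abs_minus_commute)
qed

section \<open>Frobenius norms of the recovered factors\<close>

lemma mat_fnorm_le:
  assumes X: "X \<in> carrier_mat n R" and R: "real R \<le> L" and L: "1 \<le> L"
    and d: "0 \<le> d" "\<And>r. r < R \<Longrightarrow> sqrt (\<Sum>i<n. (X $$ (i, r))\<^sup>2) \<le> d"
  shows "mat_fnorm X \<le> L * d"
proof -
  have "(\<Sum>i<n. \<Sum>r<R. (X $$ (i, r))\<^sup>2) = (\<Sum>r<R. \<Sum>i<n. (X $$ (i, r))\<^sup>2)" by (rule sum.swap)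
  also have "\<dots> \<le> (\<Sum>r<R. d\<^sup>2)"
    using d(2) by (intro sum_mono sqrt_le_D) auto
  also have "\<dots> = real R * d\<^sup>2" by simp
  also have "\<dots> \<le> (L * L) * d\<^sup>2"
  proof (rule mult_right_mono)
    have "L * 1 \<le> L * L" using L by (intro mult_left_mono) auto
    with R show "real R \<le> L * L" by simp
  qed simp
  also have "\<dots> = (L * d)\<^sup>2" by (simp add: power2_eq_square)
  finally show ?thesis
    unfolding mat_fnorm_def using X L d(1) by (intro real_le_lsqrt) (auto intro: sum_nonneg)
qed

text \<open>\<open>p\<close> gives the row of the entry 1, so column \<open>j\<close> of the product
  comes from column \<open>p j\<close> of \<open>A\<close>: the same direction as
  \<open>\<pi>\<close>, which maps primed columns to unprimed ones.\<close>

lemma index_mult_permutation_diagonal: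
  fixes A :: "real mat"
  assumes A: "A \<in> carrier_mat n R" and p: "p permutes {..<R}" and ij: "i < n" "j < R"
  shows "(A * mat R R (\<lambda>(i, j). if i = p j then 1 else 0)
      * mat R R (\<lambda>(i, j). if i = j then d j else 0)) $$ (i, j) = d j * A $$ (i, p j)"
proof -
  let ?P = "mat R R (\<lambda>(i, j). if i = p j then 1 else 0) :: real mat"
  have pj: "p l < R" if "l < R" for l using permutes_in_image[OF p] that by simp
  have AP: "(A * ?P) $$ (i, l) = A $$ (i, p l)" if "l < R" for l
  proof -
    have "(A * ?P) $$ (i, l) = (\<Sum>q<R. A $$ (i, q) * (if q = p l then 1 else 0))"
      using A ij that by (simp add: scalar_prod_def atLeast0LessThan)
    also have "\<dots> = (\<Sum>q<R. if q = p l then A $$ (i, q) else 0)" by (intro sum.cong) auto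
    finally show ?thesis using pj[OF that] by simp
  qed
  have "(A * ?P * mat R R (\<lambda>(i, j). if i = j then d j else 0)) $$ (i, j)
      = (\<Sum>q<R. (A * ?P) $$ (i, q) * (if q = j then d j else 0))"
    using A ij by (simp add: scalar_prod_def atLeast0LessThan)
  also have "\<dots> = (\<Sum>q<R. if q = j then (A * ?P) $$ (i, q) * d q else 0)" by (intro sum.cong) auto
  finally show ?thesis using ij AP by (simp add: mult.commute)
qed

lemma mat_fnorm_diff_permutation_diagonal_le:
  assumes A: "A \<in> carrier_mat n R" "A' \<in> carrier_mat n R" and p: "p permutes {..<R}"
    and R: "real R \<le> L" "1 \<le> L" and e: "0 \<le> e"
    and close: "\<And>r. r < R \<Longrightarrow> norm (col_seq A' r - d r *\<^sub>R col_seq A (p r)) \<le> e"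
  shows "mat_fnorm (A' - A * mat R R (\<lambda>(i, j). if i = p j then 1 else 0)
      * mat R R (\<lambda>(i, j). if i = j then d j else 0)) \<le> L * e"
proof (rule mat_fnorm_le[OF _ R e])
  show "A' - A * mat R R (\<lambda>(i, j). if i = p j then 1 else 0)
      * mat R R (\<lambda>(i, j). if i = j then d j else 0) \<in> carrier_mat n R"
    using A by (intro minus_carrier_mat mult_carrier_mat[of _ n R]) auto
  fix r assume r: "r < R"
  have "norm (col_seq A' r - d r *\<^sub>R col_seq A (p r)) = sqrt (\<Sum>i<n. (A' $$ (i, r) - d r * A $$ (i, p r))\<^sup>2)"
    using A by (simp add: col_seq_def fin_seq_scaleR fin_seq_diff norm_fin_seq)
  moreover have "(A' - A * mat R R (\<lambda>(i, j). if i = p j then 1 else 0)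
      * mat R R (\<lambda>(i, j). if i = j then d j else 0)) $$ (i, r) = A' $$ (i, r) - d r * A $$ (i, p r)"
    if "i < n" for i
    using index_mult_permutation_diagonal[OF A(1) p that r, of d] A r that by simp
  ultimately show "sqrt (\<Sum>i<n. ((A' - A * mat R R (\<lambda>(i, j). if i = p j then 1 else 0)
      * mat R R (\<lambda>(i, j). if i = j then d j else 0)) $$ (i, r))\<^sup>2) \<le> e"
    using close[OF r] by simp
qed

lemma mat_fnorm_diagonals_le:
  assumes R: "real R \<le> L" "1 \<le> L" and e: "0 \<le> e"
    and close: "\<And>r. r < R \<Longrightarrow> \<bar>d1 r * d2 r * d3 r - 1\<bar> \<le> e"
  shows "mat_fnorm (mat R R (\<lambda>(i, j). if i = j then d1 j else 0) * mat R R (\<lambda>(i, j). if i = j then d2 j else 0)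
    * mat R R (\<lambda>(i, j). if i = j then d3 j else 0) - 1\<^sub>m R) \<le> L * e" (is "mat_fnorm ?X \<le> _")
proof (rule mat_fnorm_le[OF _ R e])
  show "?X \<in> carrier_mat R R" by (intro minus_carrier_mat one_carrier_mat)
  let ?D = "\<lambda>d. mat R R (\<lambda>(i, j). if i = j then d j else 0) :: real mat"
  have mult: "?D d * ?D d' = ?D (\<lambda>j. d j * d' j)" for d d'
  proof (rule eq_matI)
    fix i j assume ij: "i < dim_row (?D (\<lambda>j. d j * d' j))" "j < dim_col (?D (\<lambda>j. d j * d' j))"
    have "(?D d * ?D d') $$ (i, j) = (\<Sum>q<R. (if i = q then d q else 0) * (if q = j then d' j else 0))"
      using ij by (simp add: scalar_prod_def atLeast0LessThan)
    also have "\<dots> = (\<Sum>q<R. if q = i then (if i = j then d j * d' j else 0) else 0)"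
      by (intro sum.cong) auto
    finally show "(?D d * ?D d') $$ (i, j) = ?D (\<lambda>j. d j * d' j) $$ (i, j)" using ij by simp
  qed auto
  fix r assume r: "r < R"
  have "(\<Sum>i<R. (?X $$ (i, r))\<^sup>2) = (\<Sum>i<R. if i = r then (d1 r * d2 r * d3 r - 1)\<^sup>2 else 0)"
    unfolding mult using r by (intro sum.cong) auto
  then show "sqrt (\<Sum>i<R. (?X $$ (i, r))\<^sup>2) \<le> e" using r close[OF r] by simp
qed

section \<open>The polynomial and the size of its factors\<close>

lemma polynomial4_monomial: "polynomial4 (\<lambda>w x y z. (b * w * x * y * z) ^ d)"
  unfolding polynomial4_def
proof (intro exI allI)
  fix w x y z :: real
  have single: "(\<Sum>i\<le>d. f i) = f d" if "\<And>i. i \<noteq> d \<Longrightarrow> f i = 0" for f :: "nat \<Rightarrow> real"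
    using that by (subst sum.remove[of _ d]) auto
  show "(b * w * x * y * z) ^ d = (\<Sum>i\<le>d. \<Sum>j\<le>d. \<Sum>k\<le>d. \<Sum>l\<le>d.
      (\<lambda>i j k l. if i = d \<and> j = d \<and> k = d \<and> l = d then b ^ d else 0) i j k l * w ^ i * x ^ j * y ^ k * z ^ l)"
    by (subst single, simp)+ (simp add: power_mult_distrib)
qed

lemma le_mult3:
  fixes a b c :: real
  assumes "1 \<le> a" "1 \<le> b" "1 \<le> c"
  shows "a \<le> a * b * c" "b \<le> a * b * c" "c \<le> a * b * c"
proof -
  have "1 * 1 \<le> b * c" "1 * 1 \<le> a * c" "1 * 1 \<le> a * b" using assms by (intro mult_mono; simp)+
  then have "a * 1 \<le> a * (b * c)" "b * 1 \<le> b * (a * c)" "c * 1 \<le> c * (a * b)"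
    using assms by (intro mult_left_mono; simp)+
  then show "a \<le> a * b * c" "b \<le> a * b * c" "c \<le> a * b * c" by (simp_all add: mult_ac)
qed

text \<open>In the last bound the 100 stays with \<open>z\<close>; this makes the base at least 100
  and leaves room to bound \<open>R\<close>.\<close>

lemma le_factors:
  fixes w x y z :: real
  assumes "1 \<le> w" "1 \<le> x" "1 \<le> y" "1 \<le> z"
  shows "w \<le> 100 * w * x * y * z" "x \<le> 100 * w * x * y * z" "y \<le> 100 * w * x * y * z"
    "100 * z \<le> 100 * w * x * y * z"
proof -
  have wxy: "w \<le> w * x * y" "x \<le> w * x * y" "y \<le> w * x * y" using assms by (intro le_mult3; simp)+
  then have "1 \<le> w * x * y" using assms by linarith
  from le_mult3[OF this assms(4) order_refl]
  have "w * x * y \<le> w * x * y * z" "z \<le> w * x * y * z" by simp_all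
  moreover have "100 * w * x * y * z = 100 * (w * x * y * z)" by simp
  ultimately show "w \<le> 100 * w * x * y * z" "x \<le> 100 * w * x * y * z" "y \<le> 100 * w * x * y * z"
    "100 * z \<le> 100 * w * x * y * z" using wxy assms by linarith+
qed

theorem theorem2p6:
  shows "\<exists>\<theta> :: real \<Rightarrow> real \<Rightarrow> real \<Rightarrow> real \<Rightarrow> real.
    polynomial4 \<theta> \<and>
    (\<forall>\<tau> \<rho> \<rho>'. \<forall>n::nat. \<tau> \<ge> 1 \<and> \<rho> \<ge> 1 \<and> \<rho>' \<ge> 1 \<and> n \<ge> 1 \<longrightarrow> \<theta> \<tau> \<rho> \<rho>' (real n) > 0) \<and>
    (\<forall>(R::nat) (n\<^sub>A::nat) (n\<^sub>B::nat) (n\<^sub>C::nat) (A::real mat) (B::real mat) (C::real mat)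
      (k\<^sub>A::nat) (k\<^sub>B::nat) (k\<^sub>C::nat)
      (\<tau>\<^sub>A::real) (\<tau>\<^sub>B::real) (\<tau>\<^sub>C::real) (\<rho>\<^sub>A::real) (\<rho>\<^sub>B::real) (\<rho>\<^sub>C::real)
      (\<rho>'\<^sub>A::real) (\<rho>'\<^sub>B::real) (\<rho>'\<^sub>C::real) (\<epsilon>'::real) (\<epsilon>::real).
      \<tau>\<^sub>A \<ge> 1 \<and> \<tau>\<^sub>B \<ge> 1 \<and> \<tau>\<^sub>C \<ge> 1 \<and> \<rho>\<^sub>A \<ge> 1 \<and> \<rho>\<^sub>B \<ge> 1 \<and> \<rho>\<^sub>C \<ge> 1 \<and>
      \<rho>'\<^sub>A \<ge> 1 \<and> \<rho>'\<^sub>B \<ge> 1 \<and> \<rho>'\<^sub>C \<ge> 1 \<and>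
      A \<in> carrier_mat n\<^sub>A R \<and> B \<in> carrier_mat n\<^sub>B R \<and> C \<in> carrier_mat n\<^sub>C R \<and>
      col_bounded \<rho>\<^sub>A A \<and> col_bounded \<rho>\<^sub>B B \<and> col_bounded \<rho>\<^sub>C C \<and>
      K_rank \<tau>\<^sub>A A = k\<^sub>A \<and> K_rank \<tau>\<^sub>B B = k\<^sub>B \<and> K_rank \<tau>\<^sub>C C = k\<^sub>C \<and>
      k\<^sub>A + k\<^sub>B + k\<^sub>C \<ge> 2 * R + 2 \<and>
      0 < \<epsilon>' \<and> \<epsilon>' < 1 \<and>
      \<epsilon> = \<epsilon>' / (real R ^ 6 * \<theta> \<tau>\<^sub>A \<rho>\<^sub>A \<rho>'\<^sub>A (real n\<^sub>A) * \<theta> \<tau>\<^sub>B \<rho>\<^sub>B \<rho>'\<^sub>B (real n\<^sub>B)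
                          * \<theta> \<tau>\<^sub>C \<rho>\<^sub>C \<rho>'\<^sub>C (real n\<^sub>C)) \<longrightarrow>
      (\<forall>A' B' C'.
        A' \<in> carrier_mat n\<^sub>A R \<and> B' \<in> carrier_mat n\<^sub>B R \<and> C' \<in> carrier_mat n\<^sub>C R \<and>
        col_bounded \<rho>'\<^sub>A A' \<and> col_bounded \<rho>'\<^sub>B B' \<and> col_bounded \<rho>'\<^sub>C C' \<and>
        tensor_fnorm [n\<^sub>A, n\<^sub>B, n\<^sub>C]
          (\<lambda>ix. cp_tensor R [A', B', C'] ix - cp_tensor R [A, B, C] ix) \<le> \<epsilon> \<longrightarrow>
        (\<exists>P L\<^sub>A L\<^sub>B L\<^sub>C.
          permutation_matrix R P \<and>
          L\<^sub>A \<in> carrier_mat R R \<and> diagonal_mat L\<^sub>A \<and>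
          L\<^sub>B \<in> carrier_mat R R \<and> diagonal_mat L\<^sub>B \<and>
          L\<^sub>C \<in> carrier_mat R R \<and> diagonal_mat L\<^sub>C \<and>
          mat_fnorm (L\<^sub>A * L\<^sub>B * L\<^sub>C - 1\<^sub>m R) \<le> \<epsilon>' \<and>
          mat_fnorm (A' - A * P * L\<^sub>A) \<le> \<epsilon>' \<and>
          mat_fnorm (B' - B * P * L\<^sub>B) \<le> \<epsilon>' \<and>
          mat_fnorm (C' - C * P * L\<^sub>C) \<le> \<epsilon>')))"
proof (rule exI[of _ "\<lambda>w x y z. (100 * w * x * y * z) ^ 40"], intro conjI allI impI)
  let ?\<theta> = "\<lambda>w x y z :: real. (100 * w * x * y * z) ^ 40"
  show "polynomial4 ?\<theta>" by (rule polynomial4_monomial)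
  show "?\<theta> \<tau> \<rho> \<rho>' (real n) > 0" if "\<tau> \<ge> 1 \<and> \<rho> \<ge> 1 \<and> \<rho>' \<ge> 1 \<and> n \<ge> 1" for \<tau> \<rho> \<rho>' n
    using that by simp
  fix R n\<^sub>A n\<^sub>B n\<^sub>C A B C k\<^sub>A k\<^sub>B k\<^sub>C \<tau>\<^sub>A \<tau>\<^sub>B \<tau>\<^sub>C \<rho>\<^sub>A \<rho>\<^sub>B \<rho>\<^sub>C \<rho>'\<^sub>A \<rho>'\<^sub>B \<rho>'\<^sub>C \<epsilon>' \<epsilon> A' B' C'
  assume "\<tau>\<^sub>A \<ge> 1 \<and> \<tau>\<^sub>B \<ge> 1 \<and> \<tau>\<^sub>C \<ge> 1 \<and> \<rho>\<^sub>A \<ge> 1 \<and> \<rho>\<^sub>B \<ge> 1 \<and> \<rho>\<^sub>C \<ge> 1 \<and>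
      \<rho>'\<^sub>A \<ge> 1 \<and> \<rho>'\<^sub>B \<ge> 1 \<and> \<rho>'\<^sub>C \<ge> 1 \<and>
      A \<in> carrier_mat n\<^sub>A R \<and> B \<in> carrier_mat n\<^sub>B R \<and> C \<in> carrier_mat n\<^sub>C R \<and>
      col_bounded \<rho>\<^sub>A A \<and> col_bounded \<rho>\<^sub>B B \<and> col_bounded \<rho>\<^sub>C C \<and>
      K_rank \<tau>\<^sub>A A = k\<^sub>A \<and> K_rank \<tau>\<^sub>B B = k\<^sub>B \<and> K_rank \<tau>\<^sub>C C = k\<^sub>C \<and>
      k\<^sub>A + k\<^sub>B + k\<^sub>C \<ge> 2 * R + 2 \<and>
      0 < \<epsilon>' \<and> \<epsilon>' < 1 \<and>
      \<epsilon> = \<epsilon>' / (real R ^ 6 * ?\<theta> \<tau>\<^sub>A \<rho>\<^sub>A \<rho>'\<^sub>A (real n\<^sub>A) * ?\<theta> \<tau>\<^sub>B \<rho>\<^sub>B \<rho>'\<^sub>B (real n\<^sub>B)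
                          * ?\<theta> \<tau>\<^sub>C \<rho>\<^sub>C \<rho>'\<^sub>C (real n\<^sub>C))"
  then have \<tau>: "\<tau>\<^sub>A \<ge> 1" "\<tau>\<^sub>B \<ge> 1" "\<tau>\<^sub>C \<ge> 1"
    and \<rho>: "\<rho>\<^sub>A \<ge> 1" "\<rho>\<^sub>B \<ge> 1" "\<rho>\<^sub>C \<ge> 1" and \<rho>': "\<rho>'\<^sub>A \<ge> 1" "\<rho>'\<^sub>B \<ge> 1" "\<rho>'\<^sub>C \<ge> 1"
    and ABC: "A \<in> carrier_mat n\<^sub>A R" "B \<in> carrier_mat n\<^sub>B R" "C \<in> carrier_mat n\<^sub>C R"
    and bounded: "col_bounded \<rho>\<^sub>A A" "col_bounded \<rho>\<^sub>B B" "col_bounded \<rho>\<^sub>C C"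
    and K: "K_rank \<tau>\<^sub>A A = k\<^sub>A" "K_rank \<tau>\<^sub>B B = k\<^sub>B" "K_rank \<tau>\<^sub>C C = k\<^sub>C"
    and k_sum: "k\<^sub>A + k\<^sub>B + k\<^sub>C \<ge> 2 * R + 2" and \<epsilon>': "0 < \<epsilon>'" "\<epsilon>' < 1"
    and \<epsilon>: "\<epsilon> = \<epsilon>' / (real R ^ 6 * ?\<theta> \<tau>\<^sub>A \<rho>\<^sub>A \<rho>'\<^sub>A (real n\<^sub>A) * ?\<theta> \<tau>\<^sub>B \<rho>\<^sub>B \<rho>'\<^sub>B (real n\<^sub>B)
                          * ?\<theta> \<tau>\<^sub>C \<rho>\<^sub>C \<rho>'\<^sub>C (real n\<^sub>C))"
    by blast+
  assume "A' \<in> carrier_mat n\<^sub>A R \<and> B' \<in> carrier_mat n\<^sub>B R \<and> C' \<in> carrier_mat n\<^sub>C R \<and>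
        col_bounded \<rho>'\<^sub>A A' \<and> col_bounded \<rho>'\<^sub>B B' \<and> col_bounded \<rho>'\<^sub>C C' \<and>
        tensor_fnorm [n\<^sub>A, n\<^sub>B, n\<^sub>C]
          (\<lambda>ix. cp_tensor R [A', B', C'] ix - cp_tensor R [A, B, C] ix) \<le> \<epsilon>"
  then have ABC': "A' \<in> carrier_mat n\<^sub>A R" "B' \<in> carrier_mat n\<^sub>B R" "C' \<in> carrier_mat n\<^sub>C R"
    and bounded': "col_bounded \<rho>'\<^sub>A A'" "col_bounded \<rho>'\<^sub>B B'" "col_bounded \<rho>'\<^sub>C C'"
    and close: "tensor_fnorm [n\<^sub>A, n\<^sub>B, n\<^sub>C]
          (\<lambda>ix. cp_tensor R [A', B', C'] ix - cp_tensor R [A, B, C] ix) \<le> \<epsilon>"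
    by blast+
  have kR: "k\<^sub>A \<le> R" "k\<^sub>B \<le> R" "k\<^sub>C \<le> R"
    using K_rank_cases(1)[OF K(1)] K_rank_cases(1)[OF K(2)] K_rank_cases(1)[OF K(3)] ABC by auto
  have kn: "k\<^sub>A \<le> n\<^sub>A" "k\<^sub>B \<le> n\<^sub>B" "k\<^sub>C \<le> n\<^sub>C"
    using K_rank_le_dim_row[OF ABC(1) K(1)] K_rank_le_dim_row[OF ABC(2) K(2)]
      K_rank_le_dim_row[OF ABC(3) K(3)] \<tau> by auto
  \<comment> \<open>Any two of the three ranks add up to at most \<open>2 * R\<close>, so each is at
    least 2; this also makes the denominator of \<open>\<epsilon>\<close> positive.\<close>
  have n: "1 \<le> n\<^sub>A" "1 \<le> n\<^sub>B" "1 \<le> n\<^sub>C" and R2: "2 \<le> R"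
    using kR kn k_sum by linarith+
  define a b c where "a = 100 * \<tau>\<^sub>A * \<rho>\<^sub>A * \<rho>'\<^sub>A * real n\<^sub>A"
    and "b = 100 * \<tau>\<^sub>B * \<rho>\<^sub>B * \<rho>'\<^sub>B * real n\<^sub>B" and "c = 100 * \<tau>\<^sub>C * \<rho>\<^sub>C * \<rho>'\<^sub>C * real n\<^sub>C"
  \<comment> \<open>A product instead of a maximum: the three values of the polynomial then multiply
    to exactly \<open>L ^ 40\<close>, and as all factors are at least 1, \<open>L\<close> still
    dominates every parameter.\<close>
  define L where "L = a * b * c"
  note factorA = le_factors[OF \<tau>(1) \<rho>(1) \<rho>'(1), of "real n\<^sub>A", folded a_def]
  note factorB = le_factors[OF \<tau>(2) \<rho>(2) \<rho>'(2), of "real n\<^sub>B", folded b_def]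
  note factorC = le_factors[OF \<tau>(3) \<rho>(3) \<rho>'(3), of "real n\<^sub>C", folded c_def]
  have abc: "100 \<le> a" "100 \<le> b" "100 \<le> c"
    using factorA(4) factorB(4) factorC(4) n by auto
  have aL: "a \<le> L" "b \<le> L" "c \<le> L"
    unfolding L_def using abc by (intro le_mult3; simp)+
  have L100: "100 \<le> L" using abc aL by linarith
  have RL: "real R \<le> L"
  proof -
    have "real (2 * R + 2) \<le> real (n\<^sub>A + n\<^sub>B + n\<^sub>C)" using kn k_sum by (intro of_nat_mono) linarith
    then show ?thesis using factorA(4) factorB(4) factorC(4) n aL L100 by simp
  qed
  have \<epsilon>L: "\<epsilon> = \<epsilon>' / (real R ^ 6 * L ^ 40)"
    unfolding \<epsilon> L_def a_def b_def c_def by (simp only: power_mult_distrib mult.assoc)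
  have \<epsilon>0: "0 < \<epsilon>" unfolding \<epsilon>L using \<epsilon>' R2 L100 by simp
  have L\<epsilon>: "L ^ 40 * \<epsilon> \<le> \<epsilon>'"
  proof -
    have "1 \<le> real R ^ 6" using R2 by (intro one_le_power) auto
    then have "\<epsilon>' / real R ^ 6 \<le> \<epsilon>' / 1" using \<epsilon>' R2 by (intro divide_left_mono) auto
    then show ?thesis unfolding \<epsilon>L using L100 by simp
  qed
  interpret cp_approx_bounded "{..<R}" k\<^sub>A k\<^sub>B k\<^sub>C L \<epsilon> "col_seq A" "col_seq A'" "col_seq B" "col_seq B'"
    "col_seq C" "col_seq C'"
  proof (intro cp_approx_bounded.intro cp_approx.intro cp_approx_bounded_axioms.intro)
    show "well_conditioned k\<^sub>A L {..<R} (col_seq A)"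
      using factorA(1) n aL \<tau> by (intro well_conditioned_col_seq[OF ABC(1) K(1)]) auto
    show "well_conditioned k\<^sub>B L {..<R} (col_seq B)"
      using factorB(1) n aL \<tau> by (intro well_conditioned_col_seq[OF ABC(2) K(2)]) auto
    show "well_conditioned k\<^sub>C L {..<R} (col_seq C)"
      using factorC(1) n aL \<tau> by (intro well_conditioned_col_seq[OF ABC(3) K(3)]) auto
    fix x y z :: "nat \<Rightarrow>\<^sub>0 real"
    show "\<bar>(\<Sum>r<R. inner (col_seq A r) x * inner (col_seq B r) y * inner (col_seq C r) z)
       - (\<Sum>r<R. inner (col_seq A' r) x * inner (col_seq B' r) y * inner (col_seq C' r) z)\<bar>
       \<le> \<epsilon> * norm x * norm y * norm z"
      by (rule trilinear_close[OF ABC ABC' close])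
  next
    fix r assume "r \<in> {..<R}"
    then have r: "r < R" by simp
    show "norm (col_seq A r) \<le> L" "norm (col_seq A' r) \<le> L"
      using norm_col_seq_le[OF ABC(1) bounded(1) r] norm_col_seq_le[OF ABC'(1) bounded'(1) r]
        factorA(2,3) n aL by auto
    show "norm (col_seq B r) \<le> L" "norm (col_seq B' r) \<le> L"
      using norm_col_seq_le[OF ABC(2) bounded(2) r] norm_col_seq_le[OF ABC'(2) bounded'(2) r]
        factorB(2,3) n aL by auto
    show "norm (col_seq C r) \<le> L" "norm (col_seq C' r) \<le> L"
      using norm_col_seq_le[OF ABC(3) bounded(3) r] norm_col_seq_le[OF ABC'(3) bounded'(3) r]
        factorC(2,3) n aL by auto
  qed (use L100 RL kR k_sum \<epsilon>0 L\<epsilon> \<epsilon>' in auto)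
  obtain \<pi> \<alpha> \<beta> \<gamma> where \<pi>: "bij_betw \<pi> {..<R} {..<R}"
    and near: "\<And>s. s < R \<Longrightarrow> norm (col_seq A' s - \<alpha> s *\<^sub>R col_seq A (\<pi> s)) \<le> L ^ 27 * \<epsilon>"
      "\<And>s. s < R \<Longrightarrow> norm (col_seq B' s - \<beta> s *\<^sub>R col_seq B (\<pi> s)) \<le> L ^ 27 * \<epsilon>"
      "\<And>s. s < R \<Longrightarrow> norm (col_seq C' s - \<gamma> s *\<^sub>R col_seq C (\<pi> s)) \<le> L ^ 27 * \<epsilon>"
      "\<And>s. s < R \<Longrightarrow> \<bar>\<alpha> s * \<beta> s * \<gamma> s - 1\<bar> \<le> L ^ 34 * \<epsilon>"
    using robust_uniqueness by (metis lessThan_iff)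
  \<comment> \<open>\<open>permutes\<close> asks for the identity outside of \<open>{..<R}\<close>,
    where \<open>\<pi>\<close> is arbitrary.\<close>
  define p where "p i = (if i < R then \<pi> i else i)" for i
  have p: "p permutes {..<R}"
  proof (rule bij_imp_permutes)
    show "bij_betw p {..<R} {..<R}" using \<pi> by (rule bij_betw_cong[THEN iffD1, rotated]) (simp add: p_def)
  qed (simp add: p_def)
  \<comment> \<open>Passing from columns to Frobenius norms costs one more power of
    \<open>L\<close>: the exponents 27 and 34 become 28 and 35, within 40.\<close>
  have le: "L * (L ^ m * \<epsilon>) \<le> \<epsilon>'" if "m < 39" for m
  proof -
    have "L * (L ^ m * \<epsilon>) = L ^ Suc m * \<epsilon>" by simp
    also have "\<dots> \<le> L ^ 40 * \<epsilon>"
      using that L100 \<epsilon>0 by (intro mult_right_mono power_increasing) auto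
    finally show ?thesis using L\<epsilon> by simp
  qed
  have e0: "0 \<le> L ^ m * \<epsilon>" for m using \<epsilon>0 L100 by simp
  have L1: "1 \<le> L" using L100 by simp
  let ?P = "mat R R (\<lambda>(i, j). if i = p j then 1 else 0) :: real mat"
  let ?D = "\<lambda>d. mat R R (\<lambda>(i, j). if i = j then d j else 0) :: real mat"
  have P: "permutation_matrix R ?P" unfolding permutation_matrix_def using p by blast
  have D: "?D \<alpha> \<in> carrier_mat R R" "?D \<beta> \<in> carrier_mat R R" "?D \<gamma> \<in> carrier_mat R R" by simp_all
  have diag: "diagonal_mat (?D \<alpha>)" "diagonal_mat (?D \<beta>)" "diagonal_mat (?D \<gamma>)"
    by (auto simp: diagonal_mat_def)
  have 1: "mat_fnorm (?D \<alpha> * ?D \<beta> * ?D \<gamma> - 1\<^sub>m R) \<le> \<epsilon>'"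
    by (rule order_trans[OF mat_fnorm_diagonals_le[OF RL L1 e0 near(4)] le]) simp_all
  have near': "norm (col_seq A' r - \<alpha> r *\<^sub>R col_seq A (p r)) \<le> L ^ 27 * \<epsilon>"
    "norm (col_seq B' r - \<beta> r *\<^sub>R col_seq B (p r)) \<le> L ^ 27 * \<epsilon>"
    "norm (col_seq C' r - \<gamma> r *\<^sub>R col_seq C (p r)) \<le> L ^ 27 * \<epsilon>" if "r < R" for r
    using near that by (simp_all add: p_def)
  have 2: "mat_fnorm (A' - A * ?P * ?D \<alpha>) \<le> \<epsilon>'"
    by (rule order_trans[OF mat_fnorm_diff_permutation_diagonal_le[OF ABC(1) ABC'(1) p RL L1 e0 near'(1)] le])
      simp_all
  have 3: "mat_fnorm (B' - B * ?P * ?D \<beta>) \<le> \<epsilon>'"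
    by (rule order_trans[OF mat_fnorm_diff_permutation_diagonal_le[OF ABC(2) ABC'(2) p RL L1 e0 near'(2)] le])
      simp_all
  have 4: "mat_fnorm (C' - C * ?P * ?D \<gamma>) \<le> \<epsilon>'"
    by (rule order_trans[OF mat_fnorm_diff_permutation_diagonal_le[OF ABC(3) ABC'(3) p RL L1 e0 near'(3)] le])
      simp_all
  show "\<exists>P L\<^sub>A L\<^sub>B L\<^sub>C.
          permutation_matrix R P \<and>
          L\<^sub>A \<in> carrier_mat R R \<and> diagonal_mat L\<^sub>A \<and>
          L\<^sub>B \<in> carrier_mat R R \<and> diagonal_mat L\<^sub>B \<and>
          L\<^sub>C \<in> carrier_mat R R \<and> diagonal_mat L\<^sub>C \<and>
          mat_fnorm (L\<^sub>A * L\<^sub>B * L\<^sub>C - 1\<^sub>m R) \<le> \<epsilon>' \<and>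
          mat_fnorm (A' - A * P * L\<^sub>A) \<le> \<epsilon>' \<and>
          mat_fnorm (B' - B * P * L\<^sub>B) \<le> \<epsilon>' \<and>
          mat_fnorm (C' - C * P * L\<^sub>C) \<le> \<epsilon>'"
    by (rule exI[of _ ?P], rule exI[of _ "?D \<alpha>"], rule exI[of _ "?D \<beta>"], rule exI[of _ "?D \<gamma>"],
        intro conjI P D diag 1 2 3 4)
qed

end
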